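(* Let $n,m\ge1$, let $K\subset\mathbb{R}^{2n}$ and $T\subset\mathbb{R}^{2m}$ be convex bodies containing the origin, and let $1\le p\le\infty$. Then $$ c_{\rm EHZ}(K\times_pT)=\begin{cases}\min\{c_{\rm EHZ}(K),c_{\rm EHZ}(T)\}, & 2\le p\le\infty,\\[4pt] \Big(c_{\rm EHZ}(K)^{\frac{p}{p-2}}+c_{\rm EHZ}(T)^{\frac{p}{p-2}}\Big)^{\frac{p-2}{p}}, & 1\le p<2.\end{cases}$$
   Context: A convex body in $\mathbb{R}^d$ is a compact convex set with non-empty interior. The space $\mathbb{R}^{2n}$ carries the standard symplectic form $\omega_n=dq\wedge dp$, and $\mathbb{R}^{2n}\times\mathbb{R}^{2m}\cong\mathbb{R}^{2(n+m)}$ carries the product symplectic form; $J$ is the standard linear complex structure. $p$-product: for $1\le p<\infty$, $K\times_p T=\bigcup_{0\le t\le1}\big((1-t)^{1/p}K\times t^{1/p}T\big)\subset\mathbb{R}^{2n}\times\mathbb{R}^{2m}$, and $K\times_\infty T=K\times T$. Equivalently, in terms of gauge functions, $\|(x,y)\|_{K\times_pT}^p=\|x\|_K^p+\|y\|_T^p$ for $p<\infty$ and $\|(x,y)\|_{K\times_\infty T}=\max\{\|x\|_K,\|y\|_T\}$. Capacity: for a convex body $K\subset\mathbb{R}^{2n}$ with smooth boundary, $c_{\rm EHZ}(K)$ is the minimal symplectic action $A(\gamma)=\int_\gamma\lambda$ ($d\lambda=\omega_n$) among closed characteristics $\gamma$ on $\partial K$, i.e. closed integral curves of the line field $\ker\omega_n|_{\partial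 K}$ (oriented along $J n_K$, with $n_K$ the outer unit normal). For a general convex body, $c_{\rm EHZ}$ is the extension of this by continuity in the Hausdorff metric; equivalently it is the minimal action among generalized closed characteristics, i.e. non-constant absolutely continuous closed curves $\gamma\subset\partial K$ with $\dot\gamma(t)\in J N_K(\gamma(t))$ for almost every $t$, where $N_K(x)$ is the outer normal cone of $K$ at $x$. *)

theory Defs
  imports "HOL-Analysis.Analysis"
begin

definition convex_body :: "'a::euclidean_space set \<Rightarrow> bool" where
  "convex_body K \<longleftrightarrow> compact K \<and> convex K \<and> interior K \<noteq> {}"

(* The space R^(2n) is the type (real^'n) * (real^'n) with coordinates (q, p), and
   R^(2n) * R^(2m) is the product type itself.  The symplectic notions below take the
   complex structure J as a parameter, so that they apply both to the standard J and to
   the product structure map_prod J J.  The sign of J is chosen so that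
   omega J u v = J u \<bullet> v is dq \<and> dp and omega J u (J u) > 0 for u \<noteq> 0. *)

definition J_std :: "(real^'n) \<times> (real^'n) \<Rightarrow> (real^'n) \<times> (real^'n)" where
  "J_std z = (- snd z, fst z)"

definition omega :: "('a::euclidean_space \<Rightarrow> 'a) \<Rightarrow> 'a \<Rightarrow> 'a \<Rightarrow> real" where
  "omega J u v = J u \<bullet> v"

lemma omega_std: "omega J_std u v = fst u \<bullet> snd v - snd u \<bullet> fst v"
  by (simp add: omega_def J_std_def inner_prod_def)

lemma omega_prod:
  "omega (map_prod J1 J2) u v = omega J1 (fst u) (fst v) + omega J2 (snd u) (snd v)"
  by (simp add: omega_def inner_prod_def)

definition normal_cone :: "'a::euclidean_space set \<Rightarrow> 'a \<Rightarrow> 'a set" where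
  "normal_cone K x = {v. \<forall>y\<in>K. v \<bullet> (y - x) \<le> 0}"

definition absolutely_continuous_curve :: "(real \<Rightarrow> 'a::euclidean_space) \<Rightarrow> bool" where
  "absolutely_continuous_curve \<gamma> \<longleftrightarrow>
     (\<forall>\<epsilon>>0. \<exists>\<delta>>0. \<forall>D. D division_of \<Union>D \<and> \<Union>D \<subseteq> {0..1} \<and> (\<Sum>I\<in>D. Sup I - Inf I) < \<delta>
        \<longrightarrow> (\<Sum>I\<in>D. norm (\<gamma> (Sup I) - \<gamma> (Inf I))) < \<epsilon>)"

(* Curves are parametrised by [0,1]; as the normal cone is invariant under scaling by
   positive reals, this loses no generality. *)
definition generalized_closed_characteristic ::
    "('a::euclidean_space \<Rightarrow> 'a) \<Rightarrow> 'a set \<Rightarrow> (real \<Rightarrow> 'a) \<Rightarrow> bool" where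
  "generalized_closed_characteristic J K \<gamma> \<longleftrightarrow>
     absolutely_continuous_curve \<gamma> \<and> pathstart \<gamma> = pathfinish \<gamma> \<and>
     \<not> \<gamma> constant_on {0..1} \<and> path_image \<gamma> \<subseteq> frontier K \<and>
     (AE t in lebesgue. t \<in> {0..1} \<longrightarrow>
        (\<exists>v \<in> normal_cone K (\<gamma> t). (\<gamma> has_vector_derivative J v) (at t)))"

(* The integral along \<gamma> of the primitive x \<mapsto> omega J x (-) / 2 of omega J; for closed
   curves every primitive gives the same value. *)
definition action :: "('a::euclidean_space \<Rightarrow> 'a) \<Rightarrow> (real \<Rightarrow> 'a) \<Rightarrow> real" where
  "action J \<gamma> = integral {0..1} (\<lambda>t. omega J (\<gamma> t) (vector_derivative \<gamma> (at t)) / 2)"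

(* For a convex body the infimum is a minimum. *)
definition c_EHZ :: "('a::euclidean_space \<Rightarrow> 'a) \<Rightarrow> 'a set \<Rightarrow> real" where
  "c_EHZ J K = Inf {action J \<gamma> |\<gamma>. generalized_closed_characteristic J K \<gamma>}"

definition p_product ::
    "ereal \<Rightarrow> 'a::euclidean_space set \<Rightarrow> 'b::euclidean_space set \<Rightarrow> ('a \<times> 'b) set" where
  "p_product p K T =
     (if p = \<infinity> then K \<times> T
      else \<Union>t\<in>{0..1}. ((*\<^sub>R) ((1 - t) powr (1 / real_of_ereal p)) ` K) \<times>
                       ((*\<^sub>R) (t powr (1 / real_of_ereal p)) ` T))"

end

theory Submission
  imports Defs "HOL-Complex_Analysis.Great_Picard"
begin

text \<open>The capacity of a convex body is governed by an isoperimetric inequality. Write \<open>h_K(v)\<close> for the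
support function, the maximum of \<open>\<langle>v, k\<rangle>\<close> over \<open>k \<in> K\<close>, and let \<open>\<gamma>\<close> be a closed curve of action \<open>A\<close> with
velocity \<open>J v\<close>. Then \<open>c(K) A \<le> (L / 2)\<^sup>2\<close>, where \<open>L\<close> is the integral of \<open>h_K(v)\<close> along \<open>\<gamma>\<close>; this is
\<open>isoperimetric_inequality\<close>. Some closed characteristic has action exactly \<open>c(K)\<close>
(\<open>minimal_characteristic\<close>), and equality holds for it. In contrast to the definition of the
capacity, the inequality can be tested with any closed curve, and the theorem follows from it in both
directions.

Both facts come from Clarke's dual principle. If the origin is an interior point of \<open>K\<close>, let the
action be maximised among the closed curves on \<open>[0,1]\<close> whose velocity lies in \<open>J\<close> of the polar body of
\<open>K\<close>. These curves are uniformly Lipschitz, so a maximiser \<open>z\<close> exists by the Arzela-Ascoli theorem.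
Comparison with other closed curves, a Lagrange multiplier for the closing condition and a local
modification of \<open>z\<close> show, up to a translation, that the velocity of \<open>z\<close> is \<open>J v(t)\<close> with \<open>v(t)\<close>
maximising the inner product with \<open>z(t)\<close> over the polar body. The maximum is the gauge of \<open>K\<close> at
\<open>z(t)\<close>. It is constant in time, and hence a multiple of \<open>z\<close> runs on the boundary of \<open>K\<close> as a closed
characteristic. An arbitrary closed curve becomes a competitor of \<open>z\<close> after a reparametrisation by
the integral of \<open>h_K(v)\<close>, which gives the isoperimetric inequality. A translation of \<open>K\<close> changes \<open>h_K(v)\<close> by
the derivative of a periodic function, so the inequality carries over to every convex body.

Now let \<open>(x, y)\<close> be a characteristic of the p-product \<open>P\<close> with velocity \<open>J (v, w)\<close> and action \<open>A\<close>. Its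
action is half the integral of the support function of \<open>P\<close>, which dominates \<open>a h_K(v) + b h_T(w)\<close> for all
\<open>a, b \<ge> 0\<close> in the unit ball of the p-norm. With \<open>l1\<close> and \<open>l2\<close> for the integrals of \<open>h_K(v)\<close> and \<open>h_T(w)\<close>, this
says \<open>2 A \<ge> a l1 + b l2\<close>, whereas \<open>A = A(x) + A(y) \<le> l1\<^sup>2 / 4 c(K) + l2\<^sup>2 / 4 c(T)\<close> by the isoperimetric
inequality in the factors. Eliminating \<open>l1\<close> and \<open>l2\<close> with the Hoelder inequality gives the lower bound
(\<open>c_EHZ_lower_bound\<close>). For the upper bound (\<open>c_EHZ_upper_bound\<close>) the isoperimetric inequality of \<open>P\<close> is
tested with the curve \<open>(a X, b Y)\<close>, where \<open>X\<close> and \<open>Y\<close> are minimal characteristics of the factors, both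
run at constant speed. For \<open>p \<ge> 2\<close> one of \<open>a\<close>, \<open>b\<close> is zero.

The remaining ingredient is real analysis: absolutely continuous curves with a derivative almost
everywhere obey the fundamental theorem of calculus, and Lipschitz curves are of this kind.\<close>

section \<open>Lipschitz curves are differentiable almost everywhere\<close>

text \<open>The push-forward \<open>M\<close> of Lebesgue measure under the inverse of \<open>F\<close> gives \<open>{x..y}\<close> the mass
\<open>F y - F x\<close>. It is absolutely continuous because \<open>F\<close>, being Lipschitz, maps null sets to null
sets, and \<open>g\<close> is its Radon-Nikodym density. The lower bound on the increments of \<open>F\<close> is what makes
the inverse exist.\<close>

lemma lipschitz_increasing_imp_integral:
  fixes F :: "real \<Rightarrow> real"
  assumes lo: "\<And>x y. x \<le> y \<Longrightarrow> y - x \<le> F y - F x"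
    and hi: "\<And>x y. x \<le> y \<Longrightarrow> F y - F x \<le> L * (y - x)"
  obtains g where "\<And>x y. x \<le> y \<Longrightarrow> (g has_integral (F y - F x)) {x..y}"
proof -
  have mono: "x \<le> y \<longleftrightarrow> F x \<le> F y" for x y
    using lo[of x y] lo[of y x] by force
  have inj: "inj F"
    by (rule injI) (metis mono order_antisym order_refl)
  have L0: "L \<ge> 0"
    using lo[of 0 1] hi[of 0 1] by simp
  have lip: "\<bar>F x - F y\<bar> \<le> L * \<bar>x - y\<bar>" for x y
    using hi[of x y] hi[of y x] lo[of x y] lo[of y x] by (cases "x \<le> y") auto
  have contF: "continuous_on S F" for S
  proof (rule lipschitz_on_continuous_on[where L=L])
    show "L-lipschitz_on S F"
      using L0 lip by (auto simp: lipschitz_on_def dist_real_def)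
  qed
  have surj: "\<exists>x. F x = y" for y
  proof -
    define R where "R = \<bar>y - F 0\<bar>"
    have "F (- R) \<le> y" "y \<le> F R"
      using lo[of "-R" 0] lo[of 0 R] unfolding R_def by linarith+
    then show ?thesis
      using IVT'[of F "-R" y R] contF unfolding R_def by force
  qed
  define H where "H = inv F"
  have FH: "F (H y) = y" for y
    unfolding H_def using surj by (metis f_inv_into_f rangeI)
  have HF: "H (F x) = x" for x
    unfolding H_def using inj by simp
  have "1-lipschitz_on UNIV H"
  proof (rule lipschitz_onI)
    fix x y
    show "dist (H x) (H y) \<le> 1 * dist x y"
      using lo[of "H x" "H y"] lo[of "H y" "H x"] by (cases "H x \<le> H y") (auto simp: FH dist_real_def)
  qed auto
  then have [measurable]: "H \<in> borel_measurable borel"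
    by (intro borel_measurable_continuous_onI lipschitz_on_continuous_on)
  define M where "M = distr lborel borel H"
  have vim: "H -` A = F ` A" for A
    using FH HF by (auto simp: image_iff) metis
  have emM: "emeasure M A = emeasure lborel (F ` A)" if "A \<in> sets borel" for A
    unfolding M_def using that by (subst emeasure_distr) (auto simp: vim)
  have ac: "absolutely_continuous lborel M"
    unfolding absolutely_continuous_def
  proof
    fix A assume A: "A \<in> null_sets (lborel::real measure)"
    then have "negligible A"
      by (simp add: negligible_iff_null_sets null_sets_completionI)
    then have "negligible (F ` A)"
      by (intro negligible_locally_Lipschitz_image)
        (auto intro!: exI[of _ UNIV] exI[of _ L] simp: lip)
    then have "emeasure lebesgue (F ` A) = 0"
      by (simp add: negligible_iff_null_sets null_setsD1)
    moreover have "F ` A \<in> sets borel"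
      using A measurable_sets[of H borel borel A] by (auto simp: vim null_sets_def)
    ultimately have "emeasure M A = 0"
      using A emM[of A] by (auto simp: null_sets_def)
    then show "A \<in> null_sets M"
      using A by (auto simp: null_sets_def M_def)
  qed
  define g0 where "g0 = RN_deriv lborel M"
  have g0m[measurable]: "g0 \<in> borel_measurable borel"
    unfolding g0_def using borel_measurable_RN_deriv[of lborel M] by simp
  have dens: "density lborel g0 = M"
    unfolding g0_def by (rule sigma_finite_measure.density_RN_deriv[OF sigma_finite_lborel]) (use ac in \<open>auto simp: M_def\<close>)
  have Fint: "F ` {x..y} = {F x..F y}" for x y
  proof (intro equalityI subsetI)
    fix z assume "z \<in> {F x..F y}"
    then show "z \<in> F ` {x..y}"
      by (metis FH atLeastAtMost_iff image_eqI mono)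
  qed (use mono in auto)
  have I: "(\<integral>\<^sup>+t. g0 t * indicator {x..y} t \<partial>lborel) = ennreal (F y - F x)" if "x \<le> y" for x y
  proof -
    have "(\<integral>\<^sup>+t. g0 t * indicator {x..y} t \<partial>lborel) = emeasure (density lborel g0) {x..y}"
      by (simp add: emeasure_density)
    also have "\<dots> = ennreal (F y - F x)"
      unfolding dens using that mono by (simp add: emM Fint)
    finally show ?thesis .
  qed
  define g where "g = (\<lambda>t. enn2real (g0 t))"
  show ?thesis
  proof
    fix x y :: real assume xy: "x \<le> y"
    have "AE t in lborel. g0 t * indicator {x..y} t \<noteq> \<infinity>"
      by (rule nn_integral_PInf_AE) (use I[OF xy] in auto)
    then have "(\<integral>\<^sup>+t. g0 t * indicator {x..y} t \<partial>lborel) = (\<integral>\<^sup>+t. ennreal (g t * indicator {x..y} t) \<partial>lborel)"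
      by (intro nn_integral_cong_AE) (auto simp: g_def indicator_def less_top)
    then have "(\<integral>\<^sup>+t. ennreal (g t * indicator {x..y} t) \<partial>lborel) = ennreal (F y - F x)"
      using I[OF xy] by simp
    then have "((\<lambda>t. g t * indicator {x..y} t) has_integral (F y - F x)) UNIV"
      by (intro nn_integral_has_integral) (use xy mono in \<open>auto simp: g_def\<close>)
    then have "((\<lambda>t. if t \<in> {x..y} then g t else 0) has_integral (F y - F x)) UNIV"
      by (rule has_integral_eq[rotated]) auto
    then show "(g has_integral (F y - F x)) {x..y}"
      by (simp only: has_integral_restrict_UNIV)
  qed
qed

lemma right_left_derivative_imp:
  fixes F :: "real \<Rightarrow> real"
  assumes r: "\<And>e. e > 0 \<Longrightarrow> \<exists>d>0. \<forall>h. 0 < h \<and> h < d \<longrightarrow> \<bar>(F (t + h) - F t) / h - c\<bar> < e"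
    and l: "\<And>e. e > 0 \<Longrightarrow> \<exists>d>0. \<forall>h. 0 < h \<and> h < d \<longrightarrow> \<bar>(F t - F (t - h)) / h - c\<bar> < e"
  shows "(F has_real_derivative c) (at t)"
  unfolding DERIV_def LIM_def
proof (intro allI impI)
  fix e :: real assume e: "0 < e"
  obtain d1 where d1: "d1 > 0" "\<And>h. 0 < h \<Longrightarrow> h < d1 \<Longrightarrow> \<bar>(F (t + h) - F t) / h - c\<bar> < e"
    using r[OF e] by blast
  obtain d2 where d2: "d2 > 0" "\<And>h. 0 < h \<Longrightarrow> h < d2 \<Longrightarrow> \<bar>(F t - F (t - h)) / h - c\<bar> < e"
    using l[OF e] by blast
  show "\<exists>s>0. \<forall>x. x \<noteq> 0 \<and> dist x 0 < s \<longrightarrow> dist ((F (t + x) - F t) / x) c < e"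
  proof (intro exI[of _ "min d1 d2"] conjI allI impI)
    fix x :: real assume x: "x \<noteq> 0 \<and> dist x 0 < min d1 d2"
    show "dist ((F (t + x) - F t) / x) c < e"
    proof (cases "x > 0")
      case True then show ?thesis using d1(2)[of x] x by (simp add: dist_real_def)
    next
      case False
      then have "(F t - F (t - (- x))) / (- x) = (F (t + x) - F t) / x"
        by (simp add: minus_divide_left)
      then show ?thesis using d2(2)[of "-x"] x False by (simp add: dist_real_def)
    qed
  qed (use d1 d2 in auto)
qed

text \<open>Adding a multiple of the identity makes \<open>f\<close> increasing at a positive rate, so that it is an
indefinite integral of some \<open>g\<close>. The averages of \<open>g\<close> over intervals to the right of a point
converge almost everywhere to the value of \<open>g\<close>; the averages to the left are treated by reflecting \<open>g\<close>.\<close>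

lemma lipschitz_real_differentiable_AE:
  fixes f :: "real \<Rightarrow> real"
  assumes lip: "\<And>x y. \<bar>f x - f y\<bar> \<le> C * \<bar>x - y\<bar>"
  shows "negligible {t. \<not> f differentiable (at t)}"
proof -
  have C: "C \<ge> 0" using lip[of 1 0] by simp
  define F where "F t = f t + (C + 1) * t" for t
  have lo: "y - x \<le> F y - F x" if "x \<le> y" for x y
    using lip[of x y] that by (auto simp: F_def algebra_simps abs_le_iff)
  have hi: "F y - F x \<le> (2 * C + 1) * (y - x)" if "x \<le> y" for x y
    using lip[of x y] that by (auto simp: F_def algebra_simps abs_le_iff)
  obtain g where g: "\<And>x y. x \<le> y \<Longrightarrow> (g has_integral (F y - F x)) {x..y}"
    using lipschitz_increasing_imp_integral[OF lo hi] by blast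
  have gi: "g integrable_on cbox a b" for a b
    using g[of a b] by (cases "a \<le> b") (auto simp: has_integral_integrable cbox_interval)
  have gm: "((\<lambda>t. g (- t)) has_integral (F (- x) - F (- y))) {x..y}" if "x \<le> y" for x y
    using g[of "-y" "-x"] that has_integral_reflect_real[where f=g and a="-y" and b="-x"] by simp
  have gmi: "(\<lambda>t. g (- t)) integrable_on cbox a b" for a b
    using gm[of a b] by (cases "a \<le> b") (auto simp: has_integral_integrable cbox_interval)
  obtain N1 where N1: "negligible N1"
    "\<And>x e. \<lbrakk>x \<notin> N1; 0 < e\<rbrakk> \<Longrightarrow> \<exists>d>0. \<forall>h. 0 < h \<and> h < d \<longrightarrow>
        norm (integral (cbox x (x + h *\<^sub>R One)) g /\<^sub>R h ^ DIM(real) - g x) < e"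
    using integrable_ccontinuous_explicit[OF gi] by blast
  obtain N2 where N2: "negligible N2"
    "\<And>x e. \<lbrakk>x \<notin> N2; 0 < e\<rbrakk> \<Longrightarrow> \<exists>d>0. \<forall>h. 0 < h \<and> h < d \<longrightarrow>
        norm (integral (cbox x (x + h *\<^sub>R One)) (\<lambda>t. g (- t)) /\<^sub>R h ^ DIM(real) - g (- x)) < e"
    using integrable_ccontinuous_explicit[OF gmi] by blast
  have "F differentiable (at t)" if t: "t \<notin> N1 \<union> uminus ` N2" for t
  proof -
    have "(F has_real_derivative g t) (at t)"
    proof (rule right_left_derivative_imp)
      fix e :: real assume "e > 0"
      then obtain d where d: "d > 0" "\<And>h. 0 < h \<and> h < d \<Longrightarrow>
          norm (integral (cbox t (t + h *\<^sub>R One)) g /\<^sub>R h ^ DIM(real) - g t) < e"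
        using N1(2)[of t e] t by blast
      have "integral (cbox t (t + h *\<^sub>R One)) g = F (t + h) - F t" if "0 < h" for h
        using g[of t "t + h"] that by (simp add: integral_unique)
      then show "\<exists>d>0. \<forall>h. 0 < h \<and> h < d \<longrightarrow> \<bar>(F (t + h) - F t) / h - g t\<bar> < e"
        using d by (intro exI[of _ d]) (auto simp: divide_inverse mult.commute)
    next
      fix e :: real assume "e > 0"
      moreover have "- t \<notin> N2" using t by force
      ultimately obtain d where d: "d > 0" "\<And>h. 0 < h \<and> h < d \<Longrightarrow>
          norm (integral (cbox (-t) (-t + h *\<^sub>R One)) (\<lambda>t. g (- t)) /\<^sub>R h ^ DIM(real) - g t) < e"
        using N2(2)[of "-t" e] by auto
      have "integral (cbox (-t) (-t + h *\<^sub>R One)) (\<lambda>t. g (- t)) = F t - F (t - h)" if "0 < h" for h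
        using gm[of "-t" "-t + h"] that by (simp add: integral_unique)
      then show "\<exists>d>0. \<forall>h. 0 < h \<and> h < d \<longrightarrow> \<bar>(F t - F (t - h)) / h - g t\<bar> < e"
        using d by (intro exI[of _ d]) (auto simp: divide_inverse mult.commute)
    qed
    then show ?thesis
      by (metis real_differentiable_def)
  qed
  moreover have "f differentiable (at t)" if "F differentiable (at t)" for t
  proof -
    have "(\<lambda>s. F s - (C + 1) * s) differentiable (at t)"
      using that by (intro derivative_intros)
    moreover have "(\<lambda>s. F s - (C + 1) * s) = f"
      by (auto simp: F_def)
    ultimately show ?thesis by simp
  qed
  ultimately have "{t. \<not> f differentiable (at t)} \<subseteq> N1 \<union> uminus ` N2"
    by blast
  moreover have "negligible (uminus ` N2)"
  proof (rule negligible_locally_Lipschitz_image)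
    fix x
    have "\<forall>y\<in>N2 \<inter> UNIV. norm (- y - - x) \<le> 1 * norm (y - x)"
      by auto
    then show "\<exists>T B. open T \<and> x \<in> T \<and> (\<forall>y\<in>N2 \<inter> T. norm (- y - - x) \<le> B * norm (y - x))"
      by blast
  qed (use N2 in auto)
  ultimately show ?thesis
    using N1(1) negligible_Un negligible_subset by blast
qed

lemma lipschitz_on_differentiable_AE:
  fixes f :: "real \<Rightarrow> 'a::euclidean_space"
  assumes lip: "C-lipschitz_on {a..b} f"
  shows "negligible {t \<in> {a..b}. \<not> f differentiable (at t)}"
proof (cases "a \<le> b")
  case True
  define c where "c t = max a (min b t)" for t :: real
  have c: "c t \<in> {a..b}" for t using True by (auto simp: c_def)
  have neg: "negligible {t. \<not> (\<lambda>t. f (c t) \<bullet> i) differentiable (at t)}" if i: "i \<in> Basis" for i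
  proof (rule lipschitz_real_differentiable_AE)
    fix x y
    have "\<bar>f (c x) \<bullet> i - f (c y) \<bullet> i\<bar> \<le> norm (f (c x) - f (c y))"
      using Basis_le_norm[OF i, of "f (c x) - f (c y)"] by (simp add: inner_diff_left)
    also have "\<dots> \<le> C * dist (c x) (c y)"
      using lipschitz_onD[OF lip c c] by (simp add: dist_norm)
    also have "\<dots> \<le> C * \<bar>x - y\<bar>"
      by (intro mult_left_mono lipschitz_on_nonneg[OF lip]) (auto simp: c_def dist_real_def)
    finally show "\<bar>f (c x) \<bullet> i - f (c y) \<bullet> i\<bar> \<le> C * \<bar>x - y\<bar>" .
  qed
  have diff: "f differentiable (at t)"
    if t: "t \<in> {a<..<b}" and d: "\<And>i. i \<in> Basis \<Longrightarrow> (\<lambda>t. f (c t) \<bullet> i) differentiable (at t)" for t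
  proof -
    have "(\<lambda>t. f (c t)) differentiable (at t)"
      using d by (subst differentiable_componentwise_within) auto
    then obtain D where "((\<lambda>t. f (c t)) has_derivative D) (at t)"
      unfolding differentiable_def by blast
    then have "(f has_derivative D) (at t)"
      by (rule has_derivative_transform_within_open[of _ _ _ _ "{a<..<b}"])
        (use t in \<open>auto simp: c_def\<close>)
    then show ?thesis unfolding differentiable_def by blast
  qed
  have "{t \<in> {a..b}. \<not> f differentiable (at t)} \<subseteq>
      {a, b} \<union> (\<Union>i\<in>Basis. {t. \<not> (\<lambda>t. f (c t) \<bullet> i) differentiable (at t)})"
  proof
    fix t assume t: "t \<in> {t \<in> {a..b}. \<not> f differentiable (at t)}"
    show "t \<in> {a, b} \<union> (\<Union>i\<in>Basis. {t. \<not> (\<lambda>t. f (c t) \<bullet> i) differentiable (at t)})"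
    proof (cases "t \<in> {a<..<b}")
      case True
      then show ?thesis using diff[OF True] t by blast
    next
      case False
      then have "t = a \<or> t = b" using t by auto
      then show ?thesis by blast
    qed
  qed
  moreover have "negligible ({a, b} \<union> (\<Union>i\<in>Basis. {t. \<not> (\<lambda>t. f (c t) \<bullet> i) differentiable (at t)}))"
    using neg by (intro negligible_Un negligible_Union) (auto intro: negligible_finite)
  ultimately show ?thesis
    using negligible_subset by blast
qed auto

section \<open>Absolutely continuous curves\<close>

text \<open>Closed characteristics come with a derivative almost everywhere, and Lipschitz curves have one by
the previous lemma. Including it here avoids the theorem that absolute continuity alone implies
differentiability almost everywhere.\<close>

definition ac_curve :: "(real \<Rightarrow> 'a::euclidean_space) \<Rightarrow> bool" where
  "ac_curve \<gamma> \<longleftrightarrow> absolutely_continuous_curve \<gamma> \<and> negligible {t \<in> {0..1}. \<not> \<gamma> differentiable (at t)}"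

abbreviation velocity :: "(real \<Rightarrow> 'a::euclidean_space) \<Rightarrow> real \<Rightarrow> 'a" where
  "velocity \<gamma> t \<equiv> vector_derivative \<gamma> (at t)"

lemma ac_curve_AE_differentiable:
  assumes "ac_curve \<gamma>"
  shows "negligible {t \<in> {0..1}. \<not> (\<gamma> has_vector_derivative velocity \<gamma> t) (at t)}"
  using assms unfolding ac_curve_def by (simp add: vector_derivative_works)

text \<open>The inner condition of \<open>absolutely_continuous_curve\<close>, with the two bounds as parameters.\<close>

definition variation_below :: "(real \<Rightarrow> 'a::real_normed_vector) \<Rightarrow> real \<Rightarrow> real \<Rightarrow> bool" where
  "variation_below \<gamma> \<delta> \<epsilon> \<longleftrightarrow>
     (\<forall>D. D division_of \<Union>D \<and> \<Union>D \<subseteq> {0..1} \<and> (\<Sum>I\<in>D. Sup I - Inf I) < \<delta>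
        \<longrightarrow> (\<Sum>I\<in>D. norm (\<gamma> (Sup I) - \<gamma> (Inf I))) < \<epsilon>)"

lemma ac_curve_iff:
  "ac_curve \<gamma> \<longleftrightarrow> (\<forall>\<epsilon>>0. \<exists>\<delta>>0. variation_below \<gamma> \<delta> \<epsilon>) \<and>
     negligible {t \<in> {0..1}. \<not> \<gamma> differentiable (at t)}"
  unfolding ac_curve_def absolutely_continuous_curve_def variation_below_def ..

lemma ac_curve_obtain_delta:
  assumes "ac_curve \<gamma>" "e > 0"
  obtains \<delta> where "\<delta> > 0" "variation_below \<gamma> \<delta> e"
  using assms unfolding ac_curve_iff by blast

lemma division_length_eq_measure:
  fixes D :: "real set set"
  assumes "D division_of S"
  shows "(\<Sum>I\<in>D. Sup I - Inf I) = measure lebesgue S"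
proof -
  note D = division_ofD[OF assms]
  have "measure lebesgue (\<Union>D) = (\<Sum>I\<in>D. measure lebesgue I)"
  proof (rule measure_negligible_finite_Union)
    show "pairwise (\<lambda>S T. negligible (S \<inter> T)) D"
    proof (rule pairwiseI)
      fix I K assume IK: "I \<in> D" "K \<in> D" "I \<noteq> K"
      obtain a b where I: "I = cbox a b" using D(4) IK by blast
      obtain c d where K: "K = cbox c d" using D(4) IK by blast
      have "interior (I \<inter> K) = {}" using D(5)[OF IK] by simp
      moreover obtain e f where IK': "I \<inter> K = cbox e f"
      proof
        show "I \<inter> K = cbox (max a c) (min b d)" unfolding I K by auto
      qed
      ultimately show "negligible (I \<inter> K)"
        by (metis interior_cbox negligible_interval(1))
    qed
  qed (use D in auto)
  also have "\<dots> = (\<Sum>I\<in>D. Sup I - Inf I)"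
  proof (rule sum.cong)
    fix I assume "I \<in> D"
    then obtain a b where "I = cbox a b" "I \<noteq> {}" using D by metis
    then show "measure lebesgue I = Sup I - Inf I" by auto
  qed simp
  finally show ?thesis using D(6) by simp
qed

text \<open>The exceptional null set has an open neighbourhood \<open>U\<close> of small measure. In a tagged division that is
fine enough, the intervals with an exceptional tag lie in \<open>U\<close>, and absolute continuity bounds the sum
of the increments over them. On the other intervals the increment is close to the derivative
at the tag times the length.\<close>

lemma ac_curve_has_integral_velocity:
  assumes ac: "ac_curve \<gamma>" and ab: "0 \<le> a" "a \<le> b" "b \<le> 1"
  shows "(velocity \<gamma> has_integral (\<gamma> b - \<gamma> a)) {a..b}"
proof -
  define N where "N = {t \<in> {0..1}. \<not> (\<gamma> has_vector_derivative velocity \<gamma> t) (at t)}"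
  have N: "negligible N"
    unfolding N_def using ac_curve_AE_differentiable[OF ac] .
  define f where "f t = (if t \<in> N then 0 else velocity \<gamma> t)" for t
  have "(f has_integral (\<gamma> b - \<gamma> a)) {a..b}"
    unfolding has_integral_real
  proof (intro allI impI)
    fix e :: real assume e: "e > 0"
    define e1 where "e1 = e / (2 * (b - a + 1))"
    have "e1 > 0" using e ab by (simp add: e1_def)
    moreover have "e1 * (b - a + 1) = e / 2"
    proof -
      have "b - a + 1 \<noteq> 0" using ab by simp
      then show ?thesis unfolding e1_def by (metis nonzero_eq_divide_eq times_divide_eq_left divide_divide_eq_left mult.commute)
    qed
    ultimately have e1: "e1 > 0" "e1 * (b - a) < e / 2" unfolding distrib_left by linarith+
    obtain \<delta> where \<delta>: "\<delta> > 0"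
      "variation_below \<gamma> \<delta> (e / 2)"
      by (rule ac_curve_obtain_delta[OF ac half_gt_zero[OF e]])
    \<comment> \<open>Null sets have open neighbourhoods of arbitrarily small measure.\<close>
    obtain U where U: "open U" "N \<subseteq> U" "U - N \<in> lmeasurable" "emeasure lebesgue (U - N) < ennreal \<delta>"
      using sets_lebesgue_outer_open[OF negligible_imp_sets[OF N] \<delta>(1)] by blast
    have Um: "U \<in> lmeasurable" "measure lebesgue U < \<delta>"
    proof -
      have Ueq: "U = (U - N) \<union> N" using U by auto
      show "U \<in> lmeasurable"
        using U(3) negligible_imp_measurable[OF N] Ueq by (metis fmeasurable.Un)
      have "measure lebesgue U \<le> measure lebesgue (U - N) + measure lebesgue N"
        by (subst Ueq) (intro measure_Un_le, use U(3) negligible_imp_sets[OF N] in auto)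
      also have "\<dots> < \<delta>"
        using U(3,4) \<delta>(1) negligible_imp_measure0[OF N]
        by (simp add: emeasure_eq_measure2 ennreal_less_iff)
      finally show "measure lebesgue U < \<delta>" .
    qed
    have "\<exists>d>0. x \<in> {0..1} - N \<longrightarrow>
         (\<forall>y. norm (y-x) < d \<longrightarrow> norm (\<gamma> y - \<gamma> x - (y-x) *\<^sub>R f x) \<le> e1 * norm (y-x))" for x
    proof (cases "x \<in> {0..1} - N")
      case True
      then have "(\<gamma> has_vector_derivative f x) (at x)"
        by (auto simp: N_def f_def)
      then show ?thesis
        using e1 unfolding has_vector_derivative_def has_derivative_at_alt by blast
    qed (auto intro!: exI[of _ 1])
    then obtain d where d: "\<And>x. 0 < d x"
        "\<And>x y. \<lbrakk>x \<in> {0..1} - N; norm (y-x) < d x\<rbrakk>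
           \<Longrightarrow> norm (\<gamma> y - \<gamma> x - (y-x) *\<^sub>R f x) \<le> e1 * norm (y-x)"
      by metis
    define g where "g x = (if x \<in> N then U else ball x (d x))" for x
    have "gauge g"
      using U d(1) by (auto simp: gauge_def g_def)
    moreover have "norm ((\<Sum>(x,k)\<in>p. measure lborel k *\<^sub>R f x) - (\<gamma> b - \<gamma> a)) < e"
      if ptag: "p tagged_division_of {a..b}" and fine: "g fine p" for p
    proof -
      define A where "A = {xk \<in> p. fst xk \<in> N}"
      have fin: "finite p" using ptag by blast
      have K: "\<exists>u v. K = cbox u v \<and> u \<le> v \<and> Sup K = v \<and> Inf K = u \<and> x \<in> K \<and> K \<subseteq> {a..b} \<and> K \<subseteq> g x"
        if xK: "(x, K) \<in> p" for x K
      proof -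
        have 1: "x \<in> K" "K \<subseteq> {a..b}" using ptag xK by blast+
        obtain u v where uv: "K = cbox u v" using ptag xK by blast
        have "u \<le> v" using 1 uv by auto
        then show ?thesis using 1 uv fine xK by (auto simp: fine_def)
      qed
      have len: "b - a = (\<Sum>(x,K)\<in>p. Sup K - Inf K)" and
        tel: "\<gamma> b - \<gamma> a = (\<Sum>(x,K)\<in>p. \<gamma> (Sup K) - \<gamma> (Inf K))"
        using additive_tagged_division_1[where f= "\<lambda>x. x"] additive_tagged_division_1[where f= \<gamma>]
          ab ptag by auto
      have "(\<Sum>(x,k)\<in>p. measure lborel k *\<^sub>R f x) - (\<gamma> b - \<gamma> a)
          = (\<Sum>(x,K)\<in>p. measure lborel K *\<^sub>R f x - (\<gamma> (Sup K) - \<gamma> (Inf K)))"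
        by (simp add: tel split_def sum_subtractf)
      also have "\<dots> = (\<Sum>(x,K)\<in>p - A. measure lborel K *\<^sub>R f x - (\<gamma> (Sup K) - \<gamma> (Inf K))) +
          (\<Sum>(x,K)\<in>A. measure lborel K *\<^sub>R f x - (\<gamma> (Sup K) - \<gamma> (Inf K)))"
        by (rule sum.subset_diff) (auto simp: A_def fin)
      finally have eq: "(\<Sum>(x,k)\<in>p. measure lborel k *\<^sub>R f x) - (\<gamma> b - \<gamma> a) = \<dots>" .
      have "norm (\<Sum>(x,K)\<in>p - A. measure lborel K *\<^sub>R f x - (\<gamma> (Sup K) - \<gamma> (Inf K)))
          \<le> (\<Sum>n\<in>p - A. e1 * (case n of (x, k) \<Rightarrow> Sup k - Inf k))"
      proof (rule sum_norm_le, clarify)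
        fix x K assume xK: "(x, K) \<in> p" "(x, K) \<notin> A"
        obtain u v where uv: "K = cbox u v" "u \<le> v" "x \<in> K" "K \<subseteq> {a..b}" "K \<subseteq> g x"
            "Sup K = v" "Inf K = u"
          using K[OF xK(1)] by blast
        have x: "x \<in> {0..1} - N" using xK uv ab by (auto simp: A_def)
        have "K \<subseteq> ball x (d x)" "u \<in> K" "v \<in> K"
          using uv x by (auto simp: g_def)
        then have "u \<in> ball x (d x)" "v \<in> ball x (d x)"
          by blast+
        then have du: "norm (\<gamma> u - \<gamma> x - (u - x) *\<^sub>R f x) \<le> e1 * norm (u - x)"
          and dv: "norm (\<gamma> v - \<gamma> x - (v - x) *\<^sub>R f x) \<le> e1 * norm (v - x)"
          by (intro d(2)[OF x]; simp add: dist_real_def)+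
        have "norm ((v - u) *\<^sub>R f x - (\<gamma> v - \<gamma> u))
          = norm (\<gamma> u - \<gamma> x - (u - x) *\<^sub>R f x - (\<gamma> v - \<gamma> x - (v - x) *\<^sub>R f x))"
          by (auto simp: algebra_simps)
        also have "\<dots> \<le> norm (\<gamma> u - \<gamma> x - (u - x) *\<^sub>R f x) + norm (\<gamma> v - \<gamma> x - (v - x) *\<^sub>R f x)"
          by (rule norm_triangle_ineq4)
        also have "\<dots> \<le> e1 * (v - u)"
          using du dv uv by (auto simp: algebra_simps)
        finally show "norm (measure lborel K *\<^sub>R f x - (\<gamma> (Sup K) - \<gamma> (Inf K))) \<le> e1 * (Sup K - Inf K)"
          using uv by simp
      qed
      also have "\<dots> \<le> (\<Sum>n\<in>p. e1 * (case n of (x, k) \<Rightarrow> Sup k - Inf k))"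
        by (rule sum_mono2) (use fin e1 K in \<open>force+\<close>)
      also have "\<dots> = e1 * (b - a)"
        by (simp add: len sum_distrib_left)
      finally have good: "norm (\<Sum>(x,K)\<in>p - A. measure lborel K *\<^sub>R f x - (\<gamma> (Sup K) - \<gamma> (Inf K))) < e / 2"
        using e1 by simp
      have Apart: "A tagged_partial_division_of {a..b}"
        using tagged_partial_division_subset[of p "{a..b}" A] ptag
        by (auto simp: A_def tagged_division_of_def)
      define D where "D = snd ` A"
      have D: "D division_of \<Union>D"
        unfolding D_def by (rule partial_division_of_tagged_division[OF Apart])
      have compD: "compact (\<Union>D)"
        using division_ofD(1,4)[OF D] by (metis compact_Union compact_cbox)
      have DU: "\<Union>D \<subseteq> U"
        using K by (fastforce simp: D_def A_def g_def)
      have Dab: "\<Union>D \<subseteq> {a..b}"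
        using K by (fastforce simp: D_def A_def)
      have "(\<Sum>I\<in>D. Sup I - Inf I) = measure lebesgue (\<Union>D)"
        by (rule division_length_eq_measure[OF D])
      also have "\<dots> \<le> measure lebesgue U"
        by (rule measure_mono_fmeasurable[OF DU _ Um(1)])
          (use compD in \<open>auto intro: lmeasurable_compact fmeasurableD\<close>)
      finally have "(\<Sum>I\<in>D. norm (\<gamma> (Sup I) - \<gamma> (Inf I))) < e / 2"
        using Um D Dab ab by (intro \<delta>(2)[unfolded variation_below_def, rule_format]) auto
      moreover have "(\<Sum>(x,K)\<in>A. norm (\<gamma> (Sup K) - \<gamma> (Inf K))) = (\<Sum>I\<in>D. norm (\<gamma> (Sup I) - \<gamma> (Inf I)))"
      proof -
        define h where "h K = (if K = {} then 0 else norm (\<gamma> (Sup K) - \<gamma> (Inf K)))" for K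
        have ne: "K \<noteq> {}" if "(x, K) \<in> A" for x K
          using K that by (force simp: A_def)
        have "(\<Sum>(x,K)\<in>A. h K) = (\<Sum>I\<in>D. h I)"
          unfolding D_def
        proof (rule sum.over_tagged_division_lemma[OF tagged_partial_division_of_Union_self[OF Apart]])
          fix u v :: real assume "box u v = {}"
          then have "v \<le> u" by simp
          then show "h (cbox u v) = 0"
            by (cases "u = v") (auto simp: h_def)
        qed
        moreover have "(\<Sum>(x,K)\<in>A. h K) = (\<Sum>(x,K)\<in>A. norm (\<gamma> (Sup K) - \<gamma> (Inf K)))"
          using ne by (intro sum.cong) (auto simp: h_def)
        moreover have "(\<Sum>I\<in>D. h I) = (\<Sum>I\<in>D. norm (\<gamma> (Sup I) - \<gamma> (Inf I)))"
          using ne by (intro sum.cong) (auto simp: h_def D_def)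
        ultimately show ?thesis by simp
      qed
      moreover have "norm (\<Sum>(x,K)\<in>A. measure lborel K *\<^sub>R f x - (\<gamma> (Sup K) - \<gamma> (Inf K)))
         \<le> (\<Sum>(x,K)\<in>A. norm (\<gamma> (Sup K) - \<gamma> (Inf K)))"
        by (rule sum_norm_le) (auto simp: A_def f_def norm_minus_commute)
      ultimately show ?thesis
        unfolding eq using good
          norm_triangle_ineq[of "\<Sum>(x,K)\<in>p - A. measure lborel K *\<^sub>R f x - (\<gamma> (Sup K) - \<gamma> (Inf K))"
            "\<Sum>(x,K)\<in>A. measure lborel K *\<^sub>R f x - (\<gamma> (Sup K) - \<gamma> (Inf K))"]
        by linarith
    qed
    ultimately show "\<exists>g. gauge g \<and> (\<forall>p. p tagged_division_of {a..b} \<and> g fine p \<longrightarrow>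
        norm ((\<Sum>(x,k)\<in>p. measure lborel k *\<^sub>R f x) - (\<gamma> b - \<gamma> a)) < e)"
      by (intro exI[of _ g] conjI allI impI) simp_all
  qed
  then show ?thesis
    by (intro has_integral_spike[OF N, where f = f and g = "velocity \<gamma>"]) (simp_all add: f_def)
qed

text \<open>On an interval shorter than the \<open>\<delta>\<close> that belongs to \<open>\<epsilon> = 1\<close> the variation is at most 1, and
finitely many such intervals cover \<open>[0,1]\<close>.\<close>

lemma ac_curve_velocity_absolutely_integrable:
  assumes ac: "ac_curve \<gamma>"
  shows "velocity \<gamma> absolutely_integrable_on {0..1}"
proof -
  note FTC = ac_curve_has_integral_velocity[OF ac]
  obtain \<delta> where \<delta>: "\<delta> > 0"
      "variation_below \<gamma> \<delta> 1"
    by (rule ac_curve_obtain_delta[OF ac zero_less_one])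
  have short: "velocity \<gamma> absolutely_integrable_on {a..b}" if ab: "0 \<le> a" "a \<le> b" "b \<le> 1" "b - a < \<delta>" for a b
  proof -
    have "velocity \<gamma> absolutely_integrable_on cbox a b"
    proof (rule bounded_variation_absolutely_integrable_interval[where B=1])
      show "velocity \<gamma> integrable_on cbox a b"
        using FTC ab by (auto simp: has_integral_integrable)
      fix D assume D: "D division_of cbox a b"
      have "(\<Sum>K\<in>D. norm (integral K (velocity \<gamma>))) = (\<Sum>I\<in>D. norm (\<gamma> (Sup I) - \<gamma> (Inf I)))"
      proof (rule sum.cong)
        fix I assume "I \<in> D"
        then obtain u v where uv: "I = cbox u v" "I \<noteq> {}" "I \<subseteq> cbox a b"
          using division_ofD(2-4)[OF D] by metis
        then have "(velocity \<gamma> has_integral (\<gamma> v - \<gamma> u)) {u..v}"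
          using ab by (intro FTC) auto
        then show "norm (integral I (velocity \<gamma>)) = norm (\<gamma> (Sup I) - \<gamma> (Inf I))"
          using uv by (auto simp: integral_unique)
      qed simp
      also have "\<dots> \<le> 1"
      proof -
        have U: "\<Union>D = {a..b}" using division_ofD(6)[OF D] by simp
        have "(\<Sum>I\<in>D. Sup I - Inf I) < \<delta>"
          using ab by (simp add: division_length_eq_measure[OF D])
        then show ?thesis
          using \<delta>(2)[unfolded variation_below_def, rule_format, of D] D U ab by auto
      qed
      finally show "(\<Sum>K\<in>D. norm (integral K (velocity \<gamma>))) \<le> 1" .
    qed
    then show ?thesis by simp
  qed
  obtain n :: nat where n: "n > 0" "1 / real n < \<delta>"
    using \<delta>(1) by (metis nat_approx_posE inverse_eq_divide of_nat_0_less_iff zero_less_Suc)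
  have "velocity \<gamma> absolutely_integrable_on {0..real k / n}" if "k \<le> n" for k
    using that
  proof (induction k)
    case 0
    then show ?case using absolutely_integrable_on_null[of 0 0 "velocity \<gamma>"] by simp
  next
    case (Suc k)
    have "velocity \<gamma> absolutely_integrable_on {real k / n..real (Suc k) / n}"
      by (rule short) (use n Suc in \<open>auto simp: field_simps\<close>)
    then show ?case
      using absolutely_integrable_on_combine[OF Suc.IH, of "real (Suc k) / n"] Suc.prems
      by (simp add: divide_right_mono)
  qed
  from this[of n] n show ?thesis by simp
qed

lemma lipschitz_imp_ac_curve:
  fixes \<gamma> :: "real \<Rightarrow> 'a::euclidean_space"
  assumes lip: "C-lipschitz_on {0..1} \<gamma>"
  shows "ac_curve \<gamma>"
  unfolding ac_curve_def
proof
  show "negligible {t \<in> {0..1}. \<not> \<gamma> differentiable (at t)}"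
    by (rule lipschitz_on_differentiable_AE[OF lip])
  have C: "C \<ge> 0" by (rule lipschitz_on_nonneg[OF lip])
  show "absolutely_continuous_curve \<gamma>"
    unfolding absolutely_continuous_curve_def
  proof (intro allI impI exI conjI)
    fix e :: real assume e: "e > 0"
    then show "e / (C + 1) > 0" using C by simp
    fix D assume D: "D division_of \<Union>D \<and> \<Union>D \<subseteq> {0..1} \<and> (\<Sum>I\<in>D. Sup I - Inf I) < e / (C + 1)"
    have "(\<Sum>I\<in>D. norm (\<gamma> (Sup I) - \<gamma> (Inf I))) \<le> (\<Sum>I\<in>D. C * (Sup I - Inf I))"
    proof (rule sum_mono)
      fix I assume I: "I \<in> D"
      then obtain u v where uv: "I = cbox u v" "I \<noteq> {}"
        using division_ofD(3,4) D by metis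
      then have "u \<le> v" by auto
      moreover have "I \<subseteq> {0..1}" using D I by blast
      ultimately have "u \<le> v" "u \<in> {0..1}" "v \<in> {0..1}" using uv by auto
      then show "norm (\<gamma> (Sup I) - \<gamma> (Inf I)) \<le> C * (Sup I - Inf I)"
        using lipschitz_onD[OF lip, of v u] uv by (simp add: dist_norm)
    qed
    also have "\<dots> = C * (\<Sum>I\<in>D. Sup I - Inf I)" by (simp add: sum_distrib_left)
    also have "\<dots> \<le> C * (e / (C + 1))" using D C by (intro mult_left_mono) auto
    also have "\<dots> < e" using e C by (simp add: field_simps)
    finally show "(\<Sum>I\<in>D. norm (\<gamma> (Sup I) - \<gamma> (Inf I))) < e" .
  qed
qed

lemma ac_curve_continuous_on:
  assumes ac: "ac_curve \<gamma>"
  shows "continuous_on {0..1} \<gamma>"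
proof -
  have "continuous_on {0..1} (\<lambda>t. \<gamma> 0 + integral {0..t} (velocity \<gamma>))"
    using ac_curve_has_integral_velocity[OF ac, of 0 1]
    by (intro continuous_intros indefinite_integral_continuous_1) (auto simp: has_integral_integrable)
  moreover have "\<gamma> 0 + integral {0..t} (velocity \<gamma>) = \<gamma> t" if "t \<in> {0..1}" for t
    using ac_curve_has_integral_velocity[OF ac, of 0 t] that by (simp add: integral_unique)
  ultimately show ?thesis
    by (simp cong: continuous_on_cong_simp)
qed

lemma inner_velocity_absolutely_integrable:
  assumes ac: "ac_curve \<gamma>" and \<phi>: "continuous_on {0..1} \<phi>"
  shows "(\<lambda>t. \<phi> t \<bullet> velocity \<gamma> t) absolutely_integrable_on {0..1}"
proof (rule absolutely_integrable_bounded_measurable_product[where h="(\<bullet>)"])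
  show "\<phi> \<in> borel_measurable (lebesgue_on {0..1})"
    by (intro continuous_imp_measurable_on_sets_lebesgue \<phi>) auto
  show "bounded (\<phi> ` {0..1})"
    by (intro compact_imp_bounded compact_continuous_image \<phi>) auto
qed (use ac_curve_velocity_absolutely_integrable[OF ac] bilinear_conv_bounded_bilinear bounded_bilinear_inner in auto)

lemma inner_velocity_integrable:
  assumes "ac_curve \<gamma>" and "continuous_on {0..1} \<phi>" "0 \<le> a" "b \<le> 1"
  shows "(\<lambda>t. \<phi> t \<bullet> velocity \<gamma> t) integrable_on {a..b}"
  using inner_velocity_absolutely_integrable[OF assms(1,2)] assms(3,4)
  by (auto intro: integrable_on_subinterval dest!: set_lebesgue_integral_eq_integral(1))

lemma norm_velocity_integrable:
  assumes "ac_curve \<gamma>" "0 \<le> a" "b \<le> 1"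
  shows "(\<lambda>t. norm (velocity \<gamma> t)) integrable_on {a..b}"
  using absolutely_integrable_norm[OF ac_curve_velocity_absolutely_integrable[OF assms(1)]] assms(2,3)
  by (auto intro: integrable_on_subinterval dest!: set_lebesgue_integral_eq_integral(1) simp: o_def)

lemma inner_velocity_has_integral_const:
  assumes "ac_curve \<gamma>" "0 \<le> a" "a \<le> b" "b \<le> 1"
  shows "((\<lambda>t. c \<bullet> velocity \<gamma> t) has_integral c \<bullet> (\<gamma> b - \<gamma> a)) {a..b}"
  using has_integral_linear[OF ac_curve_has_integral_velocity[OF assms] bounded_linear_inner_right[of c]]
  by (simp add: o_def)

lemma inner_velocity_integral_bound:
  assumes ac: "ac_curve \<gamma>" and \<phi>: "continuous_on {0..1} \<phi>" and ab: "0 \<le> a" "b \<le> 1"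
    and e: "\<And>t. t \<in> {a..b} \<Longrightarrow> norm (\<phi> t) \<le> e"
  shows "\<bar>integral {a..b} (\<lambda>t. \<phi> t \<bullet> velocity \<gamma> t)\<bar> \<le> e * integral {a..b} (\<lambda>t. norm (velocity \<gamma> t))"
proof -
  have "norm (integral {a..b} (\<lambda>t. \<phi> t \<bullet> velocity \<gamma> t)) \<le> integral {a..b} (\<lambda>t. e * norm (velocity \<gamma> t))"
  proof (rule integral_norm_bound_integral)
    fix t assume "t \<in> {a..b}"
    then show "norm (\<phi> t \<bullet> velocity \<gamma> t) \<le> e * norm (velocity \<gamma> t)"
      using e[of t] Cauchy_Schwarz_ineq2[of "\<phi> t" "velocity \<gamma> t"]
      by (auto intro: order_trans[OF _ mult_right_mono])
  qed (use inner_velocity_integrable norm_velocity_integrable assms in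
      \<open>auto intro!: integrable_on_mult_right\<close>)
  then show ?thesis by simp
qed

lemma integral_le_AE:
  fixes f g :: "real \<Rightarrow> real"
  assumes f: "f integrable_on S" and g: "g integrable_on S" and N: "negligible N"
    and le: "\<And>x. x \<in> S - N \<Longrightarrow> f x \<le> g x"
  shows "integral S f \<le> integral S g"
proof -
  define h where "h x = (if x \<in> N then g x else f x)" for x
  have "integral S f = integral S h"
    by (rule integral_spike[OF N]) (auto simp: h_def)
  moreover have "h integrable_on S"
    by (rule integrable_spike[OF f N]) (auto simp: h_def)
  moreover have "h x \<le> g x" if "x \<in> S" for x
    using le[of x] that by (auto simp: h_def)
  ultimately show ?thesis
    using integral_le[of h S g] g by simp
qed

lemma has_vector_derivative_quotient_tendsto:
  assumes d: "(\<gamma> has_vector_derivative v) (at t)"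
  shows "((\<lambda>s. (\<gamma> s - \<gamma> t) /\<^sub>R (s - t)) \<longlongrightarrow> v) (at t)"
proof -
  have "((\<lambda>s. (\<gamma> s - \<gamma> t - (s - t) *\<^sub>R v) /\<^sub>R norm (s - t)) \<longlongrightarrow> 0) (at t)"
    using d by (simp add: has_vector_derivative_def has_derivative_at_within)
  then have "((\<lambda>s. norm ((\<gamma> s - \<gamma> t - (s - t) *\<^sub>R v) /\<^sub>R norm (s - t))) \<longlongrightarrow> 0) (at t)"
    by (rule tendsto_norm_zero)
  moreover have "norm ((\<gamma> s - \<gamma> t - (s - t) *\<^sub>R v) /\<^sub>R norm (s - t)) = norm ((\<gamma> s - \<gamma> t) /\<^sub>R (s - t) - v)"
    if "s \<noteq> t" for s
  proof -
    have "(\<gamma> s - \<gamma> t) /\<^sub>R (s - t) - v = (\<gamma> s - \<gamma> t - (s - t) *\<^sub>R v) /\<^sub>R (s - t)"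
      using that by (simp add: scaleR_diff_right)
    then show ?thesis by simp
  qed
  ultimately have "((\<lambda>s. norm ((\<gamma> s - \<gamma> t) /\<^sub>R (s - t) - v)) \<longlongrightarrow> 0) (at t)"
    by (smt (verit, del_insts) LIM_equal)
  then show ?thesis
    by (simp add: tendsto_norm_zero_iff LIM_zero_iff)
qed

text \<open>Only interior points are considered, since the derivative is two-sided and nothing is known about
the curve outside \<open>[0,1]\<close>.\<close>

lemma lipschitz_norm_velocity_le:
  assumes lip: "C-lipschitz_on {0..1} \<gamma>" and t: "t \<in> {0<..<1}"
    and d: "(\<gamma> has_vector_derivative v) (at t)"
  shows "norm v \<le> C"
proof -
  have lim: "((\<lambda>s. norm ((\<gamma> s - \<gamma> t) /\<^sub>R (s - t))) \<longlongrightarrow> norm v) (at t)"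
    by (intro tendsto_norm has_vector_derivative_quotient_tendsto d)
  have ev: "\<forall>\<^sub>F s in at t. s \<in> {0<..<1}"
    using t by (intro eventually_at_in_open') auto
  show ?thesis
  proof (rule tendsto_upperbound[OF lim])
    show "\<forall>\<^sub>F s in at t. norm ((\<gamma> s - \<gamma> t) /\<^sub>R (s - t)) \<le> C"
      using ev eventually_neq_at_within[of t]
    proof eventually_elim
      case (elim s)
      then show ?case
        using lipschitz_onD[OF lip, of s t] t by (simp add: dist_norm divide_simps mult.commute)
    qed
  qed simp
qed

lemma lipschitz_inner_velocity_bound:
  assumes lip: "C-lipschitz_on {0..1} \<gamma>" and \<phi>: "continuous_on {0..1} \<phi>" and ab: "0 \<le> a" "a \<le> b" "b \<le> 1"
    and e: "\<And>t. t \<in> {a..b} \<Longrightarrow> norm (\<phi> t) \<le> e"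
  shows "\<bar>integral {a..b} (\<lambda>t. \<phi> t \<bullet> velocity \<gamma> t)\<bar> \<le> e * C * (b - a)"
proof -
  have ac: "ac_curve \<gamma>" by (rule lipschitz_imp_ac_curve[OF lip])
  have e0: "e \<ge> 0" using order_trans[OF norm_ge_zero e[of a]] ab by simp
  have "integral {a..b} (\<lambda>t. norm (velocity \<gamma> t)) \<le> C * (b - a)"
  proof -
    define N where "N = {t \<in> {0..1}. \<not> (\<gamma> has_vector_derivative velocity \<gamma> t) (at t)} \<union> {0,1}"
    have N: "negligible N"
      unfolding N_def using ac_curve_AE_differentiable[OF ac] by (intro negligible_Un) auto
    have "norm (velocity \<gamma> t) \<le> C" if "t \<in> {a..b} - N" for t
      using that ab by (intro lipschitz_norm_velocity_le[OF lip]) (auto simp: N_def)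
    then have "integral {a..b} (\<lambda>t. norm (velocity \<gamma> t)) \<le> integral {a..b} (\<lambda>t. C)"
      using norm_velocity_integrable[OF ac, of a b] ab by (intro integral_le_AE[OF _ _ N]) auto
    then show ?thesis using ab by (simp add: mult.commute)
  qed
  then show ?thesis
    using inner_velocity_integral_bound[OF ac \<phi>, of a b e] ab e e0
    by (auto intro: order_trans[OF _ mult_left_mono] simp: mult.assoc)
qed

text \<open>The one closure property from which those under scaling, pairing and projection are derived.\<close>

lemma ac_curve_dominated:
  assumes x: "ac_curve x" and y: "ac_curve y" and C: "C \<ge> 0"
    and le: "\<And>s t. norm (\<eta> t - \<eta> s) \<le> C * (norm (x t - x s) + norm (y t - y s))"
    and diff: "\<And>t. x differentiable (at t) \<Longrightarrow> y differentiable (at t) \<Longrightarrow> \<eta> differentiable (at t)"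
  shows "ac_curve \<eta>"
  unfolding ac_curve_iff
proof (intro conjI allI impI)
  fix e :: real assume e: "e > 0"
  then have e': "e / (2 * (C + 1)) > 0" using C by simp
  obtain d1 where d1: "d1 > 0" "variation_below x d1 (e / (2 * (C + 1)))"
    by (rule ac_curve_obtain_delta[OF x e'])
  obtain d2 where d2: "d2 > 0" "variation_below y d2 (e / (2 * (C + 1)))"
    by (rule ac_curve_obtain_delta[OF y e'])
  have "variation_below \<eta> (min d1 d2) e"
    unfolding variation_below_def
  proof (intro allI impI)
    fix D :: "real set set"
    assume D: "D division_of \<Union>D \<and> \<Union>D \<subseteq> {0..1} \<and> (\<Sum>I\<in>D. Sup I - Inf I) < min d1 d2"
    define Sx where "Sx = (\<Sum>I\<in>D. norm (x (Sup I) - x (Inf I)))"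
    define Sy where "Sy = (\<Sum>I\<in>D. norm (y (Sup I) - y (Inf I)))"
    have S: "Sx < e / (2 * (C + 1))" "Sy < e / (2 * (C + 1))" "0 \<le> Sx + Sy"
      using d1(2) d2(2) D unfolding variation_below_def Sx_def Sy_def by (auto intro!: add_nonneg_nonneg sum_nonneg)
    have "(\<Sum>I\<in>D. norm (\<eta> (Sup I) - \<eta> (Inf I))) \<le>
        (\<Sum>I\<in>D. C * (norm (x (Sup I) - x (Inf I)) + norm (y (Sup I) - y (Inf I))))"
      by (intro sum_mono le)
    also have "\<dots> = C * (Sx + Sy)"
      by (simp add: Sx_def Sy_def sum.distrib flip: sum_distrib_left)
    also have "\<dots> \<le> (C + 1) * (Sx + Sy)" using S by (intro mult_right_mono) auto
    also have "\<dots> < (C + 1) * (e / (2 * (C + 1)) + e / (2 * (C + 1)))"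
      using S C by (intro mult_strict_left_mono add_strict_mono) auto
    also have "\<dots> = e"
    proof -
      have nz: "2 * (C + 1) \<noteq> 0" using C by simp
      have "(C + 1) * (q + q) = 2 * (C + 1) * q" for q :: real by (simp add: algebra_simps)
      then show ?thesis by (simp only: times_divide_eq_right nonzero_mult_div_cancel_left[OF nz])
    qed
    finally show "(\<Sum>I\<in>D. norm (\<eta> (Sup I) - \<eta> (Inf I))) < e" .
  qed
  then show "\<exists>d>0. variation_below \<eta> d e" using d1(1) d2(1) by (intro exI[of _ "min d1 d2"]) auto
next
  have "{t \<in> {0..1}. \<not> \<eta> differentiable (at t)} \<subseteq>
      {t \<in> {0..1}. \<not> x differentiable (at t)} \<union> {t \<in> {0..1}. \<not> y differentiable (at t)}"
    using diff by blast
  then show "negligible {t \<in> {0..1}. \<not> \<eta> differentiable (at t)}"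
    using x y negligible_subset negligible_Un unfolding ac_curve_def by blast
qed

lemma ac_curve_scaleR:
  assumes "ac_curve \<gamma>"
  shows "ac_curve (\<lambda>t. c *\<^sub>R \<gamma> t)"
proof (rule ac_curve_dominated[OF assms assms, of "\<bar>c\<bar>"])
  show "norm (c *\<^sub>R \<gamma> t - c *\<^sub>R \<gamma> s) \<le> \<bar>c\<bar> * (norm (\<gamma> t - \<gamma> s) + norm (\<gamma> t - \<gamma> s))" for s t
    by (simp add: mult_left_mono flip: scaleR_diff_right)
  show "(\<lambda>t. c *\<^sub>R \<gamma> t) differentiable (at t)" if "\<gamma> differentiable (at t)" for t
    using that by (intro derivative_intros)
qed simp

lemma ac_curve_fst_snd:
  fixes \<gamma> :: "real \<Rightarrow> 'a::euclidean_space \<times> 'b::euclidean_space"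
  assumes "ac_curve \<gamma>"
  shows "ac_curve (\<lambda>t. fst (\<gamma> t))" "ac_curve (\<lambda>t. snd (\<gamma> t))"
proof -
  have le: "norm (fst (\<gamma> t) - fst (\<gamma> s)) \<le> norm (\<gamma> t - \<gamma> s)"
      "norm (snd (\<gamma> t) - snd (\<gamma> s)) \<le> norm (\<gamma> t - \<gamma> s)" for s t
    using norm_fst_le[of "fst (\<gamma> t - \<gamma> s)" "snd (\<gamma> t - \<gamma> s)"]
      norm_snd_le[of "snd (\<gamma> t - \<gamma> s)" "fst (\<gamma> t - \<gamma> s)"]
    by (simp_all only: fst_diff[symmetric] snd_diff[symmetric] prod.collapse)
  have diff: "(\<lambda>t. fst (\<gamma> t)) differentiable (at t)" "(\<lambda>t. snd (\<gamma> t)) differentiable (at t)"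
    if "\<gamma> differentiable (at t)" for t
    using that unfolding differentiable_def by (blast intro: has_derivative_fst has_derivative_snd)+
  show "ac_curve (\<lambda>t. fst (\<gamma> t))"
    by (rule ac_curve_dominated[OF assms assms, of 1]) (auto intro: diff order_trans[OF le(1)])
  show "ac_curve (\<lambda>t. snd (\<gamma> t))"
    by (rule ac_curve_dominated[OF assms assms, of 1]) (auto intro: diff order_trans[OF le(2)])
qed

lemma ac_curve_Pair:
  assumes x: "ac_curve x" and y: "ac_curve y"
  shows "ac_curve (\<lambda>t. (x t, y t))"
  by (rule ac_curve_dominated[OF x y, of 1]) (simp_all add: norm_Pair_le)

lemma negligible_velocity_Pair:
  assumes "ac_curve x" "ac_curve y"
  obtains N where "negligible N"
    "\<forall>t\<in>{0..1} - N. (x has_vector_derivative velocity x t) (at t) \<and>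
      (y has_vector_derivative velocity y t) (at t) \<and>
      velocity (\<lambda>t. (x t, y t)) t = (velocity x t, velocity y t)"
proof -
  define N where "N = {t \<in> {0..1}. \<not> (x has_vector_derivative velocity x t) (at t)} \<union>
      {t \<in> {0..1}. \<not> (y has_vector_derivative velocity y t) (at t)}"
  show ?thesis
  proof (rule that[of N])
    show "negligible N"
      unfolding N_def by (intro negligible_Un ac_curve_AE_differentiable assms)
    show "\<forall>t\<in>{0..1} - N. (x has_vector_derivative velocity x t) (at t) \<and>
      (y has_vector_derivative velocity y t) (at t) \<and>
      velocity (\<lambda>t. (x t, y t)) t = (velocity x t, velocity y t)"
    proof
      fix t assume "t \<in> {0..1} - N"
      then have d: "(x has_vector_derivative velocity x t) (at t)" "(y has_vector_derivative velocity y t) (at t)"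
        by (auto simp: N_def)
      then show "(x has_vector_derivative velocity x t) (at t) \<and>
        (y has_vector_derivative velocity y t) (at t) \<and>
        velocity (\<lambda>t. (x t, y t)) t = (velocity x t, velocity y t)"
        using vector_derivative_at[OF has_vector_derivative_Pair[OF d]] by simp
    qed
  qed
qed

lemma lipschitz_bounded_product:
  fixes a b :: "real \<Rightarrow> 'a::real_inner"
  assumes a: "A-lipschitz_on {0..1} a" and b: "B-lipschitz_on {0..1} b"
  shows "\<exists>C. C-lipschitz_on {0..1} (\<lambda>t. a t \<bullet> b t)"
proof -
  have bd: "\<exists>M\<ge>0. \<forall>t\<in>{0..1}. norm (f t) \<le> M" if "L-lipschitz_on {0..1} f" for f :: "real \<Rightarrow> 'a" and L
  proof -
    have "bounded (f ` {0..1})"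
      by (intro compact_imp_bounded compact_continuous_image lipschitz_on_continuous_on[OF that]) auto
    then show ?thesis
      unfolding bounded_pos by (meson imageI less_imp_le)
  qed
  obtain M where M: "M \<ge> 0" "\<And>t. t \<in> {0..1} \<Longrightarrow> norm (a t) \<le> M" using bd[OF a] by blast
  obtain L where L: "L \<ge> 0" "\<And>t. t \<in> {0..1} \<Longrightarrow> norm (b t) \<le> L" using bd[OF b] by blast
  have "(M * B + L * A)-lipschitz_on {0..1} (\<lambda>t. a t \<bullet> b t)"
  proof (rule lipschitz_onI)
    fix s t :: real assume st: "s \<in> {0..1}" "t \<in> {0..1}"
    have "\<bar>a s \<bullet> b s - a t \<bullet> b t\<bar> = \<bar>a s \<bullet> (b s - b t) + (a s - a t) \<bullet> b t\<bar>"
      by (simp add: algebra_simps)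
    also have "\<dots> \<le> norm (a s) * norm (b s - b t) + norm (a s - a t) * norm (b t)"
      using Cauchy_Schwarz_ineq2[of "a s" "b s - b t"] Cauchy_Schwarz_ineq2[of "a s - a t" "b t"] by linarith
    also have "\<dots> \<le> M * (B * dist s t) + (A * dist s t) * L"
      using M L st lipschitz_onD[OF a st] lipschitz_onD[OF b st] lipschitz_on_nonneg[OF a] lipschitz_on_nonneg[OF b]
      by (intro add_mono mult_mono) (auto simp: dist_norm)
    finally show "dist (a s \<bullet> b s) (a t \<bullet> b t) \<le> (M * B + L * A) * dist s t"
      by (simp add: dist_real_def algebra_simps)
  qed (use M L lipschitz_on_nonneg[OF a] lipschitz_on_nonneg[OF b] in auto)
  then show ?thesis by blast
qed

section \<open>The symplectic action as a bilinear form\<close>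

locale compatible_complex_structure =
  fixes J :: "'a::euclidean_space \<Rightarrow> 'a"
  assumes linear_J: "linear J"
    and J_J [simp]: "J (J u) = - u"
    and J_skew: "J u \<bullet> v = - (u \<bullet> J v)"
begin

lemma bounded_linear_J: "bounded_linear J"
  using linear_J linear_conv_bounded_linear by blast

lemmas J_add = linear_add[OF linear_J]
  and J_diff = linear_diff[OF linear_J]
  and J_scaleR = linear_scale[OF linear_J]
  and J_minus = linear_neg[OF linear_J]
  and J_0 [simp] = linear_0[OF linear_J]

lemma J_inner_self [simp]: "J u \<bullet> u = 0"
  using J_skew[of u u] by (simp add: inner_commute)

lemma J_inner_J [simp]: "J u \<bullet> J v = u \<bullet> v"
  by (simp add: J_skew[of u "J v"])

lemma norm_J [simp]: "norm (J u) = norm u"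
  by (simp add: norm_eq_sqrt_inner)

lemma inner_J_right_eq: "d \<bullet> J k = k \<bullet> (- J d)"
  using J_skew[of k d] by (simp only: inner_commute[of d] inner_minus_right)

lemma continuous_on_J: "continuous_on S f \<Longrightarrow> continuous_on S (\<lambda>t. J (f t))"
  by (rule bounded_linear.continuous_on[OF bounded_linear_J])

text \<open>The integral of \<open>\<omega>(a, b')\<close>, whose diagonal is twice the action.\<close>

definition bilinear_action :: "(real \<Rightarrow> 'a) \<Rightarrow> (real \<Rightarrow> 'a) \<Rightarrow> real" where
  "bilinear_action a b = integral {0..1} (\<lambda>t. J (a t) \<bullet> velocity b t)"

lemma action_eq: "action J \<gamma> = bilinear_action \<gamma> \<gamma> / 2"
  unfolding action_def bilinear_action_def omega_def by simp

lemma bilinear_action_integrable: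
  assumes "continuous_on {0..1} a" "ac_curve b" "0 \<le> s" "t \<le> 1"
  shows "(\<lambda>t. J (a t) \<bullet> velocity b t) integrable_on {s..t}"
  by (rule inner_velocity_integrable[OF assms(2) continuous_on_J[OF assms(1)] assms(3,4)])

lemma bilinear_action_add_left:
  assumes "continuous_on {0..1} a" "continuous_on {0..1} b" "ac_curve c"
  shows "bilinear_action (\<lambda>t. a t + x *\<^sub>R b t) c = bilinear_action a c + x * bilinear_action b c"
proof -
  have "bilinear_action (\<lambda>t. a t + x *\<^sub>R b t) c =
      integral {0..1} (\<lambda>t. J (a t) \<bullet> velocity c t + x * (J (b t) \<bullet> velocity c t))"
    unfolding bilinear_action_def by (simp add: J_add J_scaleR inner_add_left)
  also have "\<dots> = bilinear_action a c + x * bilinear_action b c"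
    unfolding bilinear_action_def
    using bilinear_action_integrable[OF assms(1,3), of 0 1] bilinear_action_integrable[OF assms(2,3), of 0 1]
    by (subst integral_add) (auto intro: integrable_on_mult_right)
  finally show ?thesis .
qed

lemma bilinear_action_diff_left:
  assumes "continuous_on {0..1} a" "continuous_on {0..1} b" "ac_curve c"
  shows "bilinear_action (\<lambda>t. a t - b t) c = bilinear_action a c - bilinear_action b c"
  using bilinear_action_add_left[OF assms, of "-1"] by simp

lemma bilinear_action_lipschitz_bound:
  assumes "continuous_on {0..1} a" "C-lipschitz_on {0..1} b" "\<And>t. t \<in> {0..1} \<Longrightarrow> norm (a t) \<le> e"
  shows "\<bar>bilinear_action a b\<bar> \<le> e * C"
  using lipschitz_inner_velocity_bound[OF assms(2) continuous_on_J[OF assms(1)], of 0 1 e] assms(3)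
  unfolding bilinear_action_def by simp

text \<open>Integration by parts exchanges the two curves and produces a sign, which the skewness of \<open>J\<close>
cancels. The boundary term vanishes because \<open>a\<close> is zero at both ends.\<close>

lemma bilinear_action_sym:
  assumes a: "A-lipschitz_on {0..1} a" and b: "B-lipschitz_on {0..1} b"
    and closed: "a 0 = 0" "a 1 = 0"
  shows "bilinear_action a b = bilinear_action b a"
proof -
  have aca: "ac_curve a" and acb: "ac_curve b"
    using a b lipschitz_imp_ac_curve by blast+
  have Ja: "A-lipschitz_on {0..1} (\<lambda>t. J (a t))"
    using a unfolding lipschitz_on_def by (simp add: dist_norm flip: J_diff)
  obtain C where C: "C-lipschitz_on {0..1} (\<lambda>t. J (a t) \<bullet> b t)"
    using lipschitz_bounded_product[OF Ja b] by blast
  have FTC: "(velocity (\<lambda>t. J (a t) \<bullet> b t) has_integral 0) {0..1}"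
    using ac_curve_has_integral_velocity[OF lipschitz_imp_ac_curve[OF C], of 0 1] closed by simp
  define N where "N = {t \<in> {0..1}. \<not> (a has_vector_derivative velocity a t) (at t)} \<union>
      {t \<in> {0..1}. \<not> (b has_vector_derivative velocity b t) (at t)}"
  have N: "negligible N"
    unfolding N_def by (intro negligible_Un ac_curve_AE_differentiable aca acb)
  have "velocity (\<lambda>t. J (a t) \<bullet> b t) t = J (a t) \<bullet> velocity b t - J (b t) \<bullet> velocity a t"
    if t: "t \<in> {0..1} - N" for t
  proof -
    have da: "((\<lambda>t. J (a t)) has_vector_derivative J (velocity a t)) (at t)"
      using t by (intro bounded_linear.has_vector_derivative[OF bounded_linear_J]) (auto simp: N_def)
    have db: "(b has_vector_derivative velocity b t) (at t)"
      using t by (auto simp: N_def)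
    have "((\<lambda>t. J (a t) \<bullet> b t) has_vector_derivative (J (a t) \<bullet> velocity b t + J (velocity a t) \<bullet> b t)) (at t)"
      by (rule bounded_bilinear.has_vector_derivative[OF bounded_bilinear_inner da db])
    then show ?thesis
      by (simp add: vector_derivative_at J_skew[of "b t" "velocity a t"] inner_commute)
  qed
  then have "((\<lambda>t. J (a t) \<bullet> velocity b t - J (b t) \<bullet> velocity a t) has_integral 0) {0..1}"
    by (intro has_integral_spike[OF N _ FTC]) auto
  moreover have "((\<lambda>t. J (a t) \<bullet> velocity b t - J (b t) \<bullet> velocity a t) has_integral
      (bilinear_action a b - bilinear_action b a)) {0..1}"
    unfolding bilinear_action_def
    by (intro has_integral_diff integrable_integral bilinear_action_integrable
        lipschitz_on_continuous_on[OF a] lipschitz_on_continuous_on[OF b] aca acb) auto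
  ultimately have "0 = bilinear_action a b - bilinear_action b a"
    by (rule has_integral_unique)
  then show ?thesis by simp
qed

lemma action_scaleR:
  assumes ac: "ac_curve \<gamma>"
  shows "action J (\<lambda>t. c *\<^sub>R \<gamma> t) = c\<^sup>2 * action J \<gamma>"
proof -
  have "((\<lambda>t. c\<^sup>2 * (J (\<gamma> t) \<bullet> velocity \<gamma> t)) has_integral c\<^sup>2 * bilinear_action \<gamma> \<gamma>) {0..1}"
    unfolding bilinear_action_def
    by (intro has_integral_mult_right integrable_integral bilinear_action_integrable ac_curve_continuous_on ac) auto
  then have "((\<lambda>t. J (c *\<^sub>R \<gamma> t) \<bullet> velocity (\<lambda>t. c *\<^sub>R \<gamma> t) t) has_integral c\<^sup>2 * bilinear_action \<gamma> \<gamma>) {0..1}"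
  proof (rule has_integral_spike[OF ac_curve_AE_differentiable[OF ac], rotated])
    fix t assume "t \<in> {0..1} - {t \<in> {0..1}. \<not> (\<gamma> has_vector_derivative velocity \<gamma> t) (at t)}"
    then have "(\<gamma> has_vector_derivative velocity \<gamma> t) (at t)" by auto
    then have "((\<lambda>t. c *\<^sub>R \<gamma> t) has_vector_derivative c *\<^sub>R velocity \<gamma> t) (at t)"
      by (auto intro!: derivative_eq_intros)
    from vector_derivative_at[OF this]
    show "J (c *\<^sub>R \<gamma> t) \<bullet> velocity (\<lambda>t. c *\<^sub>R \<gamma> t) t = c\<^sup>2 * (J (\<gamma> t) \<bullet> velocity \<gamma> t)"
      by (simp add: J_scaleR power2_eq_square)
  qed
  then show ?thesis
    by (simp add: action_eq bilinear_action_def[of "\<lambda>t. c *\<^sub>R \<gamma> t"] integral_unique)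
qed

lemma integral_const_inner_velocity:
  assumes "ac_curve b" "0 \<le> s" "s \<le> t" "t \<le> 1"
  shows "integral {s..t} (\<lambda>t. J c \<bullet> velocity b t) = J c \<bullet> (b t - b s)"
  using inner_velocity_has_integral_const[OF assms] by (rule integral_unique)

end

lemma complex_structure_J_std: "compatible_complex_structure (J_std :: (real^'n) \<times> (real^'n) \<Rightarrow> _)"
proof (rule compatible_complex_structure.intro)
  show "linear (J_std :: (real^'n) \<times> (real^'n) \<Rightarrow> _)"
    by (rule linearI) (auto simp: J_std_def)
qed (auto simp: J_std_def inner_prod_def)

lemma complex_structure_map_prod:
  assumes "compatible_complex_structure J1" "compatible_complex_structure J2"
  shows "compatible_complex_structure (map_prod J1 J2)"
proof -
  interpret J1: compatible_complex_structure J1 by fact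
  interpret J2: compatible_complex_structure J2 by fact
  show ?thesis
  proof (rule compatible_complex_structure.intro)
    show "linear (map_prod J1 J2)"
      by (rule linearI) (auto simp: J1.J_add J1.J_scaleR J2.J_add J2.J_scaleR map_prod_def split_beta)
    show "map_prod J1 J2 u \<bullet> v = - (u \<bullet> map_prod J1 J2 v)" for u v
      using J1.J_skew J2.J_skew by (simp add: inner_prod_def map_prod_def split_beta)
  qed (auto simp: map_prod_def split_beta)
qed

section \<open>Curves with velocity in the rotated polar body\<close>

definition support_fun :: "'a::euclidean_space set \<Rightarrow> 'a \<Rightarrow> real" where
  "support_fun S w = (SUP u\<in>S. u \<bullet> w)"

lemma inner_le_support_fun:
  assumes "bounded S" "u \<in> S"
  shows "u \<bullet> w \<le> support_fun S w"
  unfolding support_fun_def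
proof (rule cSUP_upper[OF assms(2)])
  obtain B where B: "\<And>u. u \<in> S \<Longrightarrow> norm u \<le> B"
    using assms(1) unfolding bounded_iff by blast
  show "bdd_above ((\<lambda>u. u \<bullet> w) ` S)"
  proof (rule bdd_aboveI2)
    fix u assume "u \<in> S"
    then show "u \<bullet> w \<le> B * norm w"
      using B[of u] norm_cauchy_schwarz[of u w] by (auto intro: order_trans[OF _ mult_right_mono])
  qed
qed

lemma support_fun_le:
  assumes "S \<noteq> {}" "\<And>u. u \<in> S \<Longrightarrow> u \<bullet> w \<le> c"
  shows "support_fun S w \<le> c"
  unfolding support_fun_def using assms by (rule cSUP_least)

lemma support_fun_eqI:
  assumes "bounded S" "v \<in> S" "\<And>u. u \<in> S \<Longrightarrow> u \<bullet> w \<le> v \<bullet> w"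
  shows "support_fun S w = v \<bullet> w"
  using assms support_fun_le[of S w "v \<bullet> w"] inner_le_support_fun[of S v w] by fastforce

lemma support_fun_lipschitz:
  assumes "S \<noteq> {}" and S: "S \<subseteq> cball 0 B"
  shows "\<bar>support_fun S v - support_fun S w\<bar> \<le> B * norm (v - w)"
proof -
  have bS: "bounded S" using S bounded_cball bounded_subset by blast
  have "support_fun S v \<le> support_fun S w + B * norm (v - w)" for v w
  proof (rule support_fun_le[OF assms(1)])
    fix u assume u: "u \<in> S"
    have "norm u \<le> B" using S u by (auto simp: subset_eq)
    then have "u \<bullet> (v - w) \<le> B * norm (v - w)"
      by (rule order_trans[OF norm_cauchy_schwarz mult_right_mono]) simp
    then show "u \<bullet> v \<le> support_fun S w + B * norm (v - w)"
      using inner_le_support_fun[OF bS u, of w] by (simp add: inner_diff_right)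
  qed
  from this[of v w] this[of w v] show ?thesis by (simp add: norm_minus_commute abs_le_iff)
qed

lemma support_fun_scaleR:
  assumes S: "bounded S" "S \<noteq> {}" and m: "m > 0"
  shows "support_fun S (m *\<^sub>R w) = m * support_fun S w"
proof (rule antisym)
  show "support_fun S (m *\<^sub>R w) \<le> m * support_fun S w"
    using inner_le_support_fun[OF S(1)] m by (intro support_fun_le S) simp
  have "support_fun S w \<le> support_fun S (m *\<^sub>R w) / m"
    using inner_le_support_fun[OF S(1), of _ "m *\<^sub>R w"] m by (intro support_fun_le S) (simp add: field_simps)
  then show "m * support_fun S w \<le> support_fun S (m *\<^sub>R w)"
    using m by (simp add: field_simps)
qed

lemma support_fun_attained:
  assumes "compact K" "K \<noteq> {}"
  obtains k where "k \<in> K" "support_fun K w = k \<bullet> w"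
proof -
  have "continuous_on K (\<lambda>u. u \<bullet> w)" by (intro continuous_intros)
  then obtain k where k: "k \<in> K" "\<And>u. u \<in> K \<Longrightarrow> u \<bullet> w \<le> k \<bullet> w"
    using continuous_attains_sup[OF assms] by blast
  then have "support_fun K w = k \<bullet> w"
    by (intro support_fun_eqI compact_imp_bounded assms) auto
  then show ?thesis using that k by blast
qed

text \<open>The origin is an interior point, as witnessed by the radius \<open>r\<close>. Bounds such as the Lipschitz
constant \<open>1 / r\<close> below are expressed through \<open>r\<close> and \<open>R\<close>.\<close>

locale centred_convex_body = compatible_complex_structure J
  for J :: "'a::euclidean_space \<Rightarrow> 'a" +
  fixes K :: "'a set" and r R :: real
  assumes convex_K: "convex K" and closed_K: "closed K"
    and r_pos: "r > 0" and ball_K: "cball 0 r \<subseteq> K"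
    and K_ball: "K \<subseteq> cball 0 R"
begin

definition polar :: "'a set" where
  "polar = {u. \<forall>x\<in>K. u \<bullet> x \<le> 1}"

text \<open>For curves with a derivative this says that the velocity lies in \<open>J\<close> of the polar body almost
everywhere. Written with increments, the condition is visibly preserved by uniform limits, and
competitors can be checked without being differentiated.\<close>

definition admissible :: "(real \<Rightarrow> 'a) \<Rightarrow> bool" where
  "admissible w \<longleftrightarrow> w 0 = 0 \<and>
     (\<forall>s\<in>{0..1}. \<forall>t\<in>{0..1}. s \<le> t \<longrightarrow> (\<forall>x\<in>K. (w t - w s) \<bullet> J x \<le> t - s))"

definition closed_admissible :: "(real \<Rightarrow> 'a) \<Rightarrow> bool" where
  "closed_admissible w \<longleftrightarrow> admissible w \<and> w 1 = 0"

lemma polarD: "u \<in> polar \<Longrightarrow> x \<in> K \<Longrightarrow> u \<bullet> x \<le> 1"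
  by (simp add: polar_def)

lemma R_pos: "R > 0"
proof -
  obtain b :: 'a where b: "b \<in> Basis" using nonempty_Basis by blast
  then have "r *\<^sub>R b \<in> K" using ball_K r_pos by (auto simp: subset_eq)
  then show ?thesis using K_ball b r_pos by (force simp: subset_eq)
qed

lemma zero_in_K: "0 \<in> K"
  using ball_K r_pos by auto

text \<open>The maximum of a linear functional over \<open>K\<close> is at least its maximum over the ball of radius \<open>r\<close>.\<close>

lemma sup_over_ball:
  assumes "\<And>x. x \<in> K \<Longrightarrow> d \<bullet> x \<le> c"
  shows "r * norm d \<le> c"
proof (cases "d = 0")
  case True
  then show ?thesis using assms[OF zero_in_K] by simp
next
  case False
  have "(r / norm d) *\<^sub>R d \<in> K"
    using ball_K r_pos False by (auto simp: subset_eq)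
  from assms[OF this] show ?thesis
    using False by (simp add: dot_square_norm power2_eq_square)
qed

lemma polar_bound: "polar \<subseteq> cball 0 (1 / r)"
proof
  fix u assume "u \<in> polar"
  then have "r * norm u \<le> 1" by (intro sup_over_ball polarD)
  then show "u \<in> cball 0 (1 / r)" using r_pos by (simp add: field_simps)
qed

lemma bounded_polar: "bounded polar"
  using polar_bound bounded_cball bounded_subset by blast

lemma zero_in_polar: "0 \<in> polar"
  by (simp add: polar_def)

lemma ball_in_polar: "norm u \<le> 1 / R \<Longrightarrow> u \<in> polar"
  unfolding polar_def
proof safe
  fix x assume u: "norm u \<le> 1 / R" and x: "x \<in> K"
  have "u \<bullet> x \<le> norm u * norm x" by (rule norm_cauchy_schwarz)
  also have "\<dots> \<le> 1 / R * R"
    using u x K_ball R_pos by (intro mult_mono) (auto simp: subset_eq)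
  finally show "u \<bullet> x \<le> 1" using R_pos by simp
qed

lemma bipolar:
  assumes "\<And>u. u \<in> polar \<Longrightarrow> u \<bullet> x \<le> 1"
  shows "x \<in> K"
proof (rule ccontr)
  assume "x \<notin> K"
  then obtain a b where ab: "a \<bullet> x < b" "\<And>y. y \<in> K \<Longrightarrow> a \<bullet> y > b"
    using separating_hyperplane_closed_point[OF convex_K closed_K] by blast
  have b: "b < 0" using ab(2)[OF zero_in_K] by simp
  have "(1 / b) *\<^sub>R a \<in> polar"
    unfolding polar_def using ab(2) b by (auto simp: field_simps less_imp_le)
  from assms[OF this] show False using ab(1) b by (simp add: field_simps)
qed

text \<open>The support function of the polar body is the gauge of \<open>K\<close>. At an interior point, a slightly
larger multiple of the point is still in \<open>K\<close>, so that the gauge is less than 1.\<close>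

lemma frontierI:
  assumes "support_fun polar x = 1"
  shows "x \<in> frontier K"
proof -
  have le: "u \<bullet> x \<le> 1" if "u \<in> polar" for u
    using inner_le_support_fun[OF bounded_polar that, of x] assms by simp
  then have "x \<in> K" by (rule bipolar)
  moreover have "x \<notin> interior K"
  proof
    assume "x \<in> interior K"
    then obtain e where e: "e > 0" "cball x e \<subseteq> K"
      unfolding mem_interior_cball by blast
    define q where "q = e / (norm x + 1)"
    have q: "q > 0" using e by (simp add: q_def add_nonneg_pos)
    have "norm x / (norm x + 1) \<le> 1"
      by (subst divide_le_eq_1_pos) (auto simp: add_nonneg_pos)
    then have "q * norm x \<le> e"
      using e mult_left_le[of "norm x / (norm x + 1)" e] by (simp add: q_def)
    then have "x + q *\<^sub>R x \<in> K" using e q by (auto simp: subset_eq dist_norm)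
    then have "u \<bullet> x \<le> 1 / (1 + q)" if "u \<in> polar" for u
      using polarD[OF that, of "x + q *\<^sub>R x"] q by (simp add: inner_add_right field_simps)
    then have "support_fun polar x \<le> 1 / (1 + q)"
      using zero_in_polar by (intro support_fun_le) auto
    then show False using assms q by (simp add: field_simps)
  qed
  ultimately show ?thesis
    using closed_K by (simp add: frontier_def)
qed

lemma admissibleD:
  "admissible w \<Longrightarrow> s \<in> {0..1} \<Longrightarrow> t \<in> {0..1} \<Longrightarrow> s \<le> t \<Longrightarrow> x \<in> K \<Longrightarrow> (w t - w s) \<bullet> J x \<le> t - s"
  unfolding admissible_def by blast

lemma J_inner_bound:
  assumes "\<And>x. x \<in> K \<Longrightarrow> d \<bullet> J x \<le> c"
  shows "r * norm d \<le> c"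
proof -
  have "r * norm (- J d) \<le> c"
    by (rule sup_over_ball) (use assms in \<open>simp add: J_skew\<close>)
  then show ?thesis by simp
qed

lemma admissible_lipschitz:
  assumes w: "admissible w"
  shows "(1 / r)-lipschitz_on {0..1} w"
proof (rule lipschitz_onI)
  have le: "norm (w t - w s) \<le> (t - s) / r" if "s \<in> {0..1}" "t \<in> {0..1}" "s \<le> t" for s t
    using J_inner_bound[of "w t - w s" "t - s"] admissibleD[OF w that] r_pos
    by (simp add: field_simps)
  fix s t :: real assume st: "s \<in> {0..1}" "t \<in> {0..1}"
  show "dist (w s) (w t) \<le> 1 / r * dist s t"
    using le[of s t] le[of t s] st
    by (cases "s \<le> t") (auto simp: dist_norm norm_minus_commute)
qed (use r_pos in simp)

lemma admissible_continuous: "admissible w \<Longrightarrow> continuous_on {0..1} w"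
  using admissible_lipschitz lipschitz_on_continuous_on by blast

lemma admissible_ac_curve: "admissible w \<Longrightarrow> ac_curve w"
  using admissible_lipschitz lipschitz_imp_ac_curve by blast

lemma admissible_norm_le:
  assumes "admissible w" "t \<in> {0..1}"
  shows "norm (w t) \<le> 1 / r"
proof -
  have "norm (w t) \<le> 1 / r * t"
    using lipschitz_onD[OF admissible_lipschitz[OF assms(1)], of t 0] assms
    by (simp add: admissible_def dist_norm)
  also have "\<dots> \<le> 1 / r * 1" using assms r_pos by (intro mult_left_mono) auto
  finally show ?thesis by simp
qed

lemma admissible_mix:
  assumes a: "admissible a" and b: "admissible b" and e: "0 \<le> e" "e \<le> 1"
  shows "admissible (\<lambda>t. a t + e *\<^sub>R (b t - a t))"
  unfolding admissible_def
proof (intro conjI ballI impI)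
  show "a 0 + e *\<^sub>R (b 0 - a 0) = 0" using a b by (simp add: admissible_def)
  fix s t x assume st: "s \<in> {0..1::real}" "t \<in> {0..1}" "s \<le> t" and x: "x \<in> K"
  have "(a t + e *\<^sub>R (b t - a t) - (a s + e *\<^sub>R (b s - a s))) \<bullet> J x
      = (1 - e) * ((a t - a s) \<bullet> J x) + e * ((b t - b s) \<bullet> J x)"
    by (simp add: algebra_simps)
  also have "\<dots> \<le> (1 - e) * (t - s) + e * (t - s)"
    using admissibleD[OF a st x] admissibleD[OF b st x] e by (intro add_mono mult_left_mono) auto
  finally show "(a t + e *\<^sub>R (b t - a t) - (a s + e *\<^sub>R (b s - a s))) \<bullet> J x \<le> t - s"
    by (simp add: algebra_simps)
qed

text \<open>The action is continuous in the supremum norm on closed admissible curves: with \<open>B\<close> for the bilinear form,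
\<open>B(w,w) - B(z,z) = B(w-z,w) + B(w-z,z)\<close> by symmetry, and the velocities of \<open>w\<close> and \<open>z\<close> are bounded by \<open>1 / r\<close>.\<close>

lemma bilinear_action_closed_diff:
  assumes w: "closed_admissible w" and z: "closed_admissible z"
    and e: "\<And>t. t \<in> {0..1} \<Longrightarrow> norm (w t - z t) \<le> e"
  shows "\<bar>bilinear_action w w - bilinear_action z z\<bar> \<le> 2 * e / r"
proof -
  have aw: "admissible w" and az: "admissible z" using w z by (auto simp: closed_admissible_def)
  note cw = admissible_continuous[OF aw] and cz = admissible_continuous[OF az]
  have "bilinear_action w z = bilinear_action z w"
    using w by (intro bilinear_action_sym[OF admissible_lipschitz[OF aw] admissible_lipschitz[OF az]])
      (auto simp: closed_admissible_def admissible_def)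
  then have "bilinear_action w w - bilinear_action z z =
      bilinear_action (\<lambda>t. w t - z t) w + bilinear_action (\<lambda>t. w t - z t) z"
    by (simp add: bilinear_action_diff_left[OF cw cz] admissible_ac_curve aw az)
  moreover have "\<bar>bilinear_action (\<lambda>t. w t - z t) w\<bar> \<le> e * (1 / r)"
      "\<bar>bilinear_action (\<lambda>t. w t - z t) z\<bar> \<le> e * (1 / r)"
    by (intro bilinear_action_lipschitz_bound admissible_lipschitz aw az continuous_on_diff cw cz e; simp)+
  ultimately show ?thesis by (simp add: field_simps) argo
qed

text \<open>A maximising sequence is uniformly Lipschitz, so a subsequence converges uniformly; admissibility and
the action pass to the limit.\<close>

lemma closed_admissible_maximiser:
  obtains z where "closed_admissible z"
    "\<And>w. closed_admissible w \<Longrightarrow> bilinear_action w w \<le> bilinear_action z z"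
proof -
  define S where "S = (\<lambda>w. bilinear_action w w) ` Collect closed_admissible"
  have zero: "closed_admissible (\<lambda>t. 0)"
    by (simp add: closed_admissible_def admissible_def)
  have "bilinear_action w w \<le> 2 / r / r" if w: "closed_admissible w" for w
  proof -
    have "\<bar>bilinear_action w w - bilinear_action (\<lambda>t. 0) (\<lambda>t. 0)\<bar> \<le> 2 * (1 / r) / r"
      using w by (intro bilinear_action_closed_diff zero) (auto simp: admissible_norm_le closed_admissible_def)
    then show ?thesis by (simp add: bilinear_action_def)
  qed
  then have bdd: "bdd_above S" unfolding S_def by (intro bdd_aboveI2[where M = "2 / r / r"]) auto
  have ne: "S \<noteq> {}" using zero by (auto simp: S_def)
  have "\<exists>w. closed_admissible w \<and> Sup S - 1 / real (Suc n) < bilinear_action w w" for n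
    using less_cSup_iff[OF ne bdd, of "Sup S - 1 / real (Suc n)"] by (auto simp: S_def)
  then obtain f where f: "\<And>n. closed_admissible (f n)"
    "\<And>n. Sup S - 1 / real (Suc n) < bilinear_action (f n) (f n)" by metis
  have af: "admissible (f n)" for n using f(1) by (simp add: closed_admissible_def)
  have equi: "\<exists>d>0. \<forall>n y. y \<in> {0..1} \<and> norm (x - y) < d \<longrightarrow> norm (f n x - f n y) < e"
    if "x \<in> {0..1}" "0 < e" for x e
  proof (intro exI[of _ "r * e"] conjI allI impI)
    fix n y assume y: "y \<in> {0..1} \<and> norm (x - y) < r * e"
    have "norm (f n x - f n y) \<le> 1 / r * norm (x - y)"
      using lipschitz_onD[OF admissible_lipschitz[OF af], of x y n] that y by (simp add: dist_norm)
    also have "\<dots> < e" using y r_pos by (simp add: field_simps)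
    finally show "norm (f n x - f n y) < e" .
  qed (use that r_pos in simp)
  obtain g and k :: "nat \<Rightarrow> nat" where g: "continuous_on {0..1} g" "strict_mono k"
      "\<And>e. 0 < e \<Longrightarrow> \<exists>N. \<forall>n x. n \<ge> N \<and> x \<in> {0..1} \<longrightarrow> norm (f (k n) x - g x) < e"
    by (rule Arzela_Ascoli[of "{0..1::real}" f "1 / r"]) (use equi af admissible_norm_le in auto)
  have lim: "(\<lambda>n. f (k n) t) \<longlonglongrightarrow> g t" if "t \<in> {0..1}" for t
    unfolding LIMSEQ_iff using g(3) that by blast
  have ag: "closed_admissible g"
    unfolding closed_admissible_def admissible_def
  proof (intro conjI ballI impI)
    have "(\<lambda>n. f (k n) 0) = (\<lambda>n. 0)" "(\<lambda>n. f (k n) 1) = (\<lambda>n. 0)"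
      using f(1) by (auto simp: closed_admissible_def admissible_def)
    then show "g 0 = 0" "g 1 = 0"
      using lim[of 0] lim[of 1] LIMSEQ_unique by fastforce+
    fix s t x assume st: "s \<in> {0..1::real}" "t \<in> {0..1}" "s \<le> t" and x: "x \<in> K"
    have "(\<lambda>n. (f (k n) t - f (k n) s) \<bullet> J x) \<longlonglongrightarrow> (g t - g s) \<bullet> J x"
      by (intro tendsto_intros lim st)
    then show "(g t - g s) \<bullet> J x \<le> t - s"
      by (rule LIMSEQ_le_const2) (use admissibleD[OF af st x] in auto)
  qed
  have "Sup S \<le> bilinear_action g g + e" if e: "e > 0" for e
  proof -
    define e' where "e' = r * e / 4"
    have e': "e' > 0" using e r_pos by (simp add: e'_def)
    obtain N where N: "\<And>n x. n \<ge> N \<Longrightarrow> x \<in> {0..1} \<Longrightarrow> norm (f (k n) x - g x) < e'"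
      using g(3)[OF e'] by blast
    obtain n0 :: nat where n0: "1 / real (Suc n0) < e / 2"
      using e nat_approx_posE[of "e / 2"] by auto
    define n where "n = max N n0"
    have "k n \<ge> n" using g(2) by (rule seq_suble)
    then have "1 / real (Suc (k n)) \<le> 1 / real (Suc n0)"
      by (intro divide_left_mono) (auto simp: n_def)
    moreover have "\<bar>bilinear_action (f (k n)) (f (k n)) - bilinear_action g g\<bar> \<le> 2 * e' / r"
      by (rule bilinear_action_closed_diff[OF f(1) ag less_imp_le[OF N]])
        (use \<open>k n \<ge> n\<close> in \<open>auto simp: n_def\<close>)
    moreover have "2 * e' / r = e / 2" using r_pos by (simp add: e'_def)
    ultimately show ?thesis using f(2)[of "k n"] n0 by linarith
  qed
  then have "Sup S \<le> bilinear_action g g" by (rule field_le_epsilon)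
  then have "bilinear_action w w \<le> bilinear_action g g" if "closed_admissible w" for w
    using cSup_upper[OF _ bdd, of "bilinear_action w w"] that by (auto simp: S_def)
  then show ?thesis using that[OF ag] by blast
qed

end

section \<open>Optimality conditions for curves of maximal action\<close>

context centred_convex_body
begin

text \<open>A small circle in the plane spanned by \<open>b\<close> and \<open>J b\<close>, run in the positive direction.\<close>

lemma closed_admissible_positive_action:
  obtains w where "closed_admissible w" "bilinear_action w w > 0"
proof -
  obtain b :: 'a where b: "norm b = 1" using nonempty_Basis norm_Basis by blast
  define \<rho> where "\<rho> = 1 / (2 * pi * R)"
  have \<rho>: "\<rho> > 0" using R_pos by (simp add: \<rho>_def)
  define w where "w t = (\<rho> * (cos (2 * pi * t) - 1)) *\<^sub>R b + (\<rho> * sin (2 * pi * t)) *\<^sub>R J b" for t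
  define w' where "w' t = (\<rho> * (- sin (2 * pi * t) * (2 * pi))) *\<^sub>R b + (\<rho> * (cos (2 * pi * t) * (2 * pi))) *\<^sub>R J b" for t
  have deriv: "(w has_vector_derivative w' t) (at t)" for t
    unfolding w_def w'_def
    by (auto intro!: derivative_eq_intros simp: has_vector_derivative_def scaleR_add_right algebra_simps)
  have bb: "b \<bullet> b = 1" "J b \<bullet> b = 0" "b \<bullet> J b = 0"
    using b by (simp_all add: dot_square_norm inner_commute[of b "J b"])
  have norm_w': "norm (w' t) = 1 / R" for t
  proof -
    have "((\<rho> * (- s * (2 * pi))) *\<^sub>R b + (\<rho> * (c * (2 * pi))) *\<^sub>R J b) \<bullet>
        ((\<rho> * (- s * (2 * pi))) *\<^sub>R b + (\<rho> * (c * (2 * pi))) *\<^sub>R J b) = (2 * pi * \<rho>)\<^sup>2 * (s\<^sup>2 + c\<^sup>2)" for s c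
      by (simp add: inner_add_left inner_add_right bb power2_eq_square algebra_simps)
    then have "w' t \<bullet> w' t = (2 * pi * \<rho>)\<^sup>2 * ((sin (2 * pi * t))\<^sup>2 + (cos (2 * pi * t))\<^sup>2)"
      unfolding w'_def .
    also have "\<dots> = (1 / R)\<^sup>2" using R_pos by (simp add: \<rho>_def)
    finally have "(norm (w' t))\<^sup>2 = (1 / R)\<^sup>2" by (simp add: dot_square_norm)
    then show ?thesis using R_pos by simp
  qed
  have lipw: "norm (w t - w s) \<le> 1 / R * (t - s)" if "s \<le> t" for s t
  proof -
    have "(1 / R)-lipschitz_on UNIV w"
    proof (rule bounded_derivative_imp_lipschitz)
      fix t show "(w has_derivative (\<lambda>h. h *\<^sub>R w' t)) (at t within UNIV)"
        using deriv by (simp add: has_vector_derivative_def)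
      show "onorm (\<lambda>h. h *\<^sub>R w' t) \<le> 1 / R"
        by (rule onorm_le) (simp add: norm_w')
    qed (use R_pos in auto)
    from lipschitz_onD[OF this, of t s] that show ?thesis by (simp add: dist_norm)
  qed
  have "admissible w"
    unfolding admissible_def
  proof (intro conjI ballI impI)
    fix s t x assume st: "s \<in> {0..1::real}" "t \<in> {0..1}" "s \<le> t" and x: "x \<in> K"
    have "(w t - w s) \<bullet> J x \<le> norm (w t - w s) * norm x"
      using norm_cauchy_schwarz[of "w t - w s" "J x"] by simp
    also have "\<dots> \<le> (1 / R * (t - s)) * R"
      using lipw[OF st(3)] x K_ball st R_pos by (intro mult_mono) (auto simp: subset_eq)
    finally show "(w t - w s) \<bullet> J x \<le> t - s" using R_pos by simp
  qed (simp add: w_def)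
  then have cw: "closed_admissible w"
    by (simp add: closed_admissible_def w_def)
  have eq: "J (w t) \<bullet> velocity w t = 2 * pi * \<rho>\<^sup>2 * (1 - cos (2 * pi * t))" for t
  proof -
    have "J ((\<rho> * (c - 1)) *\<^sub>R b + (\<rho> * s) *\<^sub>R J b) \<bullet>
        ((\<rho> * (- s * (2 * pi))) *\<^sub>R b + (\<rho> * (c * (2 * pi))) *\<^sub>R J b) = 2 * pi * \<rho>\<^sup>2 * (s\<^sup>2 + c\<^sup>2 - c)" for s c
    proof -
      have "J ((\<rho> * (c - 1)) *\<^sub>R b + (\<rho> * s) *\<^sub>R J b) = (\<rho> * (c - 1)) *\<^sub>R J b - (\<rho> * s) *\<^sub>R b"
        by (simp only: J_add J_scaleR J_J scaleR_minus_right add_uminus_conv_diff)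
      then show ?thesis
        by (simp only:) (simp add: inner_diff_left inner_add_right bb power2_eq_square algebra_simps)
    qed
    then have "J (w t) \<bullet> w' t = 2 * pi * \<rho>\<^sup>2 * ((sin (2 * pi * t))\<^sup>2 + (cos (2 * pi * t))\<^sup>2 - cos (2 * pi * t))"
      unfolding w'_def w_def .
    then show ?thesis using vector_derivative_at[OF deriv] by simp
  qed
  have hi: "((\<lambda>t. 2 * pi * \<rho>\<^sup>2 * (1 - cos (2 * pi * t))) has_integral
      (\<lambda>t. 2 * pi * \<rho>\<^sup>2 * (t - sin (2 * pi * t) / (2 * pi))) 1 - (\<lambda>t. 2 * pi * \<rho>\<^sup>2 * (t - sin (2 * pi * t) / (2 * pi))) 0) {0..1}"
    by (intro fundamental_theorem_of_calculus)
      (auto intro!: derivative_eq_intros simp flip: has_real_derivative_iff_has_vector_derivative)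
  have "((\<lambda>t. 2 * pi * \<rho>\<^sup>2 * (1 - cos (2 * pi * t))) has_integral 2 * pi * \<rho>\<^sup>2) {0..1}"
    using hi by simp
  then have "bilinear_action w w = 2 * pi * \<rho>\<^sup>2"
    unfolding bilinear_action_def eq by (rule integral_unique)
  then show ?thesis using that[OF cw] \<rho> by simp
qed

context
  fixes z
  assumes cz: "closed_admissible z"
    and max_z: "\<And>w. closed_admissible w \<Longrightarrow> bilinear_action w w \<le> bilinear_action z z"
begin

lemma adm_z: "admissible z" and z0: "z 0 = 0" and z1: "z 1 = 0"
  using cz by (auto simp: closed_admissible_def admissible_def)

lemma bilinear_action_max_pos: "bilinear_action z z > 0"
  using closed_admissible_positive_action max_z by (metis less_le_trans)

text \<open>Moving from \<open>z\<close> towards \<open>w\<close> stays admissible, so the derivative of the action in this direction is not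
positive.\<close>

lemma first_order_condition:
  assumes cw: "closed_admissible w"
  shows "bilinear_action w z \<le> bilinear_action z z"
proof -
  define d where "d t = w t - z t" for t
  have aw: "admissible w" using cw by (simp add: closed_admissible_def)
  note cont_z = admissible_continuous[OF adm_z] and cont_w = admissible_continuous[OF aw]
  have cont_d: "continuous_on {0..1} d"
    unfolding d_def by (intro continuous_intros cont_z cont_w)
  have lip_z: "(1 / r)-lipschitz_on {0..1} z" by (rule admissible_lipschitz[OF adm_z])
  have lip_d: "(1 / r + 1 / r)-lipschitz_on {0..1} d"
    unfolding d_def by (intro lipschitz_on_diff admissible_lipschitz aw adm_z)
  have d01: "d 0 = 0" "d 1 = 0"
    using cw z0 z1 by (auto simp: d_def closed_admissible_def admissible_def)
  have ac_z: "ac_curve z" and ac_d: "ac_curve d"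
    using lip_z lip_d lipschitz_imp_ac_curve by blast+
  have dz: "bilinear_action z d = bilinear_action d z"
    by (rule bilinear_action_sym[OF lip_z lip_d z0 z1])
  have key: "2 * bilinear_action d z + e * bilinear_action d d \<le> 0" if e: "0 < e" "e \<le> 1" for e
  proof -
    define q where "q t = z t + e *\<^sub>R d t" for t
    have "admissible q" unfolding q_def d_def using e by (intro admissible_mix adm_z aw) auto
    note lip_q = admissible_lipschitz[OF this] and ac_q = admissible_ac_curve[OF this]
    from \<open>admissible q\<close> have cq: "closed_admissible q"
      using d01 z1 by (simp add: closed_admissible_def q_def)
    have "bilinear_action q q = bilinear_action z q + e * bilinear_action d q"
      using bilinear_action_add_left[OF cont_z cont_d ac_q, of e] by (simp flip: q_def)
    also have "bilinear_action z q = bilinear_action q z"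
      by (rule bilinear_action_sym[OF lip_z lip_q z0 z1])
    also have "bilinear_action d q = bilinear_action q d"
      by (rule bilinear_action_sym[OF lip_d lip_q d01])
    also have "bilinear_action q z = bilinear_action z z + e * bilinear_action d z"
      unfolding q_def by (rule bilinear_action_add_left[OF cont_z cont_d ac_z])
    also have "bilinear_action q d = bilinear_action z d + e * bilinear_action d d"
      unfolding q_def by (rule bilinear_action_add_left[OF cont_z cont_d ac_d])
    finally have "e * (2 * bilinear_action d z + e * bilinear_action d d) \<le> 0"
      using max_z[OF cq] dz by (simp add: algebra_simps)
    then show ?thesis using e by (simp add: mult_le_0_iff)
  qed
  have "bilinear_action d z \<le> 0"
  proof (rule ccontr)
    assume "\<not> bilinear_action d z \<le> 0"
    then have pos: "bilinear_action d z > 0" by simp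
    \<comment> \<open>Small enough for the quadratic term not to compensate the linear one.\<close>
  define e where "e = min 1 (bilinear_action d z / (\<bar>bilinear_action d d\<bar> + 1))"
    have e: "0 < e" "e \<le> 1" using pos by (auto simp: e_def)
    have "e \<le> bilinear_action d z / (\<bar>bilinear_action d d\<bar> + 1)" by (simp add: e_def)
    then have "e * (\<bar>bilinear_action d d\<bar> + 1) \<le> bilinear_action d z"
      by (subst (asm) pos_le_divide_eq) auto
    moreover have "- (e * bilinear_action d d) \<le> e * (\<bar>bilinear_action d d\<bar> + 1)"
      using e by (simp add: abs_if distrib_left mult_nonneg_nonneg)
    ultimately show False using key[OF e] pos by linarith
  qed
  then show ?thesis
    unfolding d_def using bilinear_action_diff_left[OF cont_w cont_z ac_z] by simp
qed

lemma admissible_linear: "u \<in> polar \<Longrightarrow> admissible (\<lambda>t. t *\<^sub>R J u)"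
  unfolding admissible_def
proof (intro conjI ballI impI)
  fix s t x assume u: "u \<in> polar" and st: "s \<in> {0..1::real}" "t \<in> {0..1}" "s \<le> t" and x: "x \<in> K"
  have "(t *\<^sub>R J u - s *\<^sub>R J u) \<bullet> J x = (t - s) * (u \<bullet> x)"
    by (simp flip: scaleR_diff_left)
  also have "\<dots> \<le> (t - s) * 1" using st polarD[OF u x] by (intro mult_left_mono) auto
  finally show "(t *\<^sub>R J u - s *\<^sub>R J u) \<bullet> J x \<le> t - s" by simp
qed simp

text \<open>The pairs of end point \<open>w 1\<close> and value \<open>B(w,z)\<close>, for \<open>w\<close> admissible but not necessarily closed, form a convex
set \<open>S\<close>. By the first-order condition it misses the points above \<open>B(z,z)\<close> on the axis \<open>w 1 = 0\<close>. A separating hyperplane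
is not vertical because the end points fill a neighbourhood of the origin, and its slope is
the Lagrange multiplier \<open>y\<close> of the closing condition.\<close>

lemma closing_multiplier:
  obtains y where "\<And>w. admissible w \<Longrightarrow> y \<bullet> w 1 + bilinear_action w z \<le> bilinear_action z z"
proof -
  define M where "M = bilinear_action z z"
  have ac_z: "ac_curve z" by (rule admissible_ac_curve[OF adm_z])
  define S where "S = (\<lambda>w. (w 1, bilinear_action w z)) ` Collect admissible"
  define T where "T = {(0::'a)} \<times> {M<..}"
  have zero: "admissible (\<lambda>t. 0)" by (simp add: admissible_def)
  have "convex S"
    unfolding convex_alt
  proof safe
    fix p q and e :: real assume pq: "p \<in> S" "q \<in> S" and e: "0 \<le> e" "e \<le> 1"
    obtain a b where a: "admissible a" "p = (a 1, bilinear_action a z)"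
      and b: "admissible b" "q = (b 1, bilinear_action b z)" using pq by (auto simp: S_def)
    define c where "c t = a t + e *\<^sub>R (b t - a t)" for t
    have c: "admissible c" unfolding c_def by (rule admissible_mix[OF a(1) b(1) e])
    note ca = admissible_continuous[OF a(1)] and cb = admissible_continuous[OF b(1)]
    have "bilinear_action c z = bilinear_action a z + e * bilinear_action (\<lambda>t. b t - a t) z"
      unfolding c_def by (intro bilinear_action_add_left continuous_on_diff ca cb ac_z)
    then have "bilinear_action c z = (1 - e) * bilinear_action a z + e * bilinear_action b z"
      by (simp add: bilinear_action_diff_left[OF cb ca ac_z] algebra_simps)
    then have "(1 - e) *\<^sub>R p + e *\<^sub>R q = (c 1, bilinear_action c z)"
      by (simp add: a b c_def algebra_simps)
    then show "(1 - e) *\<^sub>R p + e *\<^sub>R q \<in> S" using c by (auto simp: S_def)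
  qed
  moreover have "convex T" unfolding T_def by (intro convex_Times) auto
  moreover have "S \<noteq> {}" using zero by (auto simp: S_def)
  moreover have "T \<noteq> {}" by (auto simp: T_def)
  moreover have "S \<inter> T = {}"
  proof -
    have "False" if "admissible w" "w 1 = 0" "bilinear_action w z > M" for w
      using first_order_condition[of w] that by (auto simp: closed_admissible_def M_def)
    then show ?thesis by (auto simp: S_def T_def)
  qed
  ultimately obtain a c where ac: "a \<noteq> 0" "\<forall>p\<in>S. a \<bullet> p \<le> c" "\<forall>p\<in>T. a \<bullet> p \<ge> c"
    using separating_hyperplane_sets by metis
  obtain y \<tau> where a: "a = (y, \<tau>)" by fastforce
  have S: "y \<bullet> w 1 + \<tau> * bilinear_action w z \<le> c" if "admissible w" for w
    using ac(2) that by (auto simp: S_def a inner_prod_def)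
  have T: "c \<le> \<tau> * m" if "m > M" for m
    using ac(3) that by (auto simp: T_def a inner_prod_def)
  have "\<tau> \<ge> 0"
  proof (rule ccontr)
    assume n: "\<not> \<tau> \<ge> 0"
    define m where "m = max (M + 1) ((c - 1) / \<tau>)"
    have "c \<le> \<tau> * m" by (rule T) (simp add: m_def)
    also have "\<dots> \<le> \<tau> * ((c - 1) / \<tau>)"
      using n by (intro mult_left_mono_neg) (auto simp: m_def)
    finally show False using n by simp
  qed
  have cM: "c \<le> \<tau> * M"
  proof (rule field_le_epsilon)
    fix e :: real assume e: "e > 0"
    have "c \<le> \<tau> * (M + e / (\<tau> + 1))" using e \<open>\<tau> \<ge> 0\<close> by (intro T) simp
    also have "\<dots> \<le> \<tau> * M + e" using e \<open>\<tau> \<ge> 0\<close> by (simp add: field_simps)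
    finally show "c \<le> \<tau> * M + e" .
  qed
  have "\<tau> \<noteq> 0"
  proof
    assume \<tau>: "\<tau> = 0"
    \<comment> \<open>Moving straight in the direction of \<open>y\<close> would violate the separation if the hyperplane were vertical.\<close>
    define u where "u = (1 / (R * (norm y + 1))) *\<^sub>R (- J y)"
    have np: "norm y + 1 > 0" by (simp add: add_nonneg_pos)
    have "norm u = (1 / R) * (norm y / (norm y + 1))" using R_pos np by (simp add: u_def)
    also have "\<dots> \<le> (1 / R) * 1" using R_pos np by (intro mult_left_mono) auto
    finally have "u \<in> polar" by (intro ball_in_polar) simp
    from S[OF admissible_linear[OF this]] \<tau> cM have "y \<bullet> J u \<le> 0" by simp
    then have "(1 / (R * (norm y + 1))) * (y \<bullet> y) \<le> 0"
      by (simp add: u_def J_scaleR J_minus)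
    then have "y \<bullet> y \<le> 0" using R_pos np by (simp add: mult_le_0_iff divide_le_0_iff)
    then have "y = 0" by (metis inner_eq_zero_iff inner_ge_zero order_antisym)
    then show False using ac(1) a \<tau> by (simp add: zero_prod_def)
  qed
  then have \<tau>: "\<tau> > 0" using \<open>\<tau> \<ge> 0\<close> by simp
  show ?thesis
  proof (rule that[of "(1 / \<tau>) *\<^sub>R y"])
    fix w assume "admissible w"
    then have "y \<bullet> w 1 + \<tau> * bilinear_action w z \<le> \<tau> * M" using S cM by force
    then show "(1 / \<tau>) *\<^sub>R y \<bullet> w 1 + bilinear_action w z \<le> bilinear_action z z"
      using \<tau> by (simp add: M_def field_simps)
  qed
qed

end

end

section \<open>The maximiser is a closed characteristic\<close>

context centred_convex_body
begin

text \<open>In the limit of difference quotients, this says that \<open>- J v\<close> lies in the polar body.\<close>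

lemma admissible_derivative_le:
  assumes w: "admissible w" and t: "t \<in> {0<..<1}" and d: "(w has_vector_derivative v) (at t)" and x: "x \<in> K"
  shows "v \<bullet> J x \<le> 1"
proof (rule tendsto_upperbound)
  show "((\<lambda>s. ((w s - w t) /\<^sub>R (s - t)) \<bullet> J x) \<longlongrightarrow> v \<bullet> J x) (at t)"
    by (intro tendsto_intros has_vector_derivative_quotient_tendsto d)
  have "\<forall>\<^sub>F s in at t. s \<in> {0<..<1}"
    using t by (intro eventually_at_in_open') auto
  then show "\<forall>\<^sub>F s in at t. ((w s - w t) /\<^sub>R (s - t)) \<bullet> J x \<le> 1"
    using eventually_neq_at_within[of t]
  proof eventually_elim
    case (elim s)
    show ?case
    proof (cases "s < t")
      case True
      then show ?thesis
        using admissibleD[OF w, of s t x] elim t x by (simp add: divide_simps inner_diff_left)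
    next
      case False
      then show ?thesis
        using admissibleD[OF w, of t s x] elim t x by (simp add: divide_simps inner_diff_left)
    qed
  qed
qed simp

context
  fixes z y
  assumes cz: "closed_admissible z"
    and mult: "\<And>w. admissible w \<Longrightarrow> y \<bullet> w 1 + bilinear_action w z \<le> bilinear_action z z"
begin

text \<open>The competitor follows \<open>z\<close> up to time \<open>a\<close>, moves on a straight segment with velocity \<open>J u\<close> until time \<open>b\<close>,
and then repeats the increments of \<open>z\<close>. The clipped times make the three phases additive, which avoids a
case distinction on the position of \<open>s\<close> and \<open>t\<close>.\<close>

lemma admissible_splice:
  assumes ab: "0 \<le> a" "a \<le> b" "b \<le> 1" and u: "u \<in> polar" and z: "admissible z"
  shows "admissible (\<lambda>t. z (min t a) + (max a (min b t) - a) *\<^sub>R J u + (z (max t b) - z b))"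
  unfolding admissible_def
proof (intro conjI ballI impI)
  show "z (min 0 a) + (max a (min b 0) - a) *\<^sub>R J u + (z (max 0 b) - z b) = 0"
    using ab z by (simp add: admissible_def min_absorb1 max_absorb2 max_def)
  fix s t x assume st: "s \<in> {0..1::real}" "t \<in> {0..1}" "s \<le> t" and x: "x \<in> K"
  have 1: "(z (min t a) - z (min s a)) \<bullet> J x \<le> min t a - min s a"
    by (rule admissibleD[OF z]) (use st ab x in auto)
  have 2: "(z (max t b) - z (max s b)) \<bullet> J x \<le> max t b - max s b"
    by (rule admissibleD[OF z]) (use st ab x in auto)
  have "(max a (min b t) - max a (min b s)) * (u \<bullet> x) \<le> (max a (min b t) - max a (min b s)) * 1"
    using polarD[OF u x] st by (intro mult_left_mono) auto
  then have 3: "((max a (min b t) - max a (min b s)) *\<^sub>R J u) \<bullet> J x \<le> max a (min b t) - max a (min b s)"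
    by simp
  have eq: "z (min t a) + (max a (min b t) - a) *\<^sub>R J u + (z (max t b) - z b) -
         (z (min s a) + (max a (min b s) - a) *\<^sub>R J u + (z (max s b) - z b)) =
       (z (min t a) - z (min s a)) + (max a (min b t) - max a (min b s)) *\<^sub>R J u + (z (max t b) - z (max s b))"
    by (simp add: algebra_simps)
  have "(min t a - min s a) + (max a (min b t) - max a (min b s)) + (max t b - max s b) = t - s"
    using st ab by (auto simp: min_def max_def)
  then show "(z (min t a) + (max a (min b t) - a) *\<^sub>R J u + (z (max t b) - z b) -
         (z (min s a) + (max a (min b s) - a) *\<^sub>R J u + (z (max s b) - z b))) \<bullet> J x \<le> t - s"
    unfolding eq inner_add_left using 1 2 3 by linarith
qed

text \<open>The multiplier inequality for the spliced curve. The difference \<open>\<phi>\<close> to \<open>z\<close> vanishes before \<open>a\<close>, is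
constant after \<open>b\<close>, and is of order \<open>b - a\<close> in between, so the middle part contributes only to second
order.\<close>

lemma splice_inequality:
  assumes ab: "0 \<le> a" "a < b" "b \<le> 1" and u: "u \<in> polar"
  shows "((b - a) *\<^sub>R J u - (z b - z a)) \<bullet> (y + J (z b)) \<le> 2 * (b - a)\<^sup>2 / r\<^sup>2"
proof -
  have az: "admissible z" and z0: "z 0 = 0" and z1: "z 1 = 0"
    using cz by (auto simp: closed_admissible_def admissible_def)
  note cont_z = admissible_continuous[OF az] and ac_z = admissible_ac_curve[OF az]
  define w where "w t = z (min t a) + (max a (min b t) - a) *\<^sub>R J u + (z (max t b) - z b)" for t
  have aw: "admissible w" unfolding w_def using ab by (intro admissible_splice u az) auto
  note cont_w = admissible_continuous[OF aw]
  define \<phi> where "\<phi> t = w t - z t" for t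
  define \<phi>1 where "\<phi>1 = (b - a) *\<^sub>R J u - (z b - z a)"
  have cont_\<phi>: "continuous_on {0..1} \<phi>" unfolding \<phi>_def by (intro continuous_intros cont_w cont_z)
  have \<phi>_left: "\<phi> t = 0" if "t \<le> a" for t using that ab by (simp add: \<phi>_def w_def min_def max_def)
  have \<phi>_right: "\<phi> t = \<phi>1" if "b \<le> t" for t using that ab by (simp add: \<phi>_def \<phi>1_def w_def min_def max_def)
  have \<phi>_mid: "norm (J (\<phi> t)) \<le> 2 * (b - a) / r" if t: "t \<in> {a..b}" for t
  proof -
    have "min t a = a" "max a (min b t) = t" "max t b = b" using t ab by auto
    then have "\<phi> t = (t - a) *\<^sub>R J u - (z t - z a)"
      by (simp add: \<phi>_def w_def)
    then have "norm (\<phi> t) \<le> norm ((t - a) *\<^sub>R J u) + norm (z t - z a)"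
      using norm_triangle_ineq4 by metis
    also have "\<dots> \<le> (t - a) * (1 / r) + 1 / r * (t - a)"
    proof (rule add_mono)
      have "norm u \<le> 1 / r" using polar_bound u by (auto simp: subset_eq)
      then show "norm ((t - a) *\<^sub>R J u) \<le> (t - a) * (1 / r)"
        using t by (simp add: mult_left_mono del: times_divide_eq_right)
      show "norm (z t - z a) \<le> 1 / r * (t - a)"
        using lipschitz_onD[OF admissible_lipschitz[OF az], of t a] t ab by (simp add: dist_norm)
    qed
    also have "\<dots> = 2 * (t - a) / r" by simp
    also have "\<dots> \<le> 2 * (b - a) / r" using t r_pos by (intro divide_right_mono) auto
    finally show ?thesis by simp
  qed
  have int: "(\<lambda>t. J (\<phi> t) \<bullet> velocity z t) integrable_on {0..1}"
    by (rule bilinear_action_integrable[OF cont_\<phi> ac_z]) auto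
  define I where "I s t = integral {s..t} (\<lambda>t. J (\<phi> t) \<bullet> velocity z t)" for s t
  have "bilinear_action \<phi> z = I 0 a + I a b + I b 1"
  proof -
    have "I a b + I b 1 = I a 1"
      unfolding I_def using ab by (intro Henstock_Kurzweil_Integration.integral_combine
          bilinear_action_integrable[OF cont_\<phi> ac_z]) auto
    moreover have "I 0 a + I a 1 = I 0 1"
      unfolding I_def using ab by (intro Henstock_Kurzweil_Integration.integral_combine int) auto
    ultimately show ?thesis by (simp add: bilinear_action_def I_def)
  qed
  moreover have "I 0 a = 0"
    unfolding I_def by (rule integral_unique, rule has_integral_is_0) (simp add: \<phi>_left)
  moreover have "I b 1 = J \<phi>1 \<bullet> (z 1 - z b)"
  proof -
    have "I b 1 = integral {b..1} (\<lambda>t. J \<phi>1 \<bullet> velocity z t)"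
      unfolding I_def by (rule Henstock_Kurzweil_Integration.integral_cong) (simp add: \<phi>_right)
    then show ?thesis using integral_const_inner_velocity[OF ac_z, of b 1] ab by simp
  qed
  moreover have "\<bar>I a b\<bar> \<le> (2 * (b - a) / r) * (1 / r) * (b - a)"
    unfolding I_def using ab
    by (intro lipschitz_inner_velocity_bound admissible_lipschitz az continuous_on_J cont_\<phi> \<phi>_mid) auto
  moreover have "bilinear_action \<phi> z = bilinear_action w z - bilinear_action z z"
    unfolding \<phi>_def by (rule bilinear_action_diff_left[OF cont_w cont_z ac_z])
  moreover have "y \<bullet> \<phi>1 + bilinear_action w z \<le> bilinear_action z z"
  proof -
    have "w 1 = \<phi>1" using \<phi>_right[of 1] ab z1 by (simp add: \<phi>_def)
    then show ?thesis using mult[OF aw] by simp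
  qed
  moreover have "J \<phi>1 \<bullet> (z 1 - z b) = \<phi>1 \<bullet> J (z b)"
    using z1 by (simp add: J_skew)
  ultimately have "y \<bullet> \<phi>1 + \<phi>1 \<bullet> J (z b) \<le> (2 * (b - a) / r) * (1 / r) * (b - a)"
    by linarith
  also have "\<dots> = 2 * (b - a)\<^sup>2 / r\<^sup>2" by (simp add: power2_eq_square)
  finally show ?thesis by (simp add: \<phi>1_def inner_add_right inner_commute[of y])
qed

text \<open>Dividing the splice inequality by \<open>b - a\<close> and letting \<open>b\<close> tend to \<open>a\<close> turns the integral condition into a
pointwise one at every point of differentiability, with no measurable selection.\<close>

lemma pointwise_maximum:
  assumes t: "t \<in> {0<..<1}" and d: "(z has_vector_derivative v) (at t)" and u: "u \<in> polar"
  shows "J u \<bullet> (y + J (z t)) \<le> v \<bullet> (y + J (z t))"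
proof -
  have "((\<lambda>s. (J u - (z s - z t) /\<^sub>R (s - t)) \<bullet> (y + J (z s))) \<longlongrightarrow> (J u - v) \<bullet> (y + J (z t))) (at_right t)"
  proof (intro tendsto_intros)
    show "((\<lambda>s. (z s - z t) /\<^sub>R (s - t)) \<longlongrightarrow> v) (at_right t)"
      using has_vector_derivative_quotient_tendsto[OF d] by (rule filterlim_mono) (auto simp: at_le)
    have "(z \<longlongrightarrow> z t) (at t)"
      using has_vector_derivative_continuous[OF d] by (simp add: continuous_within)
    then have "(z \<longlongrightarrow> z t) (at_right t)"
      by (rule filterlim_mono) (auto simp: at_le)
    then show "((\<lambda>s. J (z s)) \<longlongrightarrow> J (z t)) (at_right t)"
      by (rule bounded_linear.tendsto[OF bounded_linear_J])
  qed
  moreover have "((\<lambda>s. 2 * (s - t) / r\<^sup>2) \<longlongrightarrow> 2 * (t - t) / r\<^sup>2) (at_right t)"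
    by (intro tendsto_intros) (use r_pos in auto)
  moreover have "\<forall>\<^sub>F s in at_right t. s \<in> {t<..<1}"
    using eventually_at_right_real[of t 1] t by simp
  then have "\<forall>\<^sub>F s in at_right t. (J u - (z s - z t) /\<^sub>R (s - t)) \<bullet> (y + J (z s)) \<le> 2 * (s - t) / r\<^sup>2"
  proof (rule eventually_mono)
    fix s assume s: "s \<in> {t<..<1}"
    have "((s - t) *\<^sub>R J u - (z s - z t)) \<bullet> (y + J (z s)) \<le> 2 * (s - t)\<^sup>2 / r\<^sup>2"
      using s t by (intro splice_inequality u) auto
    moreover have "((s - t) *\<^sub>R J u - (z s - z t)) = (s - t) *\<^sub>R (J u - (z s - z t) /\<^sub>R (s - t))"
      using s by (simp add: scaleR_diff_right)
    moreover have "2 * (s - t)\<^sup>2 / r\<^sup>2 = (s - t) * (2 * (s - t) / r\<^sup>2)"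
      by (simp add: power2_eq_square)
    ultimately have "(s - t) * ((J u - (z s - z t) /\<^sub>R (s - t)) \<bullet> (y + J (z s))) \<le> (s - t) * (2 * (s - t) / r\<^sup>2)"
      by (simp only: inner_scaleR_left)
    then show "(J u - (z s - z t) /\<^sub>R (s - t)) \<bullet> (y + J (z s)) \<le> 2 * (s - t) / r\<^sup>2"
      using s by (simp only: mult_le_cancel_left_pos greaterThanLessThan_iff diff_gt_0_iff_gt)
  qed
  ultimately have "(J u - v) \<bullet> (y + J (z t)) \<le> 2 * (t - t) / r\<^sup>2"
    by (intro tendsto_le[OF trivial_limit_at_right_real]) auto
  then show ?thesis by (simp add: inner_diff_left)
qed

end

text \<open>With \<open>\<zeta> = z - J y\<close> and velocity \<open>J v\<close>, the vector \<open>v t\<close> maximises the inner product with \<open>\<zeta> t\<close> over the polar body, and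
the maximum \<open>f t\<close> is the gauge of \<open>K\<close> at \<open>\<zeta> t\<close>. As \<open>v t\<close> is a subgradient of the gauge and
orthogonal to \<open>J (v t)\<close>, the derivative of \<open>f\<close> vanishes. Hence \<open>f\<close> is a constant \<open>\<rho>\<close>, which equals \<open>B(z,z)\<close>, and
\<open>\<zeta> / \<rho>\<close> is a characteristic. The constant \<open>m = 1 / \<rho>\<close> is the value of the support function of
\<open>K\<close> along the curve, that is, the characteristic runs at constant speed in this sense.\<close>

lemma extremal_characteristic:
  obtains \<gamma> m where "m > 0" "ac_curve \<gamma>" "generalized_closed_characteristic J K \<gamma>" "action J \<gamma> = m / 2"
    "AE t in lebesgue. t \<in> {0..1} \<longrightarrow>
        (\<exists>v \<in> normal_cone K (\<gamma> t). (\<gamma> has_vector_derivative J v) (at t) \<and> v \<bullet> \<gamma> t = m)"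
    "\<And>w. closed_admissible w \<Longrightarrow> bilinear_action w w \<le> 1 / m"
proof -
  obtain z where cz: "closed_admissible z"
    and max_z: "\<And>w. closed_admissible w \<Longrightarrow> bilinear_action w w \<le> bilinear_action z z"
    using closed_admissible_maximiser by blast
  have az: "admissible z" and z01: "z 0 = 0" "z 1 = 0"
    using cz by (auto simp: closed_admissible_def admissible_def)
  note lip_z = admissible_lipschitz[OF az] and cont_z = admissible_continuous[OF az]
    and ac_z = admissible_ac_curve[OF az]
  obtain y where mult: "\<And>w. admissible w \<Longrightarrow> y \<bullet> w 1 + bilinear_action w z \<le> bilinear_action z z"
    using closing_multiplier[OF cz max_z] by blast
  define \<zeta> where "\<zeta> t = z t - J y" for t
  have J\<zeta>: "J (\<zeta> t) = y + J (z t)" for t by (simp add: \<zeta>_def J_diff)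
  define f where "f t = support_fun polar (\<zeta> t)" for t
  have lip_f: "(1 / r * (1 / r))-lipschitz_on {0..1} f"
  proof (rule lipschitz_onI)
    fix s t :: real assume st: "s \<in> {0..1}" "t \<in> {0..1}"
    have "dist (f s) (f t) \<le> 1 / r * norm (\<zeta> s - \<zeta> t)"
      unfolding f_def dist_real_def using zero_in_polar polar_bound by (intro support_fun_lipschitz) auto
    also have "\<dots> \<le> 1 / r * (1 / r * dist s t)"
      using lipschitz_onD[OF lip_z st] r_pos by (intro mult_left_mono) (auto simp: \<zeta>_def dist_norm)
    finally show "dist (f s) (f t) \<le> 1 / r * (1 / r) * dist s t" by (simp only: mult.assoc)
  qed (use r_pos in simp)
  have ac_f: "ac_curve f" by (rule lipschitz_imp_ac_curve[OF lip_f])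
  define N where "N = {t \<in> {0..1}. \<not> (z has_vector_derivative velocity z t) (at t)} \<union>
     {t \<in> {0..1}. \<not> (f has_vector_derivative velocity f t) (at t)} \<union> {0, 1}"
  have N: "negligible N"
    unfolding N_def using ac_curve_AE_differentiable[OF ac_z] ac_curve_AE_differentiable[OF ac_f]
    by (intro negligible_Un) auto
  define v where "v t = - J (velocity z t)" for t
  have Jv: "J (v t) = velocity z t" for t by (simp add: v_def J_minus)
  have dz: "(z has_vector_derivative velocity z t) (at t)" and t01: "t \<in> {0<..<1}" if "t \<in> {0..1} - N" for t
    using that by (auto simp: N_def)
  have v_polar: "v t \<in> polar" if t: "t \<in> {0..1} - N" for t
    unfolding polar_def using admissible_derivative_le[OF az t01[OF t] dz[OF t]]
    by (simp add: v_def J_skew)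
  have v_max: "u \<bullet> \<zeta> t \<le> v t \<bullet> \<zeta> t" if t: "t \<in> {0..1} - N" and u: "u \<in> polar" for t u
    using pointwise_maximum[OF cz mult t01[OF t] dz[OF t] u] by (simp flip: J\<zeta> Jv)
  have f_eq: "f t = v t \<bullet> \<zeta> t" if t: "t \<in> {0..1} - N" for t
    unfolding f_def by (rule support_fun_eqI[OF bounded_polar v_polar[OF t] v_max[OF t]])
  have f'0: "velocity f t = 0" if t: "t \<in> {0..1} - N" for t
  proof -
    have df: "(f has_real_derivative velocity f t) (at t)"
      using t by (auto simp: N_def has_real_derivative_iff_has_vector_derivative)
    have "((\<lambda>s. v t \<bullet> \<zeta> s) has_vector_derivative v t \<bullet> velocity z t) (at t)"
      unfolding \<zeta>_def
      by (rule bounded_linear.has_vector_derivative[OF bounded_linear_inner_right])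
        (use dz[OF t] in \<open>auto intro!: derivative_eq_intros\<close>)
    moreover have "v t \<bullet> velocity z t = 0"
      unfolding Jv[symmetric] by (metis J_inner_self inner_commute)
    ultimately have "((\<lambda>s. v t \<bullet> \<zeta> s) has_real_derivative 0) (at t)"
      by (simp add: has_real_derivative_iff_has_vector_derivative)
    from DERIV_diff[OF df this] have "((\<lambda>s. f s - v t \<bullet> \<zeta> s) has_real_derivative velocity f t) (at t)"
      by simp
    \<comment> \<open>\<open>v t\<close> is a subgradient of the gauge at \<open>\<zeta> t\<close>, so this difference has a minimum at \<open>t\<close>.\<close>
    moreover have "f t - v t \<bullet> \<zeta> t \<le> f s - v t \<bullet> \<zeta> s" for s
      using f_eq[OF t] inner_le_support_fun[OF bounded_polar v_polar[OF t], of "\<zeta> s"] by (simp add: f_def)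
    ultimately show ?thesis
      by (intro DERIV_local_min[of _ _ t 1]) auto
  qed
  define \<rho> where "\<rho> = f 0"
  have f_const: "f t = \<rho>" if t: "t \<in> {0..1}" for t
  proof -
    have "(velocity f has_integral (f t - f 0)) {0..t}"
      using t by (intro ac_curve_has_integral_velocity ac_f) auto
    moreover have "(velocity f has_integral 0) {0..t}"
      by (rule has_integral_spike[OF N _ has_integral_0]) (use f'0 t in auto)
    ultimately have "f t - f 0 = 0" by (rule has_integral_unique)
    then show ?thesis by (simp add: \<rho>_def)
  qed
  have "bilinear_action z z = \<rho>"
  proof -
    have "((\<lambda>t. J (z t) \<bullet> velocity z t) has_integral \<rho> - y \<bullet> (z 1 - z 0)) {0..1}"
    proof (rule has_integral_spike[OF N])
      show "((\<lambda>t. \<rho> - y \<bullet> velocity z t) has_integral \<rho> - y \<bullet> (z 1 - z 0)) {0..1}"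
        using has_integral_const_real[of \<rho> 0 1]
        by (intro has_integral_diff inner_velocity_has_integral_const ac_z) auto
      fix t assume t: "t \<in> {0..1} - N"
      have "J (\<zeta> t) \<bullet> velocity z t = \<rho>"
        using f_eq[OF t] f_const[of t] t unfolding Jv[symmetric] by (simp add: inner_commute)
      then show "J (z t) \<bullet> velocity z t = \<rho> - y \<bullet> velocity z t"
        by (simp add: J\<zeta> inner_add_left)
    qed
    then show ?thesis unfolding bilinear_action_def using z01 by (simp add: integral_unique)
  qed
  then have \<rho>: "\<rho> > 0" using bilinear_action_max_pos[OF cz max_z] by simp
  define m where "m = 1 / \<rho>"
  have m: "m > 0" "m * \<rho> = 1" using \<rho> by (auto simp: m_def)
  define \<gamma> where "\<gamma> t = m *\<^sub>R \<zeta> t" for t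
  have lip_\<gamma>: "(m * (1 / r))-lipschitz_on {0..1} \<gamma>"
  proof (rule lipschitz_onI)
    fix s t :: real assume st: "s \<in> {0..1}" "t \<in> {0..1}"
    have "dist (\<gamma> s) (\<gamma> t) = m * dist (z s) (z t)"
      using m by (simp add: \<gamma>_def \<zeta>_def dist_norm flip: scaleR_diff_right)
    also have "\<dots> \<le> m * (1 / r * dist s t)"
      using lipschitz_onD[OF lip_z st] m by (intro mult_left_mono) auto
    finally show "dist (\<gamma> s) (\<gamma> t) \<le> m * (1 / r) * dist s t" by (simp only: mult.assoc)
  qed (use m r_pos in simp)
  have ac_\<gamma>: "ac_curve \<gamma>" by (rule lipschitz_imp_ac_curve[OF lip_\<gamma>])
  have frontier: "\<gamma> t \<in> frontier K" if t: "t \<in> {0..1}" for t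
  proof (rule frontierI)
    have "support_fun polar (\<gamma> t) = m * support_fun polar (\<zeta> t)"
      unfolding \<gamma>_def using zero_in_polar m(1) by (intro support_fun_scaleR bounded_polar) auto
    then show "support_fun polar (\<gamma> t) = 1"
      using f_const[OF t] m by (simp add: f_def)
  qed
  have d\<gamma>: "(\<gamma> has_vector_derivative J (m *\<^sub>R v t)) (at t)" if t: "t \<in> {0..1} - N" for t
    unfolding \<gamma>_def \<zeta>_def J_scaleR Jv
    using dz[OF t] by (auto intro!: derivative_eq_intros)
  have v\<gamma>: "m *\<^sub>R v t \<bullet> \<gamma> t = m" if t: "t \<in> {0..1} - N" for t
    using f_eq[OF t] f_const[of t] t m by (simp add: \<gamma>_def)
  have nc: "m *\<^sub>R v t \<in> normal_cone K (\<gamma> t)" if t: "t \<in> {0..1} - N" for t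
    unfolding normal_cone_def
  proof safe
    fix x assume x: "x \<in> K"
    have "m * (v t \<bullet> x) \<le> m * 1"
      using polarD[OF v_polar[OF t] x] m by (intro mult_left_mono) auto
    then show "m *\<^sub>R v t \<bullet> (x - \<gamma> t) \<le> 0"
      using v\<gamma>[OF t] m by (simp add: inner_diff_right)
  qed
  have AE: "AE t in lebesgue. t \<in> {0..1} \<longrightarrow>
        (\<exists>v \<in> normal_cone K (\<gamma> t). (\<gamma> has_vector_derivative J v) (at t) \<and> v \<bullet> \<gamma> t = m)"
    unfolding eventually_ae_filter_negligible
    using N d\<gamma> v\<gamma> nc by (intro exI[of _ N]) blast
  have bil: "bilinear_action \<gamma> \<gamma> = m"
  proof -
    have "((\<lambda>t. J (\<gamma> t) \<bullet> velocity \<gamma> t) has_integral m) {0..1}"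
    proof (rule has_integral_spike[OF N])
      show "((\<lambda>t. m) has_integral m) {0..1::real}" using has_integral_const_real[of m 0 1] by simp
      fix t assume t: "t \<in> {0..1} - N"
      show "J (\<gamma> t) \<bullet> velocity \<gamma> t = m"
        using vector_derivative_at[OF d\<gamma>[OF t]] v\<gamma>[OF t] by (simp add: inner_commute)
    qed
    then show ?thesis unfolding bilinear_action_def by (rule integral_unique)
  qed
  have "\<not> \<gamma> constant_on {0..1}"
  proof
    assume "\<gamma> constant_on {0..1}"
    then obtain c where c: "\<And>t. t \<in> {0..1} \<Longrightarrow> \<gamma> t = c" unfolding constant_on_def by blast
    have "bilinear_action \<gamma> \<gamma> = integral {0..1} (\<lambda>t. J c \<bullet> velocity \<gamma> t)"
      unfolding bilinear_action_def by (rule Henstock_Kurzweil_Integration.integral_cong) (simp add: c)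
    also have "\<dots> = 0" using integral_const_inner_velocity[OF ac_\<gamma>, of 0 1 c] by (simp add: c)
    finally show False using bil m by simp
  qed
  then have "generalized_closed_characteristic J K \<gamma>"
    unfolding generalized_closed_characteristic_def pathstart_def pathfinish_def path_image_def
    using ac_\<gamma> frontier AE z01 by (auto simp: ac_curve_def \<gamma>_def \<zeta>_def elim!: eventually_mono)
  moreover have "bilinear_action w w \<le> 1 / m" if "closed_admissible w" for w
    using max_z[OF that] \<open>bilinear_action z z = \<rho>\<close> \<rho> by (simp add: m_def)
  ultimately show ?thesis
    using that[of m \<gamma>] m ac_\<gamma> AE bil by (simp add: action_eq)
qed

end

section \<open>The isoperimetric inequality\<close>

text \<open>Telescoping over a fine uniform partition bounds \<open>F 1 - F 0\<close> by \<open>e\<close> times the total increment of \<open>\<mu>\<close>.\<close>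

lemma eq_if_small_increments:
  fixes F \<mu> :: "real \<Rightarrow> real"
  assumes small: "\<And>e. e > 0 \<Longrightarrow> \<exists>d>0. \<forall>a b. 0 \<le> a \<longrightarrow> a \<le> b \<longrightarrow> b \<le> 1 \<longrightarrow> b - a < d \<longrightarrow> \<bar>F b - F a\<bar> \<le> e * (\<mu> b - \<mu> a)"
  shows "F 1 = F 0"
proof -
  have est: "\<bar>F 1 - F 0\<bar> \<le> e * (\<mu> 1 - \<mu> 0)" if e: "e > 0" for e
  proof -
    obtain d where d: "d > 0" "\<And>a b. 0 \<le> a \<Longrightarrow> a \<le> b \<Longrightarrow> b \<le> 1 \<Longrightarrow> b - a < d \<Longrightarrow> \<bar>F b - F a\<bar> \<le> e * (\<mu> b - \<mu> a)"
      using small[OF e] by auto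
    obtain n0 :: nat where n0: "1 / real (Suc n0) < d"
      using nat_approx_posE[OF d(1)] by auto
    define n where "n = Suc n0"
    have n: "real n > 0" "1 / real n < d" using n0 by (auto simp: n_def)
    have step: "\<bar>F (real (Suc i) / n) - F (real i / n)\<bar> \<le> e * (\<mu> (real (Suc i) / n) - \<mu> (real i / n))"
      if "i < n" for i
    proof (rule d(2))
      show "real i / n \<le> real (Suc i) / n" using n by (intro divide_right_mono) auto
      show "real (Suc i) / n \<le> 1" using that n by (subst divide_le_eq_1_pos) auto
      have "real (Suc i) / n - real i / n = 1 / n" using n by (simp add: field_simps)
      then show "real (Suc i) / n - real i / n < d" using n by simp
    qed (use n in simp)
    have "F 1 - F 0 = (\<Sum>i<n. F (real (Suc i) / n) - F (real i / n))"
      using sum_lessThan_telescope[of "\<lambda>i. F (real i / n)" n] n by simp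
    also have "\<bar>\<dots>\<bar> \<le> (\<Sum>i<n. e * (\<mu> (real (Suc i) / n) - \<mu> (real i / n)))"
      by (rule order_trans[OF sum_abs sum_mono]) (use step in auto)
    also have "\<dots> = e * (\<mu> 1 - \<mu> 0)"
      using sum_lessThan_telescope[of "\<lambda>i. \<mu> (real i / n)" n] n by (simp flip: sum_distrib_left)
    finally show ?thesis .
  qed
  define c where "c = \<mu> 1 - \<mu> 0"
  have "\<bar>F 1 - F 0\<bar> \<le> 0"
  proof (rule field_le_epsilon)
    fix e :: real assume e: "e > 0"
    have c: "\<bar>c\<bar> + 1 > 0" by simp
    have "\<bar>F 1 - F 0\<bar> \<le> e / (\<bar>c\<bar> + 1) * c"
      unfolding c_def[symmetric] using est[of "e / (\<bar>c\<bar> + 1)"] e c by (simp add: c_def)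
    also have "\<dots> \<le> e / (\<bar>c\<bar> + 1) * (\<bar>c\<bar> + 1)"
      using e by (intro mult_left_mono) auto
    also have "\<dots> = e" using c by simp
    finally show "\<bar>F 1 - F 0\<bar> \<le> 0 + e" by simp
  qed
  then show ?thesis by simp
qed

context compatible_complex_structure
begin

lemma bilinear_action_local:
  assumes ac: "ac_curve q" and ab: "0 \<le> a" "a \<le> b" "b \<le> 1"
    and e: "\<And>t. t \<in> {a..b} \<Longrightarrow> norm (q t - q a) \<le> e"
  shows "\<bar>integral {a..b} (\<lambda>t. J (q t) \<bullet> velocity q t) - J (q a) \<bullet> (q b - q a)\<bar>
    \<le> e * integral {a..b} (\<lambda>t. norm (velocity q t))"
proof -
  note cont = ac_curve_continuous_on[OF ac]
  have "integral {a..b} (\<lambda>t. J (q t) \<bullet> velocity q t) - J (q a) \<bullet> (q b - q a) =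
      integral {a..b} (\<lambda>t. J (q t - q a) \<bullet> velocity q t)"
    unfolding integral_const_inner_velocity[OF ac ab, symmetric]
    using bilinear_action_integrable[OF cont ac, of a b]
      bilinear_action_integrable[OF continuous_on_const ac, of a b "q a"] ab
    by (subst Henstock_Kurzweil_Integration.integral_diff[symmetric]) (auto simp: J_diff inner_diff_left)
  also have "\<bar>\<dots>\<bar> \<le> e * integral {a..b} (\<lambda>t. norm (velocity q t))"
    using ab e by (intro inner_velocity_integral_bound ac continuous_on_J continuous_intros cont) auto
  finally show ?thesis .
qed

text \<open>The action is invariant under weakly monotone changes of time, under which a chain rule for derivatives would need
care. Instead, on a short interval both actions agree with the same Riemann-Stieltjes term up to
the oscillation of the curve times its length, so the difference \<open>F\<close> has small increments in the
sense of the previous lemma. The term with \<open>c\<close> accounts for the change of origin and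
cancels because \<open>\<gamma>\<close> is closed.\<close>

lemma bilinear_action_reparametrise:
  assumes ac\<gamma>: "ac_curve \<gamma>" and acz: "ac_curve z" and closed: "\<gamma> 0 = \<gamma> 1"
    and cont\<sigma>: "continuous_on {0..1} \<sigma>"
    and mono\<sigma>: "\<And>s t. 0 \<le> s \<Longrightarrow> s \<le> t \<Longrightarrow> t \<le> 1 \<Longrightarrow> \<sigma> s \<le> \<sigma> t"
    and \<sigma>01: "\<sigma> 0 = 0" "\<sigma> 1 = 1" and l: "l > 0"
    and eq: "\<And>t. t \<in> {0..1} \<Longrightarrow> \<gamma> t = c + l *\<^sub>R z (\<sigma> t)"
  shows "bilinear_action \<gamma> \<gamma> = l\<^sup>2 * bilinear_action z z"
proof -
  define A where "A q s t = integral {s..t} (\<lambda>t. J (q t) \<bullet> velocity q t)" for q s t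
  define V where "V q s t = integral {s..t} (\<lambda>t. norm (velocity q t))" for q :: "real \<Rightarrow> 'a" and s t
  note cont\<gamma> = ac_curve_continuous_on[OF ac\<gamma>] and contz = ac_curve_continuous_on[OF acz]
  have \<sigma>_in: "\<sigma> t \<in> {0..1}" if "t \<in> {0..1}" for t
    using mono\<sigma>[of 0 t] mono\<sigma>[of t 1] that \<sigma>01 by auto
  have A_add: "A q 0 t - A q 0 s = A q s t" if "ac_curve q" "0 \<le> s" "s \<le> t" "t \<le> 1" for q s t
    using Henstock_Kurzweil_Integration.integral_combine[of 0 s t "\<lambda>t. J (q t) \<bullet> velocity q t"] that
      bilinear_action_integrable[OF ac_curve_continuous_on[OF that(1)] that(1), of 0 t]
    unfolding A_def by simp
  have V_add: "V q 0 t - V q 0 s = V q s t" if "ac_curve q" "0 \<le> s" "s \<le> t" "t \<le> 1" for q s t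
    using Henstock_Kurzweil_Integration.integral_combine[of 0 s t "\<lambda>t. norm (velocity q t)"] that
      norm_velocity_integrable[OF that(1), of 0 t]
    unfolding V_def by simp
  define F where "F t = A \<gamma> 0 t - l\<^sup>2 * A z 0 (\<sigma> t) - J c \<bullet> \<gamma> t" for t
  define \<mu> where "\<mu> t = V \<gamma> 0 t + l * V z 0 (\<sigma> t)" for t
  have "F 1 = F 0"
  proof (rule eq_if_small_increments[where \<mu> = \<mu>])
    fix e :: real assume e: "e > 0"
    have "uniformly_continuous_on {0..1} \<gamma>"
      by (rule compact_uniformly_continuous[OF cont\<gamma>]) simp
    then obtain d where d: "d > 0"
      "\<And>s t. s \<in> {0..1} \<Longrightarrow> t \<in> {0..1} \<Longrightarrow> dist t s < d \<Longrightarrow> dist (\<gamma> t) (\<gamma> s) < e"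
      using e unfolding uniformly_continuous_on_def by metis
    have "\<bar>F b - F a\<bar> \<le> e * (\<mu> b - \<mu> a)" if ab: "0 \<le> a" "a \<le> b" "b \<le> 1" "b - a < d" for a b
    proof -
      have \<sigma>ab: "0 \<le> \<sigma> a" "\<sigma> a \<le> \<sigma> b" "\<sigma> b \<le> 1"
        using \<sigma>_in[of a] \<sigma>_in[of b] mono\<sigma>[of a b] ab by auto
      have osc: "norm (\<gamma> t - \<gamma> a) \<le> e" if "t \<in> {a..b}" for t
        using d(2)[of a t] that ab by (simp add: dist_norm less_imp_le)
      have oscz: "norm (z \<tau> - z (\<sigma> a)) \<le> e / l" if \<tau>: "\<tau> \<in> {\<sigma> a..\<sigma> b}" for \<tau>
      proof -
        have "continuous_on {a..b} \<sigma>" using cont\<sigma> by (rule continuous_on_subset) (use ab in auto)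
        then obtain t where t: "t \<in> {a..b}" "\<sigma> t = \<tau>"
          using IVT'[of \<sigma> a \<tau> b] \<tau> ab by auto
        have "l * norm (z \<tau> - z (\<sigma> a)) = norm (\<gamma> t - \<gamma> a)"
          using eq[of t] eq[of a] t ab l by (simp flip: scaleR_diff_right)
        then show ?thesis using osc[OF t(1)] l by (simp add: field_simps)
      qed
      have 1: "\<bar>A \<gamma> a b - J (\<gamma> a) \<bullet> (\<gamma> b - \<gamma> a)\<bar> \<le> e * V \<gamma> a b"
        unfolding A_def V_def by (rule bilinear_action_local[OF ac\<gamma> ab(1-3) osc])
      have 2: "\<bar>A z (\<sigma> a) (\<sigma> b) - J (z (\<sigma> a)) \<bullet> (z (\<sigma> b) - z (\<sigma> a))\<bar> \<le> e / l * V z (\<sigma> a) (\<sigma> b)"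
        unfolding A_def V_def by (rule bilinear_action_local[OF acz \<sigma>ab oscz])
      have "\<bar>l\<^sup>2 * A z (\<sigma> a) (\<sigma> b) - l\<^sup>2 * (J (z (\<sigma> a)) \<bullet> (z (\<sigma> b) - z (\<sigma> a)))\<bar>
          = l\<^sup>2 * \<bar>A z (\<sigma> a) (\<sigma> b) - J (z (\<sigma> a)) \<bullet> (z (\<sigma> b) - z (\<sigma> a))\<bar>"
        by (simp add: abs_mult flip: right_diff_distrib)
      also have "\<dots> \<le> l\<^sup>2 * (e / l * V z (\<sigma> a) (\<sigma> b))"
        by (intro mult_left_mono 2) auto
      also have "\<dots> = e * (l * V z (\<sigma> a) (\<sigma> b))" using l by (simp add: power2_eq_square)
      finally have 3: "\<bar>l\<^sup>2 * A z (\<sigma> a) (\<sigma> b) - l\<^sup>2 * (J (z (\<sigma> a)) \<bullet> (z (\<sigma> b) - z (\<sigma> a)))\<bar> \<le> e * (l * V z (\<sigma> a) (\<sigma> b))" .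
      have "J (\<gamma> a - c) \<bullet> (\<gamma> b - \<gamma> a) = l\<^sup>2 * (J (z (\<sigma> a)) \<bullet> (z (\<sigma> b) - z (\<sigma> a)))"
        using eq[of a] eq[of b] ab by (simp add: J_scaleR power2_eq_square flip: scaleR_diff_right)
      then have 4: "l\<^sup>2 * (J (z (\<sigma> a)) \<bullet> (z (\<sigma> b) - z (\<sigma> a))) = J (\<gamma> a) \<bullet> (\<gamma> b - \<gamma> a) - J c \<bullet> (\<gamma> b - \<gamma> a)"
        by (simp add: J_diff inner_diff_left)
      have "F b - F a = A \<gamma> a b - l\<^sup>2 * A z (\<sigma> a) (\<sigma> b) - J c \<bullet> (\<gamma> b - \<gamma> a)"
        unfolding F_def A_add[OF ac\<gamma> ab(1-3), symmetric] A_add[OF acz \<sigma>ab, symmetric]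
        by (simp add: algebra_simps)
      moreover have "\<mu> b - \<mu> a = V \<gamma> a b + l * V z (\<sigma> a) (\<sigma> b)"
        unfolding \<mu>_def V_add[OF ac\<gamma> ab(1-3), symmetric] V_add[OF acz \<sigma>ab, symmetric]
        by (simp add: algebra_simps)
      ultimately show ?thesis using 1 3 4 by (simp add: distrib_left)
    qed
    then show "\<exists>d>0. \<forall>a b. 0 \<le> a \<longrightarrow> a \<le> b \<longrightarrow> b \<le> 1 \<longrightarrow> b - a < d \<longrightarrow> \<bar>F b - F a\<bar> \<le> e * (\<mu> b - \<mu> a)"
      using d(1) by blast
  qed
  then show ?thesis
    using closed \<sigma>01 by (simp add: F_def A_def bilinear_action_def)
qed

end

context centred_convex_body
begin

context
  fixes \<gamma> \<beta> N
  assumes ac: "ac_curve \<gamma>" and closed: "\<gamma> 0 = \<gamma> 1"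
    and \<beta>: "\<beta> integrable_on {0..1}" and N: "negligible N"
    and le: "\<And>t x. t \<in> {0..1} - N \<Longrightarrow> x \<in> K \<Longrightarrow> velocity \<gamma> t \<bullet> J x \<le> \<beta> t"
begin

lemma increment_le_integral:
  assumes st: "0 \<le> s" "s \<le> t" "t \<le> 1" and x: "x \<in> K"
  shows "(\<gamma> t - \<gamma> s) \<bullet> J x \<le> integral {s..t} \<beta>"
proof -
  have "((\<lambda>t. J x \<bullet> velocity \<gamma> t) has_integral J x \<bullet> (\<gamma> t - \<gamma> s)) {s..t}"
    by (rule inner_velocity_has_integral_const[OF ac st])
  then have "(\<gamma> t - \<gamma> s) \<bullet> J x = integral {s..t} (\<lambda>t. J x \<bullet> velocity \<gamma> t)"
    "(\<lambda>t. J x \<bullet> velocity \<gamma> t) integrable_on {s..t}"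
    by (auto simp: integral_unique inner_commute has_integral_integrable)
  moreover have "\<beta> integrable_on {s..t}"
    using \<beta> by (rule integrable_on_subinterval) (use st in auto)
  ultimately show ?thesis
    using le x st by (simp, intro integral_le_AE[OF _ _ N]) (auto simp: inner_commute)
qed

lemma norm_increment_le_integral:
  assumes st: "0 \<le> s" "s \<le> t" "t \<le> 1"
  shows "r * norm (\<gamma> t - \<gamma> s) \<le> integral {s..t} \<beta>"
  by (rule J_inner_bound) (rule increment_le_integral[OF st])

lemma integral_\<beta>_combine:
  assumes "0 \<le> s" "s \<le> t" "t \<le> 1"
  shows "integral {0..t} \<beta> = integral {0..s} \<beta> + integral {s..t} \<beta>"
  using assms integrable_on_subinterval[OF \<beta>, of 0 t]
  by (intro Henstock_Kurzweil_Integration.integral_combine[symmetric]) auto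

lemma integral_\<beta>_mono:
  assumes "0 \<le> s" "s \<le> t" "t \<le> 1"
  shows "integral {0..s} \<beta> \<le> integral {0..t} \<beta>"
proof -
  have "0 \<le> r * norm (\<gamma> t - \<gamma> s)" using r_pos by simp
  then show ?thesis using integral_\<beta>_combine[OF assms] norm_increment_le_integral[OF assms] by linarith
qed

lemma zero_integral_imp_const:
  assumes "integral {0..1} \<beta> = 0" "t \<in> {0..1}"
  shows "\<gamma> t = \<gamma> 0"
proof -
  have "r * norm (\<gamma> t - \<gamma> 0) \<le> 0"
    using norm_increment_le_integral[of 0 t] integral_\<beta>_mono[of t 1] assms by auto
  then show ?thesis using r_pos by (simp add: mult_le_0_iff)
qed

text \<open>The normalised integral \<open>\<sigma>\<close> of \<open>\<beta>\<close> serves as new time. It may be constant on intervals, but \<open>\<gamma>\<close> is constant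
on them too, so \<open>\<gamma>\<close> is a function of \<open>\<sigma>\<close>; scaled by the total integral \<open>l\<close> it becomes a closed admissible
curve, whose action is at most the maximum.\<close>

lemma isoperimetric_centred:
  assumes m: "m > 0" and max: "\<And>w. closed_admissible w \<Longrightarrow> bilinear_action w w \<le> 1 / m"
  shows "m * bilinear_action \<gamma> \<gamma> \<le> (integral {0..1} \<beta>)\<^sup>2"
proof (cases "integral {0..1} \<beta> = 0")
  case True
  have "bilinear_action \<gamma> \<gamma> = integral {0..1} (\<lambda>t. J (\<gamma> 0) \<bullet> velocity \<gamma> t)"
    unfolding bilinear_action_def
  proof (rule Henstock_Kurzweil_Integration.integral_cong)
    fix t :: real assume "t \<in> {0..1}"
    from zero_integral_imp_const[OF True this]
    show "J (\<gamma> t) \<bullet> velocity \<gamma> t = J (\<gamma> 0) \<bullet> velocity \<gamma> t"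
      by (rule arg_cong[where f = "\<lambda>x. J x \<bullet> velocity \<gamma> t"])
  qed
  also have "\<dots> = 0"
    using integral_const_inner_velocity[OF ac, of 0 1] closed by simp
  finally show ?thesis by simp
next
  case False
  define l where "l = integral {0..1} \<beta>"
  have l: "l > 0" using False integral_\<beta>_mono[of 0 1] by (simp add: l_def)
  define \<sigma> where "\<sigma> t = integral {0..t} \<beta> / l" for t
  have \<sigma>01: "\<sigma> 0 = 0" "\<sigma> 1 = 1" using l by (auto simp: \<sigma>_def l_def)
  have cont\<sigma>: "continuous_on {0..1} \<sigma>"
    unfolding \<sigma>_def using l by (intro continuous_intros indefinite_integral_continuous_1 \<beta>) auto
  have mono\<sigma>: "\<sigma> s \<le> \<sigma> t" if "0 \<le> s" "s \<le> t" "t \<le> 1" for s t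
    unfolding \<sigma>_def using integral_\<beta>_mono[OF that] l by (simp add: divide_right_mono)
  have same: "\<gamma> s = \<gamma> t" if st: "s \<in> {0..1}" "t \<in> {0..1}" "\<sigma> s = \<sigma> t" for s t
  proof -
    have *: "\<gamma> s = \<gamma> t" if "0 \<le> s" "s \<le> t" "t \<le> 1" "\<sigma> s = \<sigma> t" for s t
    proof -
      have "r * norm (\<gamma> t - \<gamma> s) \<le> 0"
        using norm_increment_le_integral[OF that(1-3)] integral_\<beta>_combine[OF that(1-3)] that(4) l
        by (simp add: \<sigma>_def)
      then show ?thesis using r_pos by (simp add: mult_le_0_iff)
    qed
    show ?thesis
    proof (cases "s \<le> t")
      case True
      show ?thesis by (rule *) (use st True in auto)
    next
      case False
      show ?thesis by (rule *[symmetric]) (use st False in auto)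
    qed
  qed
  have key: "(\<gamma> t - \<gamma> s) \<bullet> J x \<le> l * (\<sigma> t - \<sigma> s)"
    if st: "s \<in> {0..1}" "t \<in> {0..1}" "\<sigma> s \<le> \<sigma> t" and x: "x \<in> K" for s t x
  proof (cases "s \<le> t")
    case True
    have "integral {s..t} \<beta> = l * (\<sigma> t - \<sigma> s)"
      using integral_\<beta>_combine[of s t] st True l by (simp add: \<sigma>_def field_simps)
    then show ?thesis using increment_le_integral[of s t x] st True x by simp
  next
    case False
    then have "\<sigma> s = \<sigma> t" using mono\<sigma>[of t s] st by auto
    then show ?thesis using same[OF st(1,2)] by simp
  qed
  have "\<exists>t\<in>{0..1}. \<sigma> t = \<tau>" if "\<tau> \<in> {0..1}" for \<tau>
    using IVT'[of \<sigma> 0 \<tau> 1] cont\<sigma> \<sigma>01 that by auto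
  then obtain p where p: "\<And>\<tau>. \<tau> \<in> {0..1} \<Longrightarrow> p \<tau> \<in> {0..1}" "\<And>\<tau>. \<tau> \<in> {0..1} \<Longrightarrow> \<sigma> (p \<tau>) = \<tau>"
    by metis
  define z where "z \<tau> = (1 / l) *\<^sub>R (\<gamma> (p \<tau>) - \<gamma> 0)" for \<tau>
  have \<sigma>_in: "\<sigma> t \<in> {0..1}" if "t \<in> {0..1}" for t
    using mono\<sigma>[of 0 t] mono\<sigma>[of t 1] that \<sigma>01 by auto
  have z\<sigma>: "\<gamma> t = \<gamma> 0 + l *\<^sub>R z (\<sigma> t)" if t: "t \<in> {0..1}" for t
    using same[OF p(1)[OF \<sigma>_in[OF t]] t p(2)[OF \<sigma>_in[OF t]]] l by (simp add: z_def)
  have "admissible z"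
    unfolding admissible_def
  proof (intro conjI ballI impI)
    show "z 0 = 0" using same[of "p 0" 0] p[of 0] \<sigma>01 by (simp add: z_def)
    fix s t x assume st: "s \<in> {0..1::real}" "t \<in> {0..1}" "s \<le> t" and x: "x \<in> K"
    have "(z t - z s) \<bullet> J x = (1 / l) * ((\<gamma> (p t) - \<gamma> (p s)) \<bullet> J x)"
      by (simp add: z_def flip: scaleR_diff_right)
    also have "\<dots> \<le> (1 / l) * (l * (t - s))"
      using key[OF p(1)[OF st(1)] p(1)[OF st(2)] _ x] p(2)[OF st(1)] p(2)[OF st(2)] st l
      by (intro mult_left_mono) auto
    finally show "(z t - z s) \<bullet> J x \<le> t - s" using l by simp
  qed
  moreover have "z 1 = 0" using same[of "p 1" 1] p[of 1] \<sigma>01 closed by (simp add: z_def)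
  ultimately have cz: "closed_admissible z" and az: "admissible z" by (auto simp: closed_admissible_def)
  have "bilinear_action \<gamma> \<gamma> = l\<^sup>2 * bilinear_action z z"
    by (rule bilinear_action_reparametrise[OF ac admissible_ac_curve[OF az] closed cont\<sigma> mono\<sigma> \<sigma>01 l z\<sigma>])
  also have "\<dots> \<le> l\<^sup>2 * (1 / m)" by (intro mult_left_mono max cz) auto
  finally show ?thesis using m by (simp add: l_def field_simps)
qed

end

end

section \<open>Minimal action and the isoperimetric inequality for convex bodies\<close>

lemma has_vector_derivative_translation:
  "((\<lambda>t. a + \<gamma> t) has_vector_derivative v) F \<longleftrightarrow> (\<gamma> has_vector_derivative v) F"
proof
  assume "((\<lambda>t. a + \<gamma> t) has_vector_derivative v) F"
  from has_vector_derivative_add[OF has_vector_derivative_const[of "- a"] this]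
  show "(\<gamma> has_vector_derivative v) F" by simp
next
  assume "(\<gamma> has_vector_derivative v) F"
  from has_vector_derivative_add[OF has_vector_derivative_const[of a] this]
  show "((\<lambda>t. a + \<gamma> t) has_vector_derivative v) F" by simp
qed

lemma velocity_translation: "velocity (\<lambda>t. a + \<gamma> t) s = velocity \<gamma> s"
  unfolding vector_derivative_def has_vector_derivative_translation ..

lemma normal_cone_translation: "normal_cone ((+) a ` K) (a + x) = normal_cone K x"
  by (auto simp: normal_cone_def)

lemma convex_body_translation:
  assumes "convex_body K"
  shows "convex_body ((+) a ` K)"
  using assms by (simp add: convex_body_def compact_translation convex_translation interior_translation)

context compatible_complex_structure
begin

lemma generalized_closed_characteristic_obtain:
  assumes "generalized_closed_characteristic J K \<gamma>"
  obtains N where "negligible N" "\<And>t. t \<in> {0..1} - N \<Longrightarrow> \<exists>v \<in> normal_cone K (\<gamma> t). (\<gamma> has_vector_derivative J v) (at t)"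
proof -
  have "AE t in lebesgue. t \<in> {0..1} \<longrightarrow>
        (\<exists>v \<in> normal_cone K (\<gamma> t). (\<gamma> has_vector_derivative J v) (at t))"
    using assms by (simp add: generalized_closed_characteristic_def)
  then obtain N where N: "negligible N"
    "{t. \<not> (t \<in> {0..1} \<longrightarrow> (\<exists>v \<in> normal_cone K (\<gamma> t). (\<gamma> has_vector_derivative J v) (at t)))} \<subseteq> N"
    unfolding eventually_ae_filter_negligible by blast
  then show ?thesis using that[OF N(1)] by blast
qed

lemma generalized_closed_characteristic_ac_curve:
  assumes "generalized_closed_characteristic J K \<gamma>"
  shows "ac_curve \<gamma>" "\<gamma> 0 = \<gamma> 1"
proof -
  obtain N where N: "negligible N"
    "\<And>t. t \<in> {0..1} - N \<Longrightarrow> \<exists>v \<in> normal_cone K (\<gamma> t). (\<gamma> has_vector_derivative J v) (at t)"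
    using generalized_closed_characteristic_obtain[OF assms] by blast
  have "{t \<in> {0..1}. \<not> \<gamma> differentiable (at t)} \<subseteq> N"
    using N(2) differentiableI_vector by blast
  then show "ac_curve \<gamma>"
    using N(1) assms negligible_subset
    unfolding ac_curve_def generalized_closed_characteristic_def by blast
  show "\<gamma> 0 = \<gamma> 1"
    using assms by (simp add: generalized_closed_characteristic_def pathstart_def pathfinish_def)
qed

lemma action_translation:
  assumes "ac_curve \<gamma>" "\<gamma> 0 = \<gamma> 1"
  shows "action J (\<lambda>t. a + \<gamma> t) = action J \<gamma>"
proof -
  have "bilinear_action (\<lambda>t. a + \<gamma> t) (\<lambda>t. a + \<gamma> t) = bilinear_action (\<lambda>t. a + 1 *\<^sub>R \<gamma> t) \<gamma>"
    unfolding bilinear_action_def velocity_translation by simp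
  also have "\<dots> = bilinear_action (\<lambda>t. a) \<gamma> + 1 * bilinear_action \<gamma> \<gamma>"
    by (intro bilinear_action_add_left continuous_on_const ac_curve_continuous_on[OF assms(1)] assms(1))
  also have "bilinear_action (\<lambda>t. a) \<gamma> = 0"
    unfolding bilinear_action_def using integral_const_inner_velocity[OF assms(1), of 0 1 a] assms(2) by simp
  finally show ?thesis by (simp add: action_eq)
qed

lemma generalized_closed_characteristic_translation:
  assumes "generalized_closed_characteristic J K \<gamma>"
  shows "generalized_closed_characteristic J ((+) a ` K) (\<lambda>t. a + \<gamma> t)"
  unfolding generalized_closed_characteristic_def
proof (intro conjI)
  show "absolutely_continuous_curve (\<lambda>t. a + \<gamma> t)"
    using assms by (simp add: generalized_closed_characteristic_def absolutely_continuous_curve_def)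
  show "pathstart (\<lambda>t. a + \<gamma> t) = pathfinish (\<lambda>t. a + \<gamma> t)"
    using assms by (simp add: generalized_closed_characteristic_def pathstart_def pathfinish_def)
  show "\<not> (\<lambda>t. a + \<gamma> t) constant_on {0..1}"
  proof
    assume "(\<lambda>t. a + \<gamma> t) constant_on {0..1}"
    then obtain c where "\<And>t. t \<in> {0..1} \<Longrightarrow> a + \<gamma> t = c" unfolding constant_on_def by blast
    then have "\<And>t. t \<in> {0..1} \<Longrightarrow> \<gamma> t = c - a" by force
    then have "\<gamma> constant_on {0..1}" unfolding constant_on_def by blast
    then show False using assms by (simp add: generalized_closed_characteristic_def)
  qed
  show "path_image (\<lambda>t. a + \<gamma> t) \<subseteq> frontier ((+) a ` K)"
    using assms by (auto simp: generalized_closed_characteristic_def frontier_translation path_image_def)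
  show "AE t in lebesgue. t \<in> {0..1} \<longrightarrow>
        (\<exists>v \<in> normal_cone ((+) a ` K) (a + \<gamma> t). ((\<lambda>t. a + \<gamma> t) has_vector_derivative J v) (at t))"
    using assms by (simp add: generalized_closed_characteristic_def normal_cone_translation has_vector_derivative_translation)
qed

lemma c_EHZ_translation: "c_EHZ J ((+) a ` K) = c_EHZ J K"
proof -
  have sub: "{action J \<gamma> |\<gamma>. generalized_closed_characteristic J K \<gamma>} \<subseteq>
      {action J \<gamma> |\<gamma>. generalized_closed_characteristic J ((+) a ` K) \<gamma>}" for a K
  proof safe
    fix \<gamma> assume \<gamma>: "generalized_closed_characteristic J K \<gamma>"
    show "\<exists>\<gamma>'. action J \<gamma> = action J \<gamma>' \<and> generalized_closed_characteristic J ((+) a ` K) \<gamma>'"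
    proof (intro exI[of _ "\<lambda>t. a + \<gamma> t"] conjI)
      show "action J \<gamma> = action J (\<lambda>t. a + \<gamma> t)"
        by (rule action_translation[OF generalized_closed_characteristic_ac_curve[OF \<gamma>], symmetric])
    qed (rule generalized_closed_characteristic_translation[OF \<gamma>])
  qed
  have inv: "(+) (- a) ` (+) a ` K = K" by (simp add: image_image)
  show ?thesis
    unfolding c_EHZ_def
    by (rule arg_cong[where f = Inf], rule subset_antisym)
      (rule sub[of "(+) a ` K" "- a", unfolded inv], rule sub)
qed

text \<open>The extremal characteristic has the least action: for any other closed characteristic \<open>\<eta>\<close>, twice the action is
the integral of the support function of \<open>K\<close> along it, so that the isoperimetric inequality with
\<open>\<beta> = \<omega>(\<eta>, \<eta>')\<close> reads \<open>m B \<le> B\<^sup>2\<close> for \<open>B = B(\<eta>,\<eta>)\<close>.\<close>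

lemma minimal_characteristic_centred:
  assumes K: "convex_body K" and k0: "0 \<in> interior K"
  obtains \<gamma> where "generalized_closed_characteristic J K \<gamma>" "action J \<gamma> = c_EHZ J K" "c_EHZ J K > 0"
    "AE t in lebesgue. t \<in> {0..1} \<longrightarrow>
        (\<exists>v \<in> normal_cone K (\<gamma> t). (\<gamma> has_vector_derivative J v) (at t) \<and> v \<bullet> \<gamma> t = 2 * c_EHZ J K)"
    "\<And>\<gamma> \<beta> N. ac_curve \<gamma> \<Longrightarrow> \<gamma> 0 = \<gamma> 1 \<Longrightarrow> \<beta> integrable_on {0..1} \<Longrightarrow> negligible N \<Longrightarrow>
        (\<And>t x. t \<in> {0..1} - N \<Longrightarrow> x \<in> K \<Longrightarrow> velocity \<gamma> t \<bullet> J x \<le> \<beta> t) \<Longrightarrow>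
        c_EHZ J K * action J \<gamma> \<le> (integral {0..1} \<beta> / 2)\<^sup>2"
proof -
  have K': "compact K" "convex K" using K by (auto simp: convex_body_def)
  obtain r where r: "r > 0" "cball 0 r \<subseteq> K" using k0 mem_interior_cball by blast
  obtain R where "\<forall>x\<in>K. norm x \<le> R" using compact_imp_bounded[OF K'(1)] unfolding bounded_iff by blast
  then have R: "K \<subseteq> cball 0 R" by auto
  interpret centred_convex_body J K r R
    by unfold_locales (use K' r R compact_imp_closed in auto)
  obtain \<gamma> m where m: "m > 0" and \<gamma>: "generalized_closed_characteristic J K \<gamma>" "action J \<gamma> = m / 2"
    and AE: "AE t in lebesgue. t \<in> {0..1} \<longrightarrow>
        (\<exists>v \<in> normal_cone K (\<gamma> t). (\<gamma> has_vector_derivative J v) (at t) \<and> v \<bullet> \<gamma> t = m)"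
    and max: "\<And>w. closed_admissible w \<Longrightarrow> bilinear_action w w \<le> 1 / m"
    using extremal_characteristic by blast
  have lower: "m / 2 \<le> action J \<eta>" if \<eta>: "generalized_closed_characteristic J K \<eta>" for \<eta>
  proof -
    obtain N where N: "negligible N"
      "\<And>t. t \<in> {0..1} - N \<Longrightarrow> \<exists>v \<in> normal_cone K (\<eta> t). (\<eta> has_vector_derivative J v) (at t)"
      using generalized_closed_characteristic_obtain[OF \<eta>] by blast
    note ac = generalized_closed_characteristic_ac_curve(1)[OF \<eta>] and closed = generalized_closed_characteristic_ac_curve(2)[OF \<eta>]
    define \<beta> where "\<beta> t = J (\<eta> t) \<bullet> velocity \<eta> t" for t
    have int: "\<beta> integrable_on {0..1}"
      unfolding \<beta>_def by (rule bilinear_action_integrable[OF ac_curve_continuous_on[OF ac] ac]) auto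
    have le: "velocity \<eta> t \<bullet> J x \<le> \<beta> t" if t: "t \<in> {0..1} - N" and x: "x \<in> K" for t x
    proof -
      obtain v where v: "v \<in> normal_cone K (\<eta> t)" "(\<eta> has_vector_derivative J v) (at t)"
        using N(2)[OF t] by blast
      have "v \<bullet> (x - \<eta> t) \<le> 0" using v(1) x by (simp add: normal_cone_def)
      then show ?thesis
        unfolding \<beta>_def vector_derivative_at[OF v(2)] by (simp add: inner_diff_right inner_commute)
    qed
    have I: "integral {0..1} \<beta> = bilinear_action \<eta> \<eta>"
      unfolding \<beta>_def bilinear_action_def ..
    have "integral {0..1} \<beta> \<noteq> 0"
    proof
      assume 0: "integral {0..1} \<beta> = 0"
      have "\<And>t. t \<in> {0..1} \<Longrightarrow> \<eta> t = \<eta> 0"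
        by (rule zero_integral_imp_const[OF ac closed int N(1) le 0])
      then have "\<eta> constant_on {0..1}" unfolding constant_on_def by blast
      then show False using \<eta> by (simp add: generalized_closed_characteristic_def)
    qed
    moreover have "integral {0..1} \<beta> \<ge> 0"
      using integral_\<beta>_mono[OF ac closed int N(1) le, of 0 1] by simp
    ultimately have pos: "bilinear_action \<eta> \<eta> > 0" using I by simp
    have "m * bilinear_action \<eta> \<eta> \<le> (bilinear_action \<eta> \<eta>)\<^sup>2"
      using isoperimetric_centred[OF ac closed int N(1) le m max] I by simp
    then have "m \<le> bilinear_action \<eta> \<eta>" using pos by (simp add: power2_eq_square)
    then show ?thesis by (simp add: action_eq)
  qed
  have c: "c_EHZ J K = m / 2"
    unfolding c_EHZ_def
  proof (rule cInf_eq_minimum)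
    show "m / 2 \<in> {action J \<gamma> |\<gamma>. generalized_closed_characteristic J K \<gamma>}" using \<gamma> by force
  qed (use lower in auto)
  show ?thesis
  proof (rule that[OF \<gamma>(1)])
    show "AE t in lebesgue. t \<in> {0..1} \<longrightarrow>
        (\<exists>v \<in> normal_cone K (\<gamma> t). (\<gamma> has_vector_derivative J v) (at t) \<and> v \<bullet> \<gamma> t = 2 * c_EHZ J K)"
      using AE by (simp add: c)
    fix \<gamma> \<beta> N assume *: "ac_curve \<gamma>" "\<gamma> 0 = \<gamma> 1" "\<beta> integrable_on {0..1}" "negligible N"
        "\<And>t x. t \<in> {0..1} - N \<Longrightarrow> x \<in> K \<Longrightarrow> velocity \<gamma> t \<bullet> J x \<le> \<beta> t"
    have "m * bilinear_action \<gamma> \<gamma> \<le> (integral {0..1} \<beta>)\<^sup>2"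
      by (rule isoperimetric_centred[OF * m max])
    then show "c_EHZ J K * action J \<gamma> \<le> (integral {0..1} \<beta> / 2)\<^sup>2"
      by (simp add: c action_eq power_divide)
  qed (use \<gamma> c m in auto)
qed

lemma translated_interior:
  fixes k0 :: 'a
  assumes "k0 \<in> interior K"
  shows "0 \<in> interior ((+) (- k0) ` K)"
  unfolding interior_translation using assms by (intro image_eqI[of _ _ k0]) auto

theorem c_EHZ_pos:
  assumes K: "convex_body K"
  shows "c_EHZ J K > 0"
proof -
  obtain k0 where k0: "k0 \<in> interior K" using K by (auto simp: convex_body_def)
  show ?thesis
  proof (rule minimal_characteristic_centred[OF convex_body_translation[OF K] translated_interior[OF k0]])
    assume "c_EHZ J ((+) (- k0) ` K) > 0"
    then show ?thesis by (simp only: c_EHZ_translation)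
  qed
qed

text \<open>The parametrisation depends on the choice of the interior point \<open>k0\<close> from which the support function
is measured.\<close>

theorem minimal_characteristic:
  assumes K: "convex_body K" and k0: "k0 \<in> interior K"
  obtains \<gamma> where "generalized_closed_characteristic J K \<gamma>" "action J \<gamma> = c_EHZ J K"
    "AE t in lebesgue. t \<in> {0..1} \<longrightarrow>
        (\<exists>v \<in> normal_cone K (\<gamma> t). (\<gamma> has_vector_derivative J v) (at t) \<and> v \<bullet> (\<gamma> t - k0) = 2 * c_EHZ J K)"
proof -
  have inv: "(+) k0 ` (+) (- k0) ` K = K" by (simp add: image_image)
  have c: "c_EHZ J ((+) (- k0) ` K) = c_EHZ J K" by (rule c_EHZ_translation)
  obtain \<gamma> where \<gamma>: "generalized_closed_characteristic J ((+) (- k0) ` K) \<gamma>" "action J \<gamma> = c_EHZ J K"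
    and AE: "AE t in lebesgue. t \<in> {0..1} \<longrightarrow>
        (\<exists>v \<in> normal_cone ((+) (- k0) ` K) (\<gamma> t). (\<gamma> has_vector_derivative J v) (at t) \<and> v \<bullet> \<gamma> t = 2 * c_EHZ J K)"
    by (rule minimal_characteristic_centred[OF convex_body_translation[OF K] translated_interior[OF k0], unfolded c])
  show ?thesis
  proof (rule that[of "\<lambda>t. k0 + \<gamma> t"])
    show "generalized_closed_characteristic J K (\<lambda>t. k0 + \<gamma> t)"
      using generalized_closed_characteristic_translation[OF \<gamma>(1), of k0] unfolding inv .
    show "action J (\<lambda>t. k0 + \<gamma> t) = c_EHZ J K"
      using \<gamma>(2) by (simp only: action_translation[OF generalized_closed_characteristic_ac_curve[OF \<gamma>(1)]])
    have "normal_cone ((+) (- k0) ` K) (\<gamma> t) = normal_cone K (k0 + \<gamma> t)" for t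
      using normal_cone_translation[of "- k0" K "k0 + \<gamma> t"] by simp
    then show "AE t in lebesgue. t \<in> {0..1} \<longrightarrow>
        (\<exists>v \<in> normal_cone K (k0 + \<gamma> t). ((\<lambda>t. k0 + \<gamma> t) has_vector_derivative J v) (at t) \<and> v \<bullet> (k0 + \<gamma> t - k0) = 2 * c_EHZ J K)"
      using AE by (simp add: has_vector_derivative_translation)
  qed
qed

text \<open>Translating \<open>K\<close> by \<open>- k0\<close> changes \<open>\<beta>\<close> by the derivative of a linear function of the closed curve \<open>\<gamma>\<close>, hence not its integral.\<close>

theorem isoperimetric_inequality:
  assumes K: "convex_body K" and ac: "ac_curve \<gamma>" and closed: "\<gamma> 0 = \<gamma> 1"
    and \<beta>: "\<beta> integrable_on {0..1}" and N: "negligible N"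
    and le: "\<And>t x. t \<in> {0..1} - N \<Longrightarrow> x \<in> K \<Longrightarrow> velocity \<gamma> t \<bullet> J x \<le> \<beta> t"
  shows "c_EHZ J K * action J \<gamma> \<le> (integral {0..1} \<beta> / 2)\<^sup>2"
proof -
  obtain k0 where k0: "k0 \<in> interior K" using K by (auto simp: convex_body_def)
  \<comment> \<open>The bound for the translated body.\<close>
  define \<beta>' where "\<beta>' t = \<beta> t - J k0 \<bullet> velocity \<gamma> t" for t
  have "((\<lambda>t. \<beta>' t) has_integral integral {0..1} \<beta> - J k0 \<bullet> (\<gamma> 1 - \<gamma> 0)) {0..1}"
    unfolding \<beta>'_def
    by (intro has_integral_diff integrable_integral \<beta> inner_velocity_has_integral_const ac) auto
  then have I: "\<beta>' integrable_on {0..1}" "integral {0..1} \<beta>' = integral {0..1} \<beta>"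
    using closed by (auto simp: integral_unique has_integral_integrable)
  have le': "velocity \<gamma> t \<bullet> J x \<le> \<beta>' t" if t: "t \<in> {0..1} - N" and x: "x \<in> (+) (- k0) ` K" for t x
  proof -
    obtain k where k: "k \<in> K" "x = k - k0" using x by auto
    show ?thesis using le[OF t k(1)] by (simp add: k \<beta>'_def J_diff inner_diff_right inner_commute)
  qed
  show ?thesis
  proof (rule minimal_characteristic_centred[OF convex_body_translation[OF K] translated_interior[OF k0]])
    assume iso: "\<And>\<gamma> \<beta> N. ac_curve \<gamma> \<Longrightarrow> \<gamma> 0 = \<gamma> 1 \<Longrightarrow> \<beta> integrable_on {0..1} \<Longrightarrow> negligible N \<Longrightarrow>
        (\<And>t x. t \<in> {0..1} - N \<Longrightarrow> x \<in> (+) (- k0) ` K \<Longrightarrow> velocity \<gamma> t \<bullet> J x \<le> \<beta> t) \<Longrightarrow>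
        c_EHZ J ((+) (- k0) ` K) * action J \<gamma> \<le> (integral {0..1} \<beta> / 2)\<^sup>2"
    have "c_EHZ J ((+) (- k0) ` K) * action J \<gamma> \<le> (integral {0..1} \<beta>' / 2)\<^sup>2"
      by (rule iso[OF ac closed I(1) N le'])
    then show ?thesis by (simp only: c_EHZ_translation I(2))
  qed
qed

end

section \<open>Convexity of the p-product\<close>

lemma powr_le_one_imp_le_one:
  fixes x :: real
  assumes "r > 0" "x powr r \<le> 1"
  shows "x \<le> 1"
proof (rule ccontr)
  assume "\<not> x \<le> 1"
  then have "1 powr r < x powr r" using assms by (intro powr_less_mono2) auto
  then show False using assms by simp
qed

lemma weighted_AM_GM:
  fixes a b :: real
  assumes "0 \<le> \<alpha>" "0 \<le> \<beta>" "\<alpha> + \<beta> = 1" "a \<ge> 0" "b \<ge> 0"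
  shows "a powr \<alpha> * b powr \<beta> \<le> \<alpha> * a + \<beta> * b"
  using Youngs_inequality_0[of \<alpha> \<beta> a b] assms by (cases "a = 0 \<or> b = 0") auto

text \<open>The graph of \<open>x powr r\<close> lies above its tangent at \<open>m\<close>, in a form that is also correct for \<open>m = 0\<close>.\<close>

lemma powr_tangent_le:
  fixes m a :: real
  assumes "r \<ge> 1" "m \<ge> 0" "a \<ge> 0"
  shows "m powr (r - 1) * a \<le> (1 - 1 / r) * m powr r + (1 / r) * a powr r"
proof -
  have "(m powr r) powr (1 - 1 / r) * (a powr r) powr (1 / r) \<le> (1 - 1 / r) * m powr r + (1 / r) * a powr r"
    using assms by (intro weighted_AM_GM) auto
  moreover have "(m powr r) powr (1 - 1 / r) = m powr (r - 1)"
    using assms by (simp add: powr_powr right_diff_distrib)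
  moreover have "(a powr r) powr (1 / r) = a"
    using assms by (simp add: powr_powr)
  ultimately show ?thesis by simp
qed

lemma powr_midpoint_le:
  fixes a b s :: real
  assumes r: "r \<ge> 1" and ab: "a \<ge> 0" "b \<ge> 0" and s: "0 \<le> s" "s \<le> 1"
  shows "((1 - s) * a + s * b) powr r \<le> (1 - s) * a powr r + s * b powr r"
proof -
  define m where "m = (1 - s) * a + s * b"
  have m: "m \<ge> 0" using ab s by (simp add: m_def)
  have "m powr (r - 1) * m = m powr r"
    using m by (cases "m = 0") (auto simp: powr_diff)
  moreover have "m powr (r - 1) * m = (1 - s) * (m powr (r - 1) * a) + s * (m powr (r - 1) * b)"
    by (simp add: m_def algebra_simps)
  moreover have "\<dots> \<le> (1 - s) * ((1 - 1 / r) * m powr r + (1 / r) * a powr r)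
      + s * ((1 - 1 / r) * m powr r + (1 / r) * b powr r)"
    using s by (intro add_mono mult_left_mono powr_tangent_le r m ab) auto
  moreover have "(1 - s) * ((1 - q) * M + q * A) + s * ((1 - q) * M + q * B)
      = M - q * M + q * ((1 - s) * A + s * B)" for q M A B :: real
    by (simp add: algebra_simps)
  ultimately have "m powr r \<le> m powr r - (1 / r) * m powr r + (1 / r) * ((1 - s) * a powr r + s * b powr r)"
    by metis
  then have "(1 / r) * m powr r \<le> (1 / r) * ((1 - s) * a powr r + s * b powr r)"
    by linarith
  then show ?thesis using r by (simp add: m_def mult_le_cancel_left_pos divide_le_cancel)
qed

lemma scaled_mem_mono:
  fixes K :: "'a::real_vector set"
  assumes K: "convex K" "0 \<in> K" and ab: "0 \<le> a" "a \<le> b" and k: "k \<in> K"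
  shows "\<exists>k'\<in>K. a *\<^sub>R k = b *\<^sub>R k'"
proof (cases "b = 0")
  case True
  then show ?thesis using ab k by auto
next
  case False
  have "(1 - a / b) *\<^sub>R 0 + (a / b) *\<^sub>R k \<in> K"
    using ab False by (intro convexD_alt K k) auto
  then show ?thesis using False by (intro bexI[of _ "(a / b) *\<^sub>R k"]) auto
qed

lemma scaled_mem_combine:
  fixes K :: "'a::real_vector set"
  assumes K: "convex K" and ab: "0 \<le> a" "0 \<le> b" and k: "k \<in> K" "k' \<in> K"
  shows "\<exists>k''\<in>K. a *\<^sub>R k + b *\<^sub>R k' = (a + b) *\<^sub>R k''"
proof (cases "a + b = 0")
  case True
  then show ?thesis using ab k by (auto simp: add_nonneg_eq_0_iff)
next
  case False
  have "(a / (a + b)) *\<^sub>R k + (b / (a + b)) *\<^sub>R k' \<in> K"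
    using ab False by (intro convexD K k) (auto simp: add_divide_distrib[symmetric])
  then show ?thesis
    using False by (intro bexI[of _ "(a / (a + b)) *\<^sub>R k + (b / (a + b)) *\<^sub>R k'"]) (auto simp: scaleR_add_right)
qed

text \<open>Replacing the equation \<open>a\<^sup>r + b\<^sup>r = 1\<close> of the definition by an inequality uses that \<open>T\<close> is star-shaped about the
origin; it makes convexity of the p-product a consequence of convexity of \<open>x powr r\<close>.\<close>

lemma p_product_mem_iff:
  fixes K :: "'a::euclidean_space set" and T :: "'b::euclidean_space set"
  assumes K: "convex K" "0 \<in> K" and T: "convex T" "0 \<in> T" and r: "r \<ge> 1"
  shows "z \<in> p_product (ereal r) K T \<longleftrightarrow>
    (\<exists>a b k l. 0 \<le> a \<and> 0 \<le> b \<and> a powr r + b powr r \<le> 1 \<and> k \<in> K \<and> l \<in> T \<and> z = (a *\<^sub>R k, b *\<^sub>R l))"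
proof
  assume "z \<in> p_product (ereal r) K T"
  then obtain t k l where t: "t \<in> {0..1}" "k \<in> K" "l \<in> T"
    "z = ((1 - t) powr (1 / r) *\<^sub>R k, t powr (1 / r) *\<^sub>R l)"
    by (auto simp: p_product_def)
  moreover have "((1 - t) powr (1 / r)) powr r + (t powr (1 / r)) powr r \<le> 1"
    using t r by (simp add: powr_powr)
  ultimately show "\<exists>a b k l. 0 \<le> a \<and> 0 \<le> b \<and> a powr r + b powr r \<le> 1 \<and> k \<in> K \<and> l \<in> T \<and> z = (a *\<^sub>R k, b *\<^sub>R l)"
    by (metis powr_ge_zero)
next
  assume "\<exists>a b k l. 0 \<le> a \<and> 0 \<le> b \<and> a powr r + b powr r \<le> 1 \<and> k \<in> K \<and> l \<in> T \<and> z = (a *\<^sub>R k, b *\<^sub>R l)"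
  then obtain a b k l where ab: "0 \<le> a" "0 \<le> b" "a powr r + b powr r \<le> 1" and kl: "k \<in> K" "l \<in> T"
    and z: "z = (a *\<^sub>R k, b *\<^sub>R l)" by blast
  define t where "t = 1 - a powr r"
  have br: "b powr r \<le> t" using ab by (simp add: t_def)
  then have "0 \<le> t" using powr_ge_zero[of b r] by linarith
  moreover have "t \<le> 1" by (simp add: t_def)
  ultimately have t: "t \<in> {0..1}" by simp
  have "(1 - t) powr (1 / r) = a" using ab r by (simp add: t_def powr_powr)
  moreover have "b \<le> t powr (1 / r)"
  proof -
    have "b = (b powr r) powr (1 / r)" using ab r by (simp add: powr_powr)
    also have "\<dots> \<le> t powr (1 / r)" using br r by (intro powr_mono2) auto
    finally show ?thesis .
  qed
  then obtain l' where "l' \<in> T" "b *\<^sub>R l = t powr (1 / r) *\<^sub>R l'"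
    using scaled_mem_mono[OF T ab(2) _ kl(2)] by blast
  ultimately show "z \<in> p_product (ereal r) K T"
    using t kl(1) by (auto simp: p_product_def z)
qed

lemma p_product_subset_Times:
  assumes K: "convex K" "0 \<in> K" and T: "convex T" "0 \<in> T" and p: "1 \<le> p"
  shows "p_product p K T \<subseteq> K \<times> T"
proof -
  have "c *\<^sub>R k \<in> S" if "convex S" "0 \<in> S" "k \<in> S" "0 \<le> c" "c \<le> 1" for c :: real and k and S :: "'x::real_vector set"
    using convexD_alt[OF that(1,2,3,4,5)] by simp
  note scale = this
  show ?thesis
  proof (cases "p = \<infinity>")
    case False
    have "(1 - t) powr (1 / real_of_ereal p) \<le> 1" "t powr (1 / real_of_ereal p) \<le> 1" if "t \<in> {0..1}" for t
      using that p False by (cases p; simp add: powr_le1)+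
    then show ?thesis
      using False K T by (auto simp: p_product_def intro!: scale)
  qed (simp add: p_product_def)
qed

lemma convex_body_p_product:
  assumes K: "convex_body K" "0 \<in> K" and T: "convex_body T" "0 \<in> T" and p: "1 \<le> p"
  shows "convex_body (p_product p K T)"
proof (cases "p = \<infinity>")
  case True
  then show ?thesis
    using K T by (simp add: p_product_def convex_body_def compact_Times convex_Times interior_Times)
next
  case False
  then obtain r where r: "p = ereal r" "r \<ge> 1" using p by (cases p) auto
  have cK: "convex K" "compact K" and cT: "convex T" "compact T"
    using K T by (auto simp: convex_body_def)
  note mem = p_product_mem_iff[OF cK(1) K(2) cT(1) T(2) r(2)]
  show ?thesis
    unfolding convex_body_def
  proof (intro conjI)
    define f where "f = (\<lambda>(t, k :: 'a, l :: 'b). ((1 - t) powr (1 / r) *\<^sub>R k, t powr (1 / r) *\<^sub>R l))"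
    have "p_product p K T = f ` ({0..1} \<times> K \<times> T)"
      unfolding p_product_def f_def using r by (force simp: image_iff)
    moreover have "continuous_on ({0..1} \<times> K \<times> T) f"
      unfolding f_def split_beta using r(2)
      by (intro continuous_intros continuous_on_powr') auto
    ultimately show "compact (p_product p K T)"
      using cK cT by (simp add: compact_continuous_image compact_Times)
    show "convex (p_product p K T)"
      unfolding convex_alt r(1)
    proof safe
      fix x1 y1 x2 y2 and s :: real
      assume 1: "(x1, y1) \<in> p_product (ereal r) K T" and 2: "(x2, y2) \<in> p_product (ereal r) K T" and s: "0 \<le> s" "s \<le> 1"
      obtain a b k l where abkl: "0 \<le> a" "0 \<le> b" "a powr r + b powr r \<le> 1" "k \<in> K" "l \<in> T" "(x1, y1) = (a *\<^sub>R k, b *\<^sub>R l)"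
        using 1 unfolding mem by blast
      obtain a' b' k' l' where abkl': "0 \<le> a'" "0 \<le> b'" "a' powr r + b' powr r \<le> 1" "k' \<in> K" "l' \<in> T" "(x2, y2) = (a' *\<^sub>R k', b' *\<^sub>R l')"
        using 2 unfolding mem by blast
      obtain k'' where k'': "k'' \<in> K" "((1 - s) * a) *\<^sub>R k + (s * a') *\<^sub>R k' = ((1 - s) * a + s * a') *\<^sub>R k''"
        using scaled_mem_combine[OF cK(1), of "(1 - s) * a" "s * a'" k k'] abkl abkl' s by auto
      obtain l'' where l'': "l'' \<in> T" "((1 - s) * b) *\<^sub>R l + (s * b') *\<^sub>R l' = ((1 - s) * b + s * b') *\<^sub>R l''"
        using scaled_mem_combine[OF cT(1), of "(1 - s) * b" "s * b'" l l'] abkl abkl' s by auto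
      have "((1 - s) * a + s * a') powr r + ((1 - s) * b + s * b') powr r
          \<le> ((1 - s) * a powr r + s * a' powr r) + ((1 - s) * b powr r + s * b' powr r)"
        by (intro add_mono powr_midpoint_le r abkl abkl' s)
      also have "\<dots> = (1 - s) * (a powr r + b powr r) + s * (a' powr r + b' powr r)"
        by (simp add: algebra_simps)
      also have "\<dots> \<le> (1 - s) * 1 + s * 1"
        using abkl abkl' s by (intro add_mono mult_left_mono) auto
      finally have "((1 - s) * a + s * a') powr r + ((1 - s) * b + s * b') powr r \<le> 1" by simp
      then show "(1 - s) *\<^sub>R (x1, y1) + s *\<^sub>R (x2, y2) \<in> p_product (ereal r) K T"
        unfolding mem using abkl abkl' s k'' l''
        by (intro exI[of _ "(1 - s) * a + s * a'"] exI[of _ "(1 - s) * b + s * b'"] exI[of _ k''] exI[of _ l'']) auto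
    qed
    have "(1/2 :: real) powr r \<le> (1/2) powr 1" using r(2) by (intro powr_mono') auto
    then have "((*\<^sub>R) (1/2) ` K) \<times> ((*\<^sub>R) (1/2) ` T) \<subseteq> p_product p K T"
      unfolding r(1) using mem by (force intro!: exI[of _ "1/2 :: real"])
    then have "interior (((*\<^sub>R) (1/2) ` K) \<times> ((*\<^sub>R) (1/2) ` T)) \<subseteq> interior (p_product p K T)"
      by (rule interior_mono)
    moreover have "interior ((*\<^sub>R) (1/2) ` K) \<noteq> {}" "interior ((*\<^sub>R) (1/2) ` T) \<noteq> {}"
      using K T interior_injective_linear_image[of "(*\<^sub>R) (1/2)" K] interior_injective_linear_image[of "(*\<^sub>R) (1/2)" T]
      by (auto simp: convex_body_def linear_scale_self inj_on_def)
    ultimately show "interior (p_product p K T) \<noteq> {}"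
      by (auto simp: interior_Times)
  qed
qed

section \<open>The capacity of a p-product from below\<close>

context compatible_complex_structure
begin

lemma support_fun_velocity_integrable:
  assumes K: "compact K" "K \<noteq> {}" and ac: "ac_curve \<gamma>"
  shows "(\<lambda>t. support_fun K (- J (velocity \<gamma> t))) integrable_on {0..1}"
proof -
  obtain R where "\<forall>x\<in>K. norm x \<le> R" using compact_imp_bounded[OF K(1)] unfolding bounded_iff by blast
  then have R: "K \<subseteq> cball 0 R" by auto
  have ai: "velocity \<gamma> absolutely_integrable_on {0..1}"
    by (rule ac_curve_velocity_absolutely_integrable[OF ac])
  have R0: "R \<ge> 0"
  proof -
    obtain k where "k \<in> K" using K(2) by blast
    then have "norm k \<le> R" using R by auto
    then show ?thesis using norm_ge_zero[of k] by linarith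
  qed
  have "R-lipschitz_on UNIV (\<lambda>v. support_fun K (- J v))"
  proof (rule lipschitz_onI)
    fix v w
    show "dist (support_fun K (- J v)) (support_fun K (- J w)) \<le> R * dist v w"
      using support_fun_lipschitz[OF K(2) R, of "- J v" "- J w"]
      by (simp add: dist_real_def dist_norm norm_minus_commute flip: J_diff)
  qed (rule R0)
  then have "continuous_on UNIV (\<lambda>v. support_fun K (- J v))"
    by (rule lipschitz_on_continuous_on)
  then have "(\<lambda>v. support_fun K (- J v)) \<in> borel_measurable borel"
    by (rule borel_measurable_continuous_onI)
  then have meas: "(\<lambda>t. support_fun K (- J (velocity \<gamma> t))) \<in> borel_measurable (lebesgue_on {0..1})"
    by (intro measurable_compose[OF absolutely_integrable_imp_borel_measurable[OF ai]]) auto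
  have "support_fun K 0 = 0"
    using K(2) by (simp add: support_fun_def)
  then have "norm (support_fun K (- J v)) \<le> R * norm v" for v
    using support_fun_lipschitz[OF K(2) R, of "- J v" 0] by simp
  then have "(\<lambda>t. support_fun K (- J (velocity \<gamma> t))) absolutely_integrable_on {0..1}"
    by (intro measurable_bounded_by_integrable_imp_absolutely_integrable[OF meas, where g = "\<lambda>t. R * norm (velocity \<gamma> t)"]
        integrable_on_mult_right norm_velocity_integrable[OF ac]) auto
  then show ?thesis using set_lebesgue_integral_eq_integral(1) by blast
qed

end

text \<open>The two factors may have different dimensions, hence different types.\<close>

locale complex_structure_pair = A: compatible_complex_structure J1 + B: compatible_complex_structure J2
  for J1 :: "'a::euclidean_space \<Rightarrow> 'a" and J2 :: "'b::euclidean_space \<Rightarrow> 'b"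
begin

sublocale P: compatible_complex_structure "map_prod J1 J2"
  by (rule complex_structure_map_prod) unfold_locales

lemma action_Pair:
  assumes x: "ac_curve x" and y: "ac_curve y"
  shows "action (map_prod J1 J2) (\<lambda>t. (x t, y t)) = action J1 x + action J2 y"
proof -
  obtain N where N: "negligible N"
    "\<forall>t\<in>{0..1} - N. (x has_vector_derivative velocity x t) (at t) \<and>
      (y has_vector_derivative velocity y t) (at t) \<and>
      velocity (\<lambda>t. (x t, y t)) t = (velocity x t, velocity y t)"
    by (rule negligible_velocity_Pair[OF x y])
  have "((\<lambda>t. J1 (x t) \<bullet> velocity x t + J2 (y t) \<bullet> velocity y t) has_integral
      A.bilinear_action x x + B.bilinear_action y y) {0..1}"
    unfolding A.bilinear_action_def B.bilinear_action_def
    by (intro has_integral_add integrable_integral A.bilinear_action_integrable B.bilinear_action_integrable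
        ac_curve_continuous_on x y) auto
  then have "((\<lambda>t. map_prod J1 J2 (x t, y t) \<bullet> velocity (\<lambda>t. (x t, y t)) t) has_integral
      A.bilinear_action x x + B.bilinear_action y y) {0..1}"
    by (rule has_integral_spike[OF N(1), rotated]) (simp add: N(2) inner_prod_def)
  then show ?thesis
    unfolding A.action_eq B.action_eq P.action_eq P.bilinear_action_def
    by (simp add: integral_unique add_divide_distrib)
qed

text \<open>At almost every time the normal vector \<open>v\<close> satisfies \<open>\<langle>v, (a k, b l)\<rangle> \<le> \<langle>v, \<gamma>\<rangle>\<close> whenever the point on the left is in \<open>P\<close>.
Choosing \<open>k\<close> and \<open>l\<close> as maximisers for the components of \<open>v\<close> and integrating gives the last claim, where \<open>l1\<close> and
\<open>l2\<close> are the integrals of the support functions of \<open>K\<close> and \<open>T\<close>.\<close>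

lemma characteristic_splitting:
  assumes K: "convex_body K" "0 \<in> K" and T: "convex_body T" "0 \<in> T"
    and \<gamma>: "generalized_closed_characteristic (map_prod J1 J2) P \<gamma>"
  obtains l1 l2 A1 A2 where "action (map_prod J1 J2) \<gamma> = A1 + A2" "0 \<le> l1" "0 \<le> l2"
    "c_EHZ J1 K * A1 \<le> (l1 / 2)\<^sup>2" "c_EHZ J2 T * A2 \<le> (l2 / 2)\<^sup>2"
    "\<forall>a\<ge>0. \<forall>b\<ge>0. (\<forall>k\<in>K. \<forall>l\<in>T. (a *\<^sub>R k, b *\<^sub>R l) \<in> P) \<longrightarrow>
       a * l1 + b * l2 \<le> 2 * action (map_prod J1 J2) \<gamma>"
proof -
  have cK: "compact K" and cT: "compact T" using K T by (auto simp: convex_body_def)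
  have neK: "K \<noteq> {}" and neT: "T \<noteq> {}" using K T by auto
  note bK = compact_imp_bounded[OF cK] and bT = compact_imp_bounded[OF cT]
  note ac = P.generalized_closed_characteristic_ac_curve(1)[OF \<gamma>]
    and closed = P.generalized_closed_characteristic_ac_curve(2)[OF \<gamma>]
  define x where "x t = fst (\<gamma> t)" for t
  define y where "y t = snd (\<gamma> t)" for t
  have acx: "ac_curve x" and acy: "ac_curve y"
    using ac_curve_fst_snd[OF ac] unfolding x_def y_def by auto
  have \<gamma>_eq: "\<gamma> = (\<lambda>t. (x t, y t))" by (simp add: x_def y_def)
  define \<beta>1 where "\<beta>1 t = support_fun K (- J1 (velocity x t))" for t
  define \<beta>2 where "\<beta>2 t = support_fun T (- J2 (velocity y t))" for t
  have int1: "\<beta>1 integrable_on {0..1}" and int2: "\<beta>2 integrable_on {0..1}"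
    unfolding \<beta>1_def \<beta>2_def
    by (intro A.support_fun_velocity_integrable B.support_fun_velocity_integrable cK cT neK neT acx acy)+
  have le1: "velocity x t \<bullet> J1 k \<le> \<beta>1 t" if "k \<in> K" for t k
    using inner_le_support_fun[OF bK that, of "- J1 (velocity x t)"]
    unfolding \<beta>1_def A.inner_J_right_eq .
  have le2: "velocity y t \<bullet> J2 l \<le> \<beta>2 t" if "l \<in> T" for t l
    using inner_le_support_fun[OF bT that, of "- J2 (velocity y t)"]
    unfolding \<beta>2_def B.inner_J_right_eq .
  have nonneg: "0 \<le> \<beta>1 t" "0 \<le> \<beta>2 t" for t
    using le1[OF K(2)] le2[OF T(2)] by simp_all
  define l1 where "l1 = integral {0..1} \<beta>1"
  define l2 where "l2 = integral {0..1} \<beta>2"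
  obtain N1 where N1: "negligible N1"
    "\<And>t. t \<in> {0..1} - N1 \<Longrightarrow> \<exists>v \<in> normal_cone P (\<gamma> t). (\<gamma> has_vector_derivative map_prod J1 J2 v) (at t)"
    using P.generalized_closed_characteristic_obtain[OF \<gamma>] by blast
  obtain N2 where N2: "negligible N2"
    "\<forall>t\<in>{0..1} - N2. (x has_vector_derivative velocity x t) (at t) \<and>
      (y has_vector_derivative velocity y t) (at t) \<and>
      velocity (\<lambda>t. (x t, y t)) t = (velocity x t, velocity y t)"
    by (rule negligible_velocity_Pair[OF acx acy])
  show ?thesis
  proof (rule that[of "action J1 x" "action J2 y" l1 l2])
    show "action (map_prod J1 J2) \<gamma> = action J1 x + action J2 y"
      unfolding \<gamma>_eq by (rule action_Pair[OF acx acy])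
    show "0 \<le> l1" "0 \<le> l2"
      unfolding l1_def l2_def using int1 int2 nonneg by (auto intro: integral_nonneg)
    show "c_EHZ J1 K * action J1 x \<le> (l1 / 2)\<^sup>2"
      unfolding l1_def
      by (rule A.isoperimetric_inequality[OF K(1) acx _ int1 negligible_empty le1]) (simp_all add: x_def closed)
    show "c_EHZ J2 T * action J2 y \<le> (l2 / 2)\<^sup>2"
      unfolding l2_def
      by (rule B.isoperimetric_inequality[OF T(1) acy _ int2 negligible_empty le2]) (simp_all add: y_def closed)
    show "\<forall>a\<ge>0. \<forall>b\<ge>0. (\<forall>k\<in>K. \<forall>l\<in>T. (a *\<^sub>R k, b *\<^sub>R l) \<in> P) \<longrightarrow>
       a * l1 + b * l2 \<le> 2 * action (map_prod J1 J2) \<gamma>"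
    proof (intro allI impI)
      fix a b :: real assume ab: "0 \<le> a" "0 \<le> b" and mem: "\<forall>k\<in>K. \<forall>l\<in>T. (a *\<^sub>R k, b *\<^sub>R l) \<in> P"
      have "integral {0..1} (\<lambda>t. a * \<beta>1 t + b * \<beta>2 t) \<le> integral {0..1} (\<lambda>t. map_prod J1 J2 (\<gamma> t) \<bullet> velocity \<gamma> t)"
      proof (rule integral_le_AE[OF _ _ negligible_Un[OF N1(1) N2(1)]])
        show "(\<lambda>t. a * \<beta>1 t + b * \<beta>2 t) integrable_on {0..1}"
          by (intro integrable_add integrable_on_mult_right int1 int2)
        show "(\<lambda>t. map_prod J1 J2 (\<gamma> t) \<bullet> velocity \<gamma> t) integrable_on {0..1}"
          by (rule P.bilinear_action_integrable[OF ac_curve_continuous_on[OF ac] ac]) auto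
        fix t assume t: "t \<in> {0..1} - (N1 \<union> N2)"
        obtain v where v: "v \<in> normal_cone P (\<gamma> t)" "(\<gamma> has_vector_derivative map_prod J1 J2 v) (at t)"
          using N1(2) t by blast
        have vel: "velocity \<gamma> t = map_prod J1 J2 v" by (rule vector_derivative_at[OF v(2)])
        have "velocity \<gamma> t = (velocity x t, velocity y t)"
          using bspec[OF N2(2), of t] t unfolding \<gamma>_eq by simp
        then have vx: "velocity x t = J1 (fst v)" and vy: "velocity y t = J2 (snd v)"
          using vel by (auto simp: map_prod_def split_beta)
        obtain k where k: "k \<in> K" "support_fun K (fst v) = k \<bullet> fst v" using support_fun_attained[OF cK neK] by blast
        obtain l where l: "l \<in> T" "support_fun T (snd v) = l \<bullet> snd v" using support_fun_attained[OF cT neT] by blast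
        have "v \<bullet> ((a *\<^sub>R k, b *\<^sub>R l) - \<gamma> t) \<le> 0"
          using v(1) mem k(1) l(1) by (simp add: normal_cone_def)
        then have "a * (k \<bullet> fst v) + b * (l \<bullet> snd v) \<le> v \<bullet> \<gamma> t"
          by (simp add: inner_diff_right inner_prod_def[of v "(a *\<^sub>R k, b *\<^sub>R l)"] inner_commute)
        moreover have "map_prod J1 J2 (\<gamma> t) \<bullet> velocity \<gamma> t = v \<bullet> \<gamma> t"
          unfolding vel by (subst P.J_inner_J) (rule inner_commute)
        ultimately show "a * \<beta>1 t + b * \<beta>2 t \<le> map_prod J1 J2 (\<gamma> t) \<bullet> velocity \<gamma> t"
          by (simp add: \<beta>1_def \<beta>2_def vx vy k(2) l(2))
      qed
      also have "\<dots> = 2 * action (map_prod J1 J2) \<gamma>"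
        by (simp add: P.action_eq P.bilinear_action_def)
      also have "integral {0..1} (\<lambda>t. a * \<beta>1 t + b * \<beta>2 t) = a * l1 + b * l2"
        unfolding l1_def l2_def using int1 int2
        by (subst Henstock_Kurzweil_Integration.integral_add) (auto intro: integrable_on_mult_right)
      finally show "a * l1 + b * l2 \<le> 2 * action (map_prod J1 J2) \<gamma>" .
    qed
  qed
qed

text \<open>The weights satisfy \<open>1 / c(K) \<le> w1 / \<Lambda>\<close> and \<open>1 / c(T) \<le> w2 / \<Lambda>\<close>. With \<open>Q = w1 l1\<^sup>2 + w2 l2\<^sup>2\<close>, the isoperimetric
inequalities in the factors give \<open>4 \<Lambda> A \<le> Q\<close>, and the point of \<open>P\<close> in the direction \<open>(w1 l1, w2 l2)\<close> gives \<open>sqrt Q \<le> 2 A\<close>.\<close>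

lemma c_EHZ_lower_bound:
  assumes K: "convex_body K" "0 \<in> K" and T: "convex_body T" "0 \<in> T" and P: "convex_body P"
    and \<Lambda>: "\<Lambda> > 0" and w: "0 \<le> w1" "0 \<le> w2" "\<Lambda> \<le> w1 * c_EHZ J1 K" "\<Lambda> \<le> w2 * c_EHZ J2 T"
    and mem: "\<And>l1 l2 k l. 0 \<le> l1 \<Longrightarrow> 0 \<le> l2 \<Longrightarrow> w1 * l1\<^sup>2 + w2 * l2\<^sup>2 = 1 \<Longrightarrow> k \<in> K \<Longrightarrow> l \<in> T \<Longrightarrow>
      ((w1 * l1) *\<^sub>R k, (w2 * l2) *\<^sub>R l) \<in> P"
  shows "\<Lambda> \<le> c_EHZ (map_prod J1 J2) P"
proof -
  have cK: "c_EHZ J1 K > 0" and cT: "c_EHZ J2 T > 0" and cP: "c_EHZ (map_prod J1 J2) P > 0"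
    by (rule A.c_EHZ_pos B.c_EHZ_pos P.c_EHZ_pos; fact)+
  obtain p0 where "p0 \<in> interior P" using P by (auto simp: convex_body_def)
  then obtain \<gamma> where \<gamma>: "generalized_closed_characteristic (map_prod J1 J2) P \<gamma>"
    "action (map_prod J1 J2) \<gamma> = c_EHZ (map_prod J1 J2) P"
    using P.minimal_characteristic[OF P] by blast
  define A where "A = action (map_prod J1 J2) \<gamma>"
  have A: "A > 0" using \<gamma>(2) cP by (simp add: A_def)
  obtain l1 l2 A1 A2 where sp: "A = A1 + A2" "0 \<le> l1" "0 \<le> l2"
    "c_EHZ J1 K * A1 \<le> (l1 / 2)\<^sup>2" "c_EHZ J2 T * A2 \<le> (l2 / 2)\<^sup>2"
    and dual: "\<forall>a\<ge>0. \<forall>b\<ge>0. (\<forall>k\<in>K. \<forall>l\<in>T. (a *\<^sub>R k, b *\<^sub>R l) \<in> P) \<longrightarrow> a * l1 + b * l2 \<le> 2 * A"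
    unfolding A_def by (rule characteristic_splitting[OF K T \<gamma>(1)])
  define Q where "Q = w1 * l1\<^sup>2 + w2 * l2\<^sup>2"
  \<comment> \<open>The action of one component may be negative, in which case the claim is trivial.\<close>
  have one: "4 * \<Lambda> * B \<le> v * s\<^sup>2" if "\<Lambda> \<le> v * c" "c * B \<le> (s / 2)\<^sup>2" "0 \<le> v" "c > 0" for v c B s
  proof (cases "B \<ge> 0")
    case True
    have "\<Lambda> * B \<le> v * (c * B)" using mult_right_mono[OF that(1) True] by (simp add: mult.assoc)
    also have "\<dots> \<le> v * (s / 2)\<^sup>2" by (rule mult_left_mono[OF that(2,3)])
    finally show ?thesis by (simp add: power_divide)
  next
    case False
    then have "4 * \<Lambda> * B \<le> 0" using \<Lambda> by (simp add: mult_nonneg_nonpos)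
    also have "0 \<le> v * s\<^sup>2" using that by simp
    finally show ?thesis .
  qed
  have AQ: "4 * \<Lambda> * A \<le> Q"
    using one[OF w(3) sp(4) w(1) cK] one[OF w(4) sp(5) w(2) cT] by (simp add: sp(1) Q_def distrib_left)
  have Q: "Q > 0" using A \<Lambda> AQ mult_pos_pos[of "4 * \<Lambda>" A] by linarith
  define q where "q = sqrt Q"
  have q: "q > 0" "q\<^sup>2 = Q" using Q by (auto simp: q_def)
  have "(w1 * (l1 / q)) * l1 + (w2 * (l2 / q)) * l2 \<le> 2 * A"
  proof (rule dual[rule_format])
    fix k l assume kl: "k \<in> K" "l \<in> T"
    have "w1 * (l1 / q)\<^sup>2 + w2 * (l2 / q)\<^sup>2 = Q / q\<^sup>2"
      by (simp add: Q_def power_divide add_divide_distrib)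
    then show "((w1 * (l1 / q)) *\<^sub>R k, (w2 * (l2 / q)) *\<^sub>R l) \<in> P"
      using q Q sp by (intro mem kl) auto
  qed (use w sp q in auto)
  also have "(w1 * (l1 / q)) * l1 + (w2 * (l2 / q)) * l2 = Q / q"
    by (simp add: Q_def power2_eq_square add_divide_distrib)
  also have "Q / q = q" using q by (simp add: power2_eq_square flip: q(2))
  finally have "q\<^sup>2 \<le> (2 * A)\<^sup>2" using q by (intro power_mono) auto
  then have "4 * \<Lambda> * A \<le> 4 * A * A" using AQ q by (simp add: power2_eq_square)
  then show ?thesis using A \<gamma>(2) by (simp add: A_def)
qed

end

section \<open>The capacity of a p-product from above\<close>

context compatible_complex_structure
begin

text \<open>If the origin is on the boundary of \<open>K\<close>, no parametrisation makes \<open>\<langle>v, X\<rangle>\<close> constant in general: it is zero while \<open>X\<close>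
runs through a flat piece containing the origin. So the speed is measured from the interior
point \<open>e k0\<close> close to the origin. The curve depends on \<open>e\<close>, but its length is bounded
independently of \<open>e\<close>, because the integral of \<open>\<langle>v, X - k0\<rangle>\<close> is the same for every \<open>k0\<close>.\<close>

lemma nearly_centred_minimiser:
  assumes K: "convex_body K" "0 \<in> K" and r: "r > 0" "cball k0 r \<subseteq> K" and e: "0 < e" "e \<le> 1"
  obtains X N where "ac_curve X" "X 0 = X 1" "action J X = c_EHZ J K" "negligible N"
    "\<forall>t\<in>{0..1} - N. \<forall>k\<in>K. velocity X t \<bullet> J k \<le> 2 * c_EHZ J K + e * (norm k0 * norm (velocity X t))"
    "integral {0..1} (\<lambda>t. norm (velocity X t)) \<le> 2 * c_EHZ J K / r"
proof -
  define c where "c = c_EHZ J K"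
  have "convex K" using K by (simp add: convex_body_def)
  moreover have "k0 \<in> interior K" using r mem_interior_cball by blast
  ultimately have "0 - e *\<^sub>R (0 - k0) \<in> interior K"
    by (intro mem_interior_convex_shrink K(2) e)
  then have int: "e *\<^sub>R k0 \<in> interior K" by simp
  obtain X where X: "generalized_closed_characteristic J K X" "action J X = c"
    and AE: "AE t in lebesgue. t \<in> {0..1} \<longrightarrow>
        (\<exists>v \<in> normal_cone K (X t). (X has_vector_derivative J v) (at t) \<and> v \<bullet> (X t - e *\<^sub>R k0) = 2 * c)"
    unfolding c_def by (rule minimal_characteristic[OF K(1) int])
  obtain N where N: "negligible N" "{t. \<not> (t \<in> {0..1} \<longrightarrow>
        (\<exists>v \<in> normal_cone K (X t). (X has_vector_derivative J v) (at t) \<and> v \<bullet> (X t - e *\<^sub>R k0) = 2 * c))} \<subseteq> N"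
    using AE unfolding eventually_ae_filter_negligible by blast
  note ac = generalized_closed_characteristic_ac_curve(1)[OF X(1)]
    and closed = generalized_closed_characteristic_ac_curve(2)[OF X(1)]
  have v_ex: "\<exists>v. (\<forall>k\<in>K. v \<bullet> k \<le> v \<bullet> X t) \<and> velocity X t = J v \<and> v \<bullet> X t = 2 * c + e * (v \<bullet> k0)"
    if t: "t \<in> {0..1} - N" for t
  proof -
    obtain v where v: "v \<in> normal_cone K (X t)" "(X has_vector_derivative J v) (at t)" "v \<bullet> (X t - e *\<^sub>R k0) = 2 * c"
      using N(2) t by blast
    have "\<forall>k\<in>K. v \<bullet> k \<le> v \<bullet> X t" using v(1) by (simp add: normal_cone_def inner_diff_right)
    moreover have "v \<bullet> X t = 2 * c + e * (v \<bullet> k0)" using v(3) by (simp add: inner_diff_right)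
    ultimately show ?thesis using vector_derivative_at[OF v(2)] by blast
  qed
  show ?thesis
  proof (rule that[OF ac closed X(2)[unfolded c_def] N(1)])
    show "\<forall>t\<in>{0..1} - N. \<forall>k\<in>K. velocity X t \<bullet> J k \<le> 2 * c_EHZ J K + e * (norm k0 * norm (velocity X t))"
    proof (intro ballI)
      fix t k assume t: "t \<in> {0..1} - N" and k: "k \<in> K"
      obtain v where v: "\<forall>k\<in>K. v \<bullet> k \<le> v \<bullet> X t" "velocity X t = J v" "v \<bullet> X t = 2 * c + e * (v \<bullet> k0)"
        using v_ex[OF t] by blast
      have "velocity X t \<bullet> J k \<le> 2 * c + e * (v \<bullet> k0)"
        using v k by simp
      also have "\<dots> \<le> 2 * c + e * (norm k0 * norm v)"
        using norm_cauchy_schwarz[of v k0] e by (simp add: mult.commute)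
      finally show "velocity X t \<bullet> J k \<le> 2 * c_EHZ J K + e * (norm k0 * norm (velocity X t))"
        by (simp add: v(2) c_def)
    qed
    have "integral {0..1} (\<lambda>t. r * norm (velocity X t)) \<le> integral {0..1} (\<lambda>t. J (X t) \<bullet> velocity X t - J k0 \<bullet> velocity X t)"
    proof (rule integral_le_AE[OF _ _ N(1)])
      show "(\<lambda>t. r * norm (velocity X t)) integrable_on {0..1}"
        by (intro integrable_on_mult_right norm_velocity_integrable ac) auto
      show "(\<lambda>t. J (X t) \<bullet> velocity X t - J k0 \<bullet> velocity X t) integrable_on {0..1}"
        by (intro integrable_diff bilinear_action_integrable continuous_on_const ac_curve_continuous_on ac) auto
      fix t assume t: "t \<in> {0..1} - N"
      obtain v where v: "\<forall>k\<in>K. v \<bullet> k \<le> v \<bullet> X t" "velocity X t = J v"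
        using v_ex[OF t] by blast
      \<comment> \<open>The farthest point of the ball about \<open>k0\<close> in the direction of \<open>v\<close>.\<close>
      have "k0 + (r / norm v) *\<^sub>R v \<in> K"
        using r by (cases "v = 0") (auto simp: subset_eq dist_norm)
      then have "v \<bullet> (k0 + (r / norm v) *\<^sub>R v) \<le> v \<bullet> X t" using v(1) by blast
      then have "r * norm v \<le> v \<bullet> X t - v \<bullet> k0"
        by (cases "v = 0") (auto simp: inner_add_right dot_square_norm power2_eq_square)
      then show "r * norm (velocity X t) \<le> J (X t) \<bullet> velocity X t - J k0 \<bullet> velocity X t"
        by (simp add: v(2) inner_commute)
    qed
    also have "\<dots> = bilinear_action X X - J k0 \<bullet> (X 1 - X 0)"
    proof -
      have "((\<lambda>t. J (X t) \<bullet> velocity X t - J k0 \<bullet> velocity X t) has_integral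
          bilinear_action X X - J k0 \<bullet> (X 1 - X 0)) {0..1}"
        unfolding bilinear_action_def
        by (intro has_integral_diff integrable_integral bilinear_action_integrable inner_velocity_has_integral_const
            ac_curve_continuous_on ac) auto
      then show ?thesis by (rule integral_unique)
    qed
    also have "\<dots> = 2 * c" using X(2) closed by (simp add: action_eq)
    finally show "integral {0..1} (\<lambda>t. norm (velocity X t)) \<le> 2 * c_EHZ J K / r"
      using r by (simp add: field_simps c_def)
  qed
qed

end

context complex_structure_pair
begin

text \<open>The isoperimetric inequality for \<open>P\<close> is applied to \<open>(a X, b Y)\<close>, which has action \<open>\<Lambda>\<close>. The support function of \<open>P\<close>
along this curve is at most \<open>2 \<Lambda>\<close> plus an error of order \<open>e\<close> from the shifted centres; hence \<open>c(P) \<Lambda> \<le> (\<Lambda> + O(e))\<^sup>2\<close>.\<close>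

lemma c_EHZ_upper_bound:
  assumes K: "convex_body K" "0 \<in> K" and T: "convex_body T" "0 \<in> T" and P: "convex_body P"
    and ab: "0 \<le> a" "a \<le> 1" "0 \<le> b" "b \<le> 1"
    and \<Lambda>: "\<Lambda> > 0" "a\<^sup>2 * c_EHZ J1 K + b\<^sup>2 * c_EHZ J2 T = \<Lambda>"
    and mem: "\<And>z. z \<in> P \<Longrightarrow> \<exists>a'\<in>{0..1}. \<exists>b'\<in>{0..1}. \<exists>k\<in>K. \<exists>l\<in>T. z = (a' *\<^sub>R k, b' *\<^sub>R l) \<and>
        a * a' * c_EHZ J1 K + b * b' * c_EHZ J2 T \<le> \<Lambda>"
  shows "c_EHZ (map_prod J1 J2) P \<le> \<Lambda>"
proof -
  define c1 where "c1 = c_EHZ J1 K"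
  define c2 where "c2 = c_EHZ J2 T"
  define cP where "cP = c_EHZ (map_prod J1 J2) P"
  have c1: "c1 > 0" and c2: "c2 > 0" and cP: "cP > 0"
    unfolding c1_def c2_def cP_def by (rule A.c_EHZ_pos B.c_EHZ_pos P.c_EHZ_pos; fact)+
  obtain k0 r1 where r1: "r1 > 0" "cball k0 r1 \<subseteq> K"
    using K(1) unfolding convex_body_def by (metis ex_in_conv mem_interior_cball)
  obtain l0 r2 where r2: "r2 > 0" "cball l0 r2 \<subseteq> T"
    using T(1) unfolding convex_body_def by (metis ex_in_conv mem_interior_cball)
  define C where "C = norm k0 * (2 * c1 / r1) + norm l0 * (2 * c2 / r2)"
  have est: "cP * \<Lambda> \<le> (\<Lambda> + e * C / 2)\<^sup>2" if e: "0 < e" "e \<le> 1" for e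
  proof -
    obtain X N1 where X: "ac_curve X" "X 0 = X 1" "action J1 X = c1" "negligible N1"
      "\<forall>t\<in>{0..1} - N1. \<forall>k\<in>K. velocity X t \<bullet> J1 k \<le> 2 * c1 + e * (norm k0 * norm (velocity X t))"
      "integral {0..1} (\<lambda>t. norm (velocity X t)) \<le> 2 * c1 / r1"
      unfolding c1_def by (rule A.nearly_centred_minimiser[OF K r1 e])
    obtain Y N2 where Y: "ac_curve Y" "Y 0 = Y 1" "action J2 Y = c2" "negligible N2"
      "\<forall>t\<in>{0..1} - N2. \<forall>l\<in>T. velocity Y t \<bullet> J2 l \<le> 2 * c2 + e * (norm l0 * norm (velocity Y t))"
      "integral {0..1} (\<lambda>t. norm (velocity Y t)) \<le> 2 * c2 / r2"
      unfolding c2_def by (rule B.nearly_centred_minimiser[OF T r2 e])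
    define \<gamma> where "\<gamma> t = (a *\<^sub>R X t, b *\<^sub>R Y t)" for t
    have acX: "ac_curve (\<lambda>t. a *\<^sub>R X t)" and acY: "ac_curve (\<lambda>t. b *\<^sub>R Y t)"
      by (intro ac_curve_scaleR X Y)+
    have ac: "ac_curve \<gamma>" unfolding \<gamma>_def by (rule ac_curve_Pair[OF acX acY])
    have closed: "\<gamma> 0 = \<gamma> 1" using X(2) Y(2) by (simp add: \<gamma>_def)
    have "action (map_prod J1 J2) \<gamma> = a\<^sup>2 * c1 + b\<^sup>2 * c2"
      unfolding \<gamma>_def action_Pair[OF acX acY] A.action_scaleR[OF X(1)] B.action_scaleR[OF Y(1)] X(3) Y(3) ..
    then have act: "action (map_prod J1 J2) \<gamma> = \<Lambda>" using \<Lambda>(2) by (simp add: c1_def c2_def)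
    obtain N3 where N3: "negligible N3" "\<forall>t\<in>{0..1} - N3. (X has_vector_derivative velocity X t) (at t) \<and>
        (Y has_vector_derivative velocity Y t) (at t) \<and>
        velocity (\<lambda>t. (X t, Y t)) t = (velocity X t, velocity Y t)"
      by (rule negligible_velocity_Pair[OF X(1) Y(1)])
    define \<beta> where "\<beta> t = 2 * \<Lambda> + e * (norm k0 * norm (velocity X t) + norm l0 * norm (velocity Y t))" for t
    have I: "(\<beta> has_integral 2 * \<Lambda> + e * (norm k0 * integral {0..1} (\<lambda>t. norm (velocity X t)) +
        norm l0 * integral {0..1} (\<lambda>t. norm (velocity Y t)))) {0..1}"
    proof -
      have "((\<lambda>t. 2 * \<Lambda>) has_integral measure lborel {0..1::real} *\<^sub>R (2 * \<Lambda>)) {0..1::real}"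
        by (rule has_integral_const_real)
      moreover have "measure lborel {0..1::real} = 1" by simp
      ultimately have const: "((\<lambda>t. 2 * \<Lambda>) has_integral 2 * \<Lambda>) {0..1::real}" by (simp only: scaleR_one)
      show ?thesis
        unfolding \<beta>_def
        by (intro has_integral_add const has_integral_mult_right integrable_integral norm_velocity_integrable X Y) auto
    qed
    have "cP * action (map_prod J1 J2) \<gamma> \<le> (integral {0..1} \<beta> / 2)\<^sup>2"
      unfolding cP_def
    proof (rule P.isoperimetric_inequality[OF P ac closed])
      show "\<beta> integrable_on {0..1}" using I by (rule has_integral_integrable)
      show "negligible (N1 \<union> N2 \<union> N3)" by (intro negligible_Un X Y N3)
      fix t z assume t: "t \<in> {0..1} - (N1 \<union> N2 \<union> N3)" and z: "z \<in> P"
      obtain a' b' k l where abkl: "a' \<in> {0..1}" "b' \<in> {0..1}" "k \<in> K" "l \<in> T" "z = (a' *\<^sub>R k, b' *\<^sub>R l)"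
        "a * a' * c1 + b * b' * c2 \<le> \<Lambda>"
        using mem[OF z] unfolding c1_def c2_def by blast
      have dX: "(X has_vector_derivative velocity X t) (at t)" and dY: "(Y has_vector_derivative velocity Y t) (at t)"
        using bspec[OF N3(2), of t] t by auto
      have "((\<lambda>t. (a *\<^sub>R X t, b *\<^sub>R Y t)) has_vector_derivative (a *\<^sub>R velocity X t, b *\<^sub>R velocity Y t)) (at t)"
        using dX dY by (auto intro!: derivative_eq_intros)
      then have vel: "velocity \<gamma> t = (a *\<^sub>R velocity X t, b *\<^sub>R velocity Y t)"
        unfolding \<gamma>_def by (rule vector_derivative_at)
      have "velocity X t \<bullet> J1 k \<le> 2 * c1 + e * (norm k0 * norm (velocity X t))" using X(5) t abkl by auto
      then have 1: "(a * a') * (velocity X t \<bullet> J1 k) \<le> (a * a') * (2 * c1 + e * (norm k0 * norm (velocity X t)))"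
        using ab abkl by (intro mult_left_mono) auto
      have "velocity Y t \<bullet> J2 l \<le> 2 * c2 + e * (norm l0 * norm (velocity Y t))" using Y(5) t abkl by auto
      then have 2: "(b * b') * (velocity Y t \<bullet> J2 l) \<le> (b * b') * (2 * c2 + e * (norm l0 * norm (velocity Y t)))"
        using ab abkl by (intro mult_left_mono) auto
      have "a * a' \<le> 1" "b * b' \<le> 1" using ab abkl by (auto intro: mult_le_one)
      then have "(a * a') * (e * (norm k0 * norm (velocity X t))) \<le> 1 * (e * (norm k0 * norm (velocity X t)))"
        "(b * b') * (e * (norm l0 * norm (velocity Y t))) \<le> 1 * (e * (norm l0 * norm (velocity Y t)))"
        using e by (intro mult_right_mono; simp)+
      then have "(a * a') * (velocity X t \<bullet> J1 k) + (b * b') * (velocity Y t \<bullet> J2 l) \<le>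
          2 * (a * a' * c1 + b * b' * c2) + e * (norm k0 * norm (velocity X t) + norm l0 * norm (velocity Y t))"
        using 1 2 by (simp add: algebra_simps)
      also have "\<dots> \<le> \<beta> t" using abkl(6) by (simp add: \<beta>_def)
      also have "(a * a') * (velocity X t \<bullet> J1 k) + (b * b') * (velocity Y t \<bullet> J2 l) = velocity \<gamma> t \<bullet> map_prod J1 J2 z"
        by (simp add: vel abkl(5) inner_prod_def A.J_scaleR B.J_scaleR)
      finally show "velocity \<gamma> t \<bullet> map_prod J1 J2 z \<le> \<beta> t" .
    qed
    also have "(integral {0..1} \<beta> / 2)\<^sup>2 \<le> (\<Lambda> + e * C / 2)\<^sup>2"
    proof (rule power_mono)
      have nonneg: "0 \<le> integral {0..1} (\<lambda>t. norm (velocity X t))" "0 \<le> integral {0..1} (\<lambda>t. norm (velocity Y t))"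
        by (intro integral_nonneg norm_velocity_integrable X Y; simp)+
      have "e * (norm k0 * integral {0..1} (\<lambda>t. norm (velocity X t)) +
        norm l0 * integral {0..1} (\<lambda>t. norm (velocity Y t))) \<le> e * C"
        unfolding C_def using X(6) Y(6) e by (intro mult_left_mono add_mono) auto
      then show "integral {0..1} \<beta> / 2 \<le> \<Lambda> + e * C / 2"
        using integral_unique[OF I] by simp
      have "0 \<le> e * (norm k0 * integral {0..1} (\<lambda>t. norm (velocity X t)) +
        norm l0 * integral {0..1} (\<lambda>t. norm (velocity Y t)))"
        using nonneg e by (intro mult_nonneg_nonneg add_nonneg_nonneg) auto
      then show "0 \<le> integral {0..1} \<beta> / 2"
        using integral_unique[OF I] \<Lambda>(1) by simp
    qed
    finally show ?thesis unfolding act .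
  qed
  have "((\<lambda>e. (\<Lambda> + e * C / 2)\<^sup>2) \<longlongrightarrow> (\<Lambda> + 0 * C / 2)\<^sup>2) (at_right 0)"
    by (intro tendsto_intros) auto
  moreover have "\<forall>\<^sub>F e in at_right 0. cP * \<Lambda> \<le> (\<Lambda> + e * C / 2)\<^sup>2"
    by (rule eventually_mono[OF eventually_at_right_real[OF zero_less_one]]) (use est in auto)
  ultimately have "cP * \<Lambda> \<le> (\<Lambda> + 0 * C / 2)\<^sup>2"
    by (intro tendsto_lowerbound[OF _ _ trivial_limit_at_right_real]) auto
  then show ?thesis using \<Lambda>(1) by (simp add: power2_eq_square cP_def)
qed

text \<open>The test curves \<open>(X, 0)\<close> and \<open>(0, Y)\<close> are optimal. For the lower bound both weights are 1, since for \<open>p \<ge> 2\<close> the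
quarter of the Euclidean unit disc lies in the unit ball of the p-norm.\<close>

theorem c_EHZ_p_product_ge_2:
  assumes K: "convex_body K" "0 \<in> K" and T: "convex_body T" "0 \<in> T" and p: "2 \<le> p"
  shows "c_EHZ (map_prod J1 J2) (p_product p K T) = min (c_EHZ J1 K) (c_EHZ J2 T)"
proof (rule antisym)
  have p1: "1 \<le> p" by (rule order_trans[OF _ p]) simp
  have cK: "convex K" and cT: "convex T" using K T by (auto simp: convex_body_def)
  have P: "convex_body (p_product p K T)" by (rule convex_body_p_product[OF K T p1])
  have pos: "c_EHZ J1 K > 0" "c_EHZ J2 T > 0" by (rule A.c_EHZ_pos B.c_EHZ_pos; fact)+
  have split: "\<exists>a'\<in>{0..1::real}. \<exists>b'\<in>{0..1::real}. \<exists>k\<in>K. \<exists>l\<in>T. z = (a' *\<^sub>R k, b' *\<^sub>R l) \<and>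
        a * a' * c_EHZ J1 K + b * b' * c_EHZ J2 T \<le> \<Lambda>"
    if "a * c_EHZ J1 K + b * c_EHZ J2 T = \<Lambda>" and z: "z \<in> p_product p K T" for a b \<Lambda> z
  proof -
    have "z \<in> K \<times> T" using p_product_subset_Times[OF cK K(2) cT T(2) p1] z by blast
    then show ?thesis
      using that(1) by (intro bexI[of _ 1] bexI[of _ "fst z"] bexI[of _ "snd z"]) auto
  qed
  have "c_EHZ (map_prod J1 J2) (p_product p K T) \<le> c_EHZ J1 K"
    by (rule c_EHZ_upper_bound[OF K T P, of 1 0]) (use pos split[of 1 0] in auto)
  moreover have "c_EHZ (map_prod J1 J2) (p_product p K T) \<le> c_EHZ J2 T"
    by (rule c_EHZ_upper_bound[OF K T P, of 0 1]) (use pos split[of 0 1] in auto)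
  ultimately show "c_EHZ (map_prod J1 J2) (p_product p K T) \<le> min (c_EHZ J1 K) (c_EHZ J2 T)" by simp
  have small: "s\<^sup>2 \<le> 1 \<Longrightarrow> s \<le> 1" for s :: real
    using abs_le_square_iff[of s 1] by simp
  show "min (c_EHZ J1 K) (c_EHZ J2 T) \<le> c_EHZ (map_prod J1 J2) (p_product p K T)"
  proof (rule c_EHZ_lower_bound[OF K T P, of _ 1 1])
    fix s1 s2 :: real and k l
    assume s: "0 \<le> s1" "0 \<le> s2" "1 * s1\<^sup>2 + 1 * s2\<^sup>2 = 1" and kl: "k \<in> K" "l \<in> T"
    have s1: "s1 \<le> 1" "s2 \<le> 1"
      by (rule small; use s(3) zero_le_power2[of s1] zero_le_power2[of s2] in linarith)+
    show "((1 * s1) *\<^sub>R k, (1 * s2) *\<^sub>R l) \<in> p_product p K T"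
    proof (cases "p = \<infinity>")
      case True
      have "s1 *\<^sub>R k \<in> K" using convexD_alt[OF cK K(2) kl(1) s(1) s1(1)] by simp
      moreover have "s2 *\<^sub>R l \<in> T" using convexD_alt[OF cT T(2) kl(2) s(2) s1(2)] by simp
      ultimately show ?thesis using True by (simp add: p_product_def)
    next
      case False
      then obtain r where r: "p = ereal r" "2 \<le> r" using p by (cases p) auto
      have "s1 powr r \<le> s1 powr 2" "s2 powr r \<le> s2 powr 2"
        using s s1 r by (intro powr_mono'; simp)+
      then have "s1 powr r + s2 powr r \<le> 1" using s by simp
      then show ?thesis
        unfolding r(1) using r(2) kl s
        by (subst p_product_mem_iff[OF cK K(2) cT T(2)])
          (simp, intro exI[of _ s1] exI[of _ s2] exI[of _ k] exI[of _ l], simp)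
    qed
  qed (use pos in auto)
qed

text \<open>The optimal test curve has \<open>a\<^sup>r + b\<^sup>r = 1\<close> and synchronised factors: the two normal components have to belong to one normal
vector of the p-product, which forces \<open>a powr (2 - r) * c1 = b powr (2 - r) * c2\<close>. The common value is \<open>\<Lambda>\<close>. The lower bound
uses the weights \<open>a powr (2 - r)\<close> and \<open>b powr (2 - r)\<close>, for which the required membership in the p-product is Hoelder's
inequality with exponents \<open>2 / (2 - r)\<close> and \<open>2 / r\<close>.\<close>

theorem c_EHZ_p_product_less_2:
  assumes K: "convex_body K" "0 \<in> K" and T: "convex_body T" "0 \<in> T" and r: "1 \<le> r" "r < 2"
  shows "c_EHZ (map_prod J1 J2) (p_product (ereal r) K T) =
    (c_EHZ J1 K powr (r / (r - 2)) + c_EHZ J2 T powr (r / (r - 2))) powr ((r - 2) / r)"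
proof -
  have cK: "convex K" and cT: "convex T" using K T by (auto simp: convex_body_def)
  have p1: "1 \<le> ereal r" using r by simp
  have P: "convex_body (p_product (ereal r) K T)" by (rule convex_body_p_product[OF K T p1])
  define c1 where "c1 = c_EHZ J1 K"
  define c2 where "c2 = c_EHZ J2 T"
  have pos: "c1 > 0" "c2 > 0" unfolding c1_def c2_def by (rule A.c_EHZ_pos B.c_EHZ_pos; fact)+
  define q where "q = r / (r - 2)"
  define S where "S = c1 powr q + c2 powr q"
  have S: "S > 0" unfolding S_def using pos by (intro add_pos_pos) auto
  define \<Lambda> where "\<Lambda> = S powr ((r - 2) / r)"
  have \<Lambda>: "\<Lambda> > 0" using S by (simp add: \<Lambda>_def)
  have \<Lambda>q: "\<Lambda> powr q = S"
    unfolding \<Lambda>_def q_def using r S by (simp add: powr_powr)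
  define a where "a = (\<Lambda> / c1) powr (1 / (2 - r))"
  define b where "b = (\<Lambda> / c2) powr (1 / (2 - r))"
  have ab0: "a > 0" "b > 0" using \<Lambda> pos by (auto simp: a_def b_def)
  have pw: "((\<Lambda> / c) powr (1 / (2 - r))) powr r = c powr q / S" if "c > 0" for c
  proof -
    have "((\<Lambda> / c) powr (1 / (2 - r))) powr r = (\<Lambda> / c) powr (- q)"
      using r by (simp add: powr_powr q_def minus_divide_right)
    also have "\<dots> = c powr q / \<Lambda> powr q"
      using \<Lambda> that by (simp add: powr_minus powr_divide)
    finally show ?thesis by (simp add: \<Lambda>q)
  qed
  have sum1: "a powr r + b powr r = 1"
    unfolding a_def b_def pw[OF pos(1)] pw[OF pos(2)] using S by (simp add: S_def add_divide_distrib[symmetric])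
  have w: "a powr (2 - r) = \<Lambda> / c1" "b powr (2 - r) = \<Lambda> / c2"
    unfolding a_def b_def using r \<Lambda> pos by (simp_all add: powr_powr)
  have le1: "a \<le> 1" "b \<le> 1"
  proof -
    have "a powr r \<le> 1" "b powr r \<le> 1"
      using sum1 powr_ge_zero[of a r] powr_ge_zero[of b r] by linarith+
    then show "a \<le> 1" "b \<le> 1"
      using ab0 r powr_le_one_imp_le_one[of r] by simp_all
  qed
  have sq: "x\<^sup>2 = x powr r * x powr (2 - r)" if "x > 0" for x :: real
    using that by (simp flip: powr_add)
  have tang: "x powr (r - 1) * x powr (2 - r) = x" if "x > 0" for x :: real
    using that by (simp flip: powr_add)
  have "c_EHZ (map_prod J1 J2) (p_product (ereal r) K T) \<le> \<Lambda>"
  proof (rule c_EHZ_upper_bound[OF K T P, of a b])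
    show "a\<^sup>2 * c_EHZ J1 K + b\<^sup>2 * c_EHZ J2 T = \<Lambda>"
    proof -
      have "a\<^sup>2 * c1 + b\<^sup>2 * c2 = \<Lambda> * (a powr r + b powr r)"
        unfolding sq[OF ab0(1)] sq[OF ab0(2)] w using pos by (simp add: algebra_simps)
      then show ?thesis by (simp add: sum1 c1_def c2_def)
    qed
    fix z assume "z \<in> p_product (ereal r) K T"
    then obtain a' b' k l where z: "0 \<le> a'" "0 \<le> b'" "a' powr r + b' powr r \<le> 1" "k \<in> K" "l \<in> T"
        "z = (a' *\<^sub>R k, b' *\<^sub>R l)"
      unfolding p_product_mem_iff[OF cK K(2) cT T(2) r(1)] by blast
    have le: "a' \<le> 1" "b' \<le> 1"
    proof -
      have "a' powr r \<le> 1" "b' powr r \<le> 1"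
        using z(3) powr_ge_zero[of a' r] powr_ge_zero[of b' r] by linarith+
      then show "a' \<le> 1" "b' \<le> 1"
        using z(1,2) r powr_le_one_imp_le_one[of r] by simp_all
    qed
    have "a * a' * c1 + b * b' * c2 = \<Lambda> * (a powr (r - 1) * a' + b powr (r - 1) * b')"
    proof -
      have "a * a' * c1 = (a powr (r - 1) * a powr (2 - r)) * a' * c1" by (simp add: tang[OF ab0(1)])
      also have "\<dots> = \<Lambda> * (a powr (r - 1) * a')" unfolding w using pos by simp
      finally have 1: "a * a' * c1 = \<Lambda> * (a powr (r - 1) * a')" .
      have "b * b' * c2 = (b powr (r - 1) * b powr (2 - r)) * b' * c2" by (simp add: tang[OF ab0(2)])
      also have "\<dots> = \<Lambda> * (b powr (r - 1) * b')" unfolding w using pos by simp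
      finally have 2: "b * b' * c2 = \<Lambda> * (b powr (r - 1) * b')" .
      show ?thesis unfolding 1 2 by (simp only: distrib_left)
    qed
    also have "\<dots> \<le> \<Lambda> * 1"
    proof (rule mult_left_mono)
      have "a powr (r - 1) * a' + b powr (r - 1) * b' \<le>
          ((1 - 1 / r) * a powr r + (1 / r) * a' powr r) + ((1 - 1 / r) * b powr r + (1 / r) * b' powr r)"
        using z ab0 r by (intro add_mono powr_tangent_le) auto
      also have "\<dots> = (1 - 1 / r) * (a powr r + b powr r) + (1 / r) * (a' powr r + b' powr r)"
        by (simp add: distrib_left)
      also have "\<dots> \<le> (1 - 1 / r) * 1 + (1 / r) * 1"
        using z r sum1 by (intro add_mono mult_left_mono) auto
      finally show "a powr (r - 1) * a' + b powr (r - 1) * b' \<le> 1" by simp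
    qed (use \<Lambda> in simp)
    finally show "\<exists>a'\<in>{0..1}. \<exists>b'\<in>{0..1}. \<exists>k\<in>K. \<exists>l\<in>T. z = (a' *\<^sub>R k, b' *\<^sub>R l) \<and>
        a * a' * c_EHZ J1 K + b * b' * c_EHZ J2 T \<le> \<Lambda>"
      using z le by (intro bexI[of _ a'] bexI[of _ b'] bexI[of _ k] bexI[of _ l]) (auto simp: c1_def c2_def)
  qed (use ab0 le1 \<Lambda> in auto)
  moreover have "\<Lambda> \<le> c_EHZ (map_prod J1 J2) (p_product (ereal r) K T)"
  proof (rule c_EHZ_lower_bound[OF K T P \<Lambda>, of "a powr (2 - r)" "b powr (2 - r)"])
    show "\<Lambda> \<le> a powr (2 - r) * c_EHZ J1 K" "\<Lambda> \<le> b powr (2 - r) * c_EHZ J2 T"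
      unfolding w using pos by (simp_all add: c1_def c2_def)
    fix s1 s2 :: real and k l
    assume s: "0 \<le> s1" "0 \<le> s2" "a powr (2 - r) * s1\<^sup>2 + b powr (2 - r) * s2\<^sup>2 = 1" and kl: "k \<in> K" "l \<in> T"
    have holder: "(x powr (2 - r) * s) powr r \<le> (1 - r / 2) * x powr r + (r / 2) * (x powr (2 - r) * s\<^sup>2)"
      if "x > 0" "s \<ge> 0" for x s :: real
    proof (cases "s = 0")
      case True
      then show ?thesis using r by simp
    next
      case False
      then have s: "s > 0" using that by simp
      have "(x powr r) powr (1 - r / 2) * (x powr (2 - r) * s\<^sup>2) powr (r / 2) \<le>
          (1 - r / 2) * x powr r + (r / 2) * (x powr (2 - r) * s\<^sup>2)"
        using r by (intro weighted_AM_GM) auto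
      moreover have "(x powr r) powr (1 - r / 2) * (x powr (2 - r) * s\<^sup>2) powr (r / 2) = (x powr (2 - r) * s) powr r"
      proof -
        have "(x powr (2 - r) * s\<^sup>2) powr (r / 2) = x powr ((2 - r) * (r / 2)) * (s powr 2) powr (r / 2)"
          using s by (simp add: powr_mult powr_powr)
        also have "(s powr 2) powr (r / 2) = s powr r" by (simp add: powr_powr)
        finally have "(x powr r) powr (1 - r / 2) * (x powr (2 - r) * s\<^sup>2) powr (r / 2) =
            x powr (r * (1 - r / 2) + (2 - r) * (r / 2)) * s powr r"
          by (simp add: powr_powr powr_add)
        also have "r * (1 - r / 2) + (2 - r) * (r / 2) = (2 - r) * r" by (simp add: field_simps)
        also have "x powr ((2 - r) * r) * s powr r = (x powr (2 - r) * s) powr r"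
          using s by (simp add: powr_mult powr_powr)
        finally show ?thesis .
      qed
      ultimately show ?thesis by simp
    qed
    have "(a powr (2 - r) * s1) powr r + (b powr (2 - r) * s2) powr r \<le>
        ((1 - r / 2) * a powr r + (r / 2) * (a powr (2 - r) * s1\<^sup>2)) +
        ((1 - r / 2) * b powr r + (r / 2) * (b powr (2 - r) * s2\<^sup>2))"
      by (intro add_mono holder ab0 s)
    also have "\<dots> = (1 - r / 2) * (a powr r + b powr r) +
        (r / 2) * (a powr (2 - r) * s1\<^sup>2 + b powr (2 - r) * s2\<^sup>2)"
      by (simp only: distrib_left add_ac)
    also have "\<dots> = 1" unfolding sum1 s(3) by simp
    finally show "((a powr (2 - r) * s1) *\<^sub>R k, (b powr (2 - r) * s2) *\<^sub>R l) \<in> p_product (ereal r) K T"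
      using kl s by (subst p_product_mem_iff[OF cK K(2) cT T(2) r(1)])
        (intro exI[of _ "a powr (2 - r) * s1"] exI[of _ "b powr (2 - r) * s2"] exI[of _ k] exI[of _ l], simp)
  qed auto
  ultimately show ?thesis
    by (simp add: \<Lambda>_def S_def c1_def c2_def q_def)
qed

end

theorem proposition1p5:
  fixes K :: "((real^'n) \<times> (real^'n)) set"
    and T :: "((real^'m) \<times> (real^'m)) set"
    and p :: ereal
  assumes "convex_body K" and "0 \<in> K"
    and "convex_body T" and "0 \<in> T"
    and "1 \<le> p"
  shows "c_EHZ (map_prod J_std J_std) (p_product p K T) =
    (if 2 \<le> p then min (c_EHZ J_std K) (c_EHZ J_std T)
     else let r = real_of_ereal p in
       (c_EHZ J_std K powr (r / (r - 2)) + c_EHZ J_std T powr (r / (r - 2))) powr ((r - 2) / r))"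
proof -
  interpret complex_structure_pair "J_std :: (real^'n) \<times> (real^'n) \<Rightarrow> _" "J_std :: (real^'m) \<times> (real^'m) \<Rightarrow> _"
    by (rule complex_structure_pair.intro) (rule complex_structure_J_std)+
  show ?thesis
  proof (cases "2 \<le> p")
    case True
    then show ?thesis using c_EHZ_p_product_ge_2[OF assms(1-4)] by simp
  next
    case False
    then obtain r where r: "p = ereal r" using assms(5) by (cases p) auto
    with False assms(5) have "1 \<le> r" "r < 2" by auto
    then show ?thesis
      using c_EHZ_p_product_less_2[OF assms(1-4)] False by (simp add: r)
  qed
qed

end
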